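(* Let $X$ be a real Banach space and let $f\colon C\to\mathbb R$ be a uniformly continuous function defined on a bounded closed convex set $C\subset X$. Consider the following statements: (i) $f$ is a uniform limit (on $C$) of $\mathcal{DC}$-bounded functions; (ii) $f$ is finitely dentable; (iii) $f$ is a uniform limit (on $C$) of $\mathcal{DC}$-Lipschitz functions; (iv) $f$ is countably dentable; (v) $f$ is $(\mathcal C\setminus\mathcal C)_\sigma$-measurable; (vi) $f$ is a pointwise limit of $\mathcal{DC}$-Lipschitz functions. Then (i) $\Leftrightarrow$ (ii) $\Leftrightarrow$ (iii) $\Rightarrow$ (iv) $\Rightarrow$ (v) $\Rightarrow$ (vi). Moreover, none of these last three implications can be reversed in general: (vi) $\not\Rightarrow$ (v), (v) $\not\Rightarrow$ (iv), and (iv) $\not\Rightarrow$ (iii), i.e. for each of these there are a real Banach space $X$, a bounded closed convex set $C\subset X$ and a uniformly continuous function $f\colon C\to\mathbb R$ for which the first statement holds and the second one fails.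
   Context: An open half-space of $X$ is a set $\{x\in X: x^*(x)>a\}$ with $x^*\in X^*$, $a\in\mathbb R$; $\mathbb H$ is the set of all of them. A map $f\colon C\to M$ into a metric space is dentable if for every nonempty bounded $A\subset C$ and $\varepsilon>0$ there is $H\in\mathbb H$ with $A\cap H\ne\emptyset$ and $\operatorname{diam}(f(A\cap H))<\varepsilon$. For a dentable map $f$ on a bounded closed convex set $C$, $D\subset C$ and $\varepsilon>0$, let $[D]'_\varepsilon=\{x\in D:\operatorname{diam}(f(D\cap H))>\varepsilon \text{ for all } H\in\mathbb H \text{ with } x\in H\}$. Define $[C]^0_\varepsilon=C$, $[C]^{\alpha+1}_\varepsilon=[[C]^\alpha_\varepsilon]'_\varepsilon$ and $[C]^\alpha_\varepsilon=\bigcap_{\beta<\alpha}[C]^\beta_\varepsilon$ for limit ordinals $\alpha$; let $\operatorname{Dz}(f,\varepsilon)=\inf\{\alpha:[C]^\alpha_\varepsilon=\emptyset\}$ (which exists by dentability of $f$). The dentable map $f$ is finitely dentable if $\operatorname{Dz}(f,\varepsilon)<\omega$ for every $\varepsilon>0$, and countably dentable if $\operatorname{Dz}(f,\varepsilon)<\omega_1$ for every $\varepsilon>0$. A function on $C$ is $\mathcal{DC}$ if it is the difference of two convex continuous functions on $C$; it is $\mathcal{DC}$-Lipschitz if it is the difference of two convex Lipschitz functions on $C$, and $\mathcal{DC}$-bounded if it is the difference of two bounded convex continuous functions on $C$. A set $D\subset X$ is a $(\mathcal C\setminus\mathcal C)_\sigma$-set if $D=\bigcup_{n=1}^\infty(A_n\setminus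 B_n)$ with $A_n,B_n$ closed convex subsets of $X$. A function $f\colon C\to\mathbb R$ is $(\mathcal C\setminus\mathcal C)_\sigma$-measurable if $f^{-1}(-\infty,r)$ and $f^{-1}(r,+\infty)$ are $(\mathcal C\setminus\mathcal C)_\sigma$-sets for each $r\in\mathbb R$. *)

theory Defs
  imports "HOL-Analysis.Analysis"
begin

unbundle cardinal_syntax

definition open_halfspaces :: "'a::real_normed_vector set set" where
  "open_halfspaces = {{x. blinfun_apply \<phi> x > a} | (\<phi> :: 'a \<Rightarrow>\<^sub>L real) (a :: real). True}"

text \<open>
  \<^const>\<open>diameter\<close> is real-valued and carries no information on unbounded sets, whose diameter is
  \<open>\<infinity>\<close>; hence the explicit boundedness clauses in the next two definitions.
\<close>

definition dentable :: "'a::real_normed_vector set \<Rightarrow> ('a \<Rightarrow> 'b::metric_space) \<Rightarrow> bool" where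
  "dentable C f \<longleftrightarrow>
     (\<forall>A \<epsilon>. A \<noteq> {} \<and> bounded A \<and> A \<subseteq> C \<and> \<epsilon> > 0 \<longrightarrow>
        (\<exists>H\<in>open_halfspaces. A \<inter> H \<noteq> {} \<and>
           bounded (f ` (A \<inter> H)) \<and> diameter (f ` (A \<inter> H)) < \<epsilon>))"

definition slice_derivative ::
    "('a::real_normed_vector \<Rightarrow> 'b::metric_space) \<Rightarrow> real \<Rightarrow> 'a set \<Rightarrow> 'a set" where
  "slice_derivative f \<epsilon> D =
     {x \<in> D. \<forall>H\<in>open_halfspaces. x \<in> H \<longrightarrow>
        \<not> bounded (f ` (D \<inter> H)) \<or> diameter (f ` (D \<inter> H)) > \<epsilon>}"

text \<open>
  Ordinals are represented by well-orders, compared by \<^const>\<open>ordLess\<close> and \<^const>\<open>ordLeq\<close>.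
  A nonempty well-order is of successor type iff it has a greatest element, and its predecessor is
  then obtained by removing that element. For a well-order \<open>r\<close> of type \<open>\<alpha>\<close>,
  \<open>derived_set f \<epsilon> C r\<close> is the set \<open>[C]\<close> with upper index \<open>\<alpha>\<close> and lower index \<open>\<epsilon>\<close>.
\<close>

definition is_greatest :: "'i rel \<Rightarrow> 'i \<Rightarrow> bool" where
  "is_greatest r m \<longleftrightarrow> m \<in> Field r \<and> (\<forall>i\<in>Field r. (i, m) \<in> r)"

definition pred_order :: "'i rel \<Rightarrow> 'i rel" where
  "pred_order r = Restr r (underS r (THE m. is_greatest r m))"

lemma pred_order_ordLess:
  assumes "Well_order r" "is_greatest r m"
  shows "pred_order r <o r"
proof -
  have anti: "antisym r"
    using assms(1) by (simp add: order_on_defs)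
  have "(THE m. is_greatest r m) = m"
    using assms(2) anti by (auto simp: is_greatest_def intro!: the_equality dest: antisymD)
  moreover have "Restr r (underS r m) <o r"
    by (rule underS_Restr_ordLess) (use assms in \<open>auto simp: is_greatest_def Field_def\<close>)
  ultimately show ?thesis by (simp add: pred_order_def)
qed

function derived_set ::
    "('a::real_normed_vector \<Rightarrow> 'b::metric_space) \<Rightarrow> real \<Rightarrow> 'a set \<Rightarrow> 'i rel \<Rightarrow> 'a set" where
  "derived_set f \<epsilon> C r =
     (if \<not> Well_order r \<or> Field r = {} then C
      else if \<exists>m. is_greatest r m then slice_derivative f \<epsilon> (derived_set f \<epsilon> C (pred_order r))
      else (\<Inter>s\<in>{s. s <o r}. derived_set f \<epsilon> C s))"
  by pat_completeness auto
termination
  by (relation "inv_image ordLess (\<lambda>(f, \<epsilon>, C, r). r)")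
     (auto simp: wf_ordLess pred_order_ordLess)

declare derived_set.simps [simp del]

text \<open>
  The least ordinal with empty derived set. Well-orders on subsets of the space suffice: for a
  dentable \<open>f\<close> on a bounded \<open>C\<close> every derivation step removes a point as long as the set is nonempty,
  so that the index has cardinality at most that of \<open>C\<close>. For maps that are not dentable the value is
  meaningless.
\<close>

definition Dz :: "'a::real_normed_vector set \<Rightarrow> ('a \<Rightarrow> 'b::metric_space) \<Rightarrow> real \<Rightarrow> 'a rel" where
  "Dz C f \<epsilon> =
     (SOME r. Well_order r \<and> derived_set f \<epsilon> C r = {} \<and>
        (\<forall>s :: 'a rel. Well_order s \<and> derived_set f \<epsilon> C s = {} \<longrightarrow> r \<le>o s))"

definition finitely_dentable ::
    "'a::real_normed_vector set \<Rightarrow> ('a \<Rightarrow> 'b::metric_space) \<Rightarrow> bool" where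
  "finitely_dentable C f \<longleftrightarrow> dentable C f \<and> (\<forall>\<epsilon>>0. Dz C f \<epsilon> <o natLeq)"

text \<open>\<^term>\<open>cardSuc natLeq\<close> is the initial ordinal \<open>\<omega>\<^sub>1\<close>.\<close>

definition countably_dentable ::
    "'a::real_normed_vector set \<Rightarrow> ('a \<Rightarrow> 'b::metric_space) \<Rightarrow> bool" where
  "countably_dentable C f \<longleftrightarrow> dentable C f \<and> (\<forall>\<epsilon>>0. Dz C f \<epsilon> <o cardSuc natLeq)"

definition DC_Lipschitz :: "'a::real_normed_vector set \<Rightarrow> ('a \<Rightarrow> real) \<Rightarrow> bool" where
  "DC_Lipschitz C f \<longleftrightarrow>
     (\<exists>g h. convex_on C g \<and> (\<exists>L. L-lipschitz_on C g) \<and>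
            convex_on C h \<and> (\<exists>L. L-lipschitz_on C h) \<and>
            (\<forall>x\<in>C. f x = g x - h x))"

definition DC_bounded :: "'a::real_normed_vector set \<Rightarrow> ('a \<Rightarrow> real) \<Rightarrow> bool" where
  "DC_bounded C f \<longleftrightarrow>
     (\<exists>g h. convex_on C g \<and> continuous_on C g \<and> bounded (g ` C) \<and>
            convex_on C h \<and> continuous_on C h \<and> bounded (h ` C) \<and>
            (\<forall>x\<in>C. f x = g x - h x))"

definition uniform_limit_of_DC_bounded :: "'a::real_normed_vector set \<Rightarrow> ('a \<Rightarrow> real) \<Rightarrow> bool" where
  "uniform_limit_of_DC_bounded C f \<longleftrightarrow>
     (\<exists>g. (\<forall>n. DC_bounded C (g n)) \<and> uniform_limit C g f sequentially)"

definition uniform_limit_of_DC_Lipschitz :: "'a::real_normed_vector set \<Rightarrow> ('a \<Rightarrow> real) \<Rightarrow> bool" where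
  "uniform_limit_of_DC_Lipschitz C f \<longleftrightarrow>
     (\<exists>g. (\<forall>n. DC_Lipschitz C (g n)) \<and> uniform_limit C g f sequentially)"

definition pointwise_limit_of_DC_Lipschitz :: "'a::real_normed_vector set \<Rightarrow> ('a \<Rightarrow> real) \<Rightarrow> bool" where
  "pointwise_limit_of_DC_Lipschitz C f \<longleftrightarrow>
     (\<exists>g. (\<forall>n. DC_Lipschitz C (g n)) \<and> (\<forall>x\<in>C. (\<lambda>n. g n x) \<longlonglongrightarrow> f x))"

definition CC_sigma :: "'a::real_normed_vector set \<Rightarrow> bool" where
  "CC_sigma D \<longleftrightarrow>
     (\<exists>A B :: nat \<Rightarrow> 'a set.
        (\<forall>n. closed (A n) \<and> convex (A n) \<and> closed (B n) \<and> convex (B n)) \<and>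
        D = (\<Union>n. A n - B n))"

definition CC_sigma_measurable :: "'a::real_normed_vector set \<Rightarrow> ('a \<Rightarrow> real) \<Rightarrow> bool" where
  "CC_sigma_measurable C f \<longleftrightarrow>
     (\<forall>r. CC_sigma {x \<in> C. f x < r} \<and> CC_sigma {x \<in> C. f x > r})"

text \<open>
  The Banach space \<open>\<ell>\<^sub>\<infinity>\<close> of bounded real sequences with the supremum norm (\<^typ>\<open>nat\<close> being
  discrete, continuity is no restriction). One cannot quantify existentially over types, so
  \<open>\<ell>\<^sub>\<infinity>\<close> is the ambient space of the counterexamples. It contains every separable
  Banach space isometrically, and by the Hahn-Banach theorem all the notions above are unaffected
  by passing from a closed subspace containing \<open>C\<close> to the whole space.
\<close>

instance bcontfun :: (metric_space, banach) banach ..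

type_synonym l_infty = "nat \<Rightarrow>\<^sub>C real"

end

theory Submission
  imports Defs "HOL-Library.Discrete_Functions"
begin

text \<open>
  If \<open>f\<close> is close to \<open>g - h\<close> with \<open>g, h \<ge> 0\<close> convex and bounded, then \<open>\<phi> = g\<^sup>2 + h\<^sup>2\<close> is convex and its
  midpoint defect \<open>\<phi> x + \<phi> y - 2 \<phi> ((x + y) / 2)\<close> is bounded below whenever \<open>f x\<close> and \<open>f y\<close> are far
  apart. On a slice where \<open>\<phi>\<close> is almost maximal the defect is small, so \<open>f\<close> oscillates little; hence
  (i) implies (ii). Conversely, the squared distances to the finitely many derived sets add up to a
  Lipschitz convex function with the same property, and an infimal convolution of \<open>f\<close> with its
  midpoint defect gives (iii). A countable derivation exhibits the preimages of open sets as countable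
  unions of sets \<open>D - (D - \<Union>\<H>)\<close> with \<open>\<H>\<close> a family of half-spaces, which is (v); and (v) implies (vi)
  by a Lebesgue-Hausdorff argument in the lattice of DC-Lipschitz functions.

  For (vi) without (v) take \<open>inf\<^sub>i \<bar>x i\<bar>\<close> on the unit ball of \<open>\<ell>\<^sub>\<infinity>\<close>. Fix the signs of a sequence outside an
  infinite set of coordinates. If a closed convex set meets all further such restrictions, it
  contains all sign sequences allowed, by averaging; as it then contains points with a vanishing
  coordinate, no set \<open>A - B\<close> on which the function is positive can resist, and a fusion argument yields
  a sign sequence outside countably many such sets. The other two examples are
  distances to the integer points with odd support in a subset of the unit ball of \<open>c\<^sub>0\<close>: in the whole
  ball these points form an infinite tree that no slice separates; if the supports are confined to
  finite blocks of unbounded size, the function is dentable, hence countably dentable by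
  separability, but arbitrarily long trees remain.
\<close>

section \<open>Separation of points from closed convex sets\<close>

text \<open>The notion \<open>midpoint_control\<close> links the first three statements: it can be
  read off from any approximation by \<open>DC_bounded\<close> functions, it yields dentability and
  finite derivations, and the distances to the derived sets give it back with a Lipschitz function
  in place of a merely continuous one. This is why boundedness improves to Lipschitz continuity. The
  only input from duality is the separation of a point from a closed convex set, obtained from
  minimal sublinear functionals. The ordinal index is measured by well-orders on the points of the
  space, whereas the counting arguments produce well-orders on sets of indices; hence
  \<open>derived_set\<close> has to be shown invariant under isomorphism across types. Separability
  shapes the examples. In a separable closed convex set every relatively open set is a countable
  union of closed convex pieces, so every continuous function satisfies (v). A failure of (v)
  therefore requires a nonseparable set, while inside \<open>c_0\<close> (v) is automatic and
  dentability alone implies (iv).\<close>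

definition sublinear :: "('a::real_vector \<Rightarrow> real) \<Rightarrow> bool" where
  "sublinear p \<longleftrightarrow> (\<forall>x y. p (x + y) \<le> p x + p y) \<and> (\<forall>t\<ge>0. \<forall>x. p (t *\<^sub>R x) = t * p x)"

lemma sublinear_add: "sublinear p \<Longrightarrow> p (x + y) \<le> p x + p y"
  and sublinear_scale: "sublinear p \<Longrightarrow> t \<ge> 0 \<Longrightarrow> p (t *\<^sub>R x) = t * p x"
  by (auto simp: sublinear_def)

lemma sublinear_zero: "sublinear p \<Longrightarrow> p 0 = 0"
  using sublinear_scale[of p 0 0] by simp

lemma sublinear_uminus: "sublinear p \<Longrightarrow> - p (- x) \<le> p x"
  using sublinear_add[of p x "- x"] sublinear_zero[of p] by simp

lemma sublinear_scaleI:
  fixes p :: "'a::real_vector \<Rightarrow> real"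
  assumes "\<And>t x. t > 0 \<Longrightarrow> p (t *\<^sub>R x) \<le> t * p x" "p 0 = 0" "t \<ge> 0"
  shows "p (t *\<^sub>R x) = t * p x"
proof (cases "t = 0")
  case False
  with assms(3) have t: "t > 0" by simp
  have "(1 / t) *\<^sub>R (t *\<^sub>R x) = x" using t by simp
  then have "p x \<le> (1 / t) * p (t *\<^sub>R x)" using assms(1)[of "1 / t" "t *\<^sub>R x"] t by simp
  then show ?thesis using assms(1)[of t x] t by (simp add: field_simps)
qed (simp add: assms)

text \<open>Zorn's lemma for the reversed pointwise order. The infimum of a chain stays finite
  because each member \<open>p \<le> q\<close> satisfies \<open>- q (- x) \<le> p x\<close>.\<close>

lemma minimal_sublinear_exists:
  assumes q: "sublinear q"
  obtains p where "sublinear p" "p \<le> q" "\<And>p'. sublinear p' \<Longrightarrow> p' \<le> p \<Longrightarrow> p' = p"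
proof -
  define A where "A = {p. sublinear p \<and> p \<le> q}"
  define P where "P = (\<lambda>a b :: 'a \<Rightarrow> real. b \<le> a)"
  have "\<exists>m\<in>A. \<forall>a\<in>A. P m a \<longrightarrow> a = m"
  proof (rule predicate_Zorn)
    show "partial_order_on A (relation_of P A)"
      by (rule partial_order_on_relation_ofI) (auto simp: P_def)
    fix \<C> assume "\<C> \<in> Chains (relation_of P A)"
    then have sub: "\<C> \<subseteq> A" and ch: "\<And>a b. a \<in> \<C> \<Longrightarrow> b \<in> \<C> \<Longrightarrow> a \<le> b \<or> b \<le> a"
      by (auto simp: Chains_def relation_of_def P_def)
    show "\<exists>u\<in>A. \<forall>a\<in>\<C>. P a u"
    proof (cases "\<C> = {}")
      case True
      then show ?thesis using q by (auto simp: A_def)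
    next
      case False
      define u where "u x = (INF p\<in>\<C>. p x)" for x
      have lb: "- q (- x) \<le> p x" if "p \<in> \<C>" for p x
      proof -
        from that sub have "sublinear p" "p (- x) \<le> q (- x)" by (auto simp: A_def le_fun_def)
        then show ?thesis using sublinear_uminus[of p x] by linarith
      qed
      have bdd: "bdd_below ((\<lambda>p. p x) ` \<C>)" for x
        using lb by (intro bdd_belowI2[where m = "- q (- x)"])
      have u_le: "u x \<le> p x" if "p \<in> \<C>" for p x
        unfolding u_def by (rule cINF_lower[OF bdd that])
      have u_ge: "c \<le> u x" if "\<And>p. p \<in> \<C> \<Longrightarrow> c \<le> p x" for c x
        unfolding u_def by (rule cINF_greatest[OF False that])
      have add: "u (x + y) \<le> u x + u y" for x y
      proof -
        \<comment> \<open>Members of a chain are comparable, so a single \<open>p\<close> below both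
          may be used for \<open>x\<close> and \<open>y\<close>.\<close>
        have *: "u (x + y) \<le> p1 x + p2 y" if "p1 \<in> \<C>" "p2 \<in> \<C>" for p1 p2
        proof -
          obtain p where p: "p \<in> \<C>" "p \<le> p1" "p \<le> p2"
            using ch[OF \<open>p1 \<in> \<C>\<close> \<open>p2 \<in> \<C>\<close>] \<open>p1 \<in> \<C>\<close> \<open>p2 \<in> \<C>\<close> by blast
          have "u (x + y) \<le> p x + p y"
            using u_le[OF p(1), of "x + y"] sublinear_add[of p x y] p(1) sub by (auto simp: A_def)
          also have "\<dots> \<le> p1 x + p2 y" using p(2,3) by (intro add_mono) (auto simp: le_fun_def)
          finally show ?thesis .
        qed
        have "u (x + y) - p2 y \<le> u x" if "p2 \<in> \<C>" for p2
          by (rule u_ge) (use *[OF _ that] in \<open>simp add: algebra_simps\<close>)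
        then have "u (x + y) - u x \<le> u y" by (intro u_ge) (simp add: algebra_simps)
        then show ?thesis by simp
      qed
      have p0: "p 0 = 0" if "p \<in> \<C>" for p using that sub sublinear_zero by (auto simp: A_def)
      have zero: "u 0 = 0"
      proof (rule antisym)
        show "u 0 \<le> 0" using u_le[of _ 0] p0 False by force
        show "0 \<le> u 0" by (rule u_ge) (simp add: p0)
      qed
      have "u (t *\<^sub>R x) \<le> t * u x" if "t > 0" for t x
      proof -
        have "u (t *\<^sub>R x) / t \<le> u x"
        proof (rule u_ge)
          fix p assume p: "p \<in> \<C>"
          then have "p (t *\<^sub>R x) = t * p x" using sub that by (intro sublinear_scale) (auto simp: A_def)
          with u_le[OF p, of "t *\<^sub>R x"] that show "u (t *\<^sub>R x) / t \<le> p x" by (simp add: field_simps)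
        qed
        then show ?thesis using that by (simp add: field_simps)
      qed
      then have "sublinear u"
        using add zero sublinear_scaleI[of u] by (simp add: sublinear_def)
      moreover have "u \<le> q"
      proof -
        obtain p where "p \<in> \<C>" using False by auto
        then have "u \<le> p" "p \<le> q" using u_le sub by (auto simp: le_fun_def A_def)
        then show ?thesis by simp
      qed
      ultimately show ?thesis using u_le by (auto simp: A_def P_def le_fun_def intro!: bexI[of _ u])
    qed
  qed
  then obtain m where m: "m \<in> A" "\<And>a. a \<in> A \<Longrightarrow> a \<le> m \<Longrightarrow> a = m" by (auto simp: P_def)
  show thesis
    by (rule that[of m]) (use m in \<open>auto simp: A_def intro: order_trans\<close>)
qed

text \<open>
  For fixed \<open>y\<close> the functional \<open>x \<mapsto> inf\<^sub>t p (x + t y) - t p y\<close> is sublinear and below \<open>p\<close>;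
  minimality forces equality, and \<open>t = 1\<close> gives superadditivity.
\<close>

lemma minimal_sublinear_additive:
  assumes p: "sublinear p" and min: "\<And>p'. sublinear p' \<Longrightarrow> p' \<le> p \<Longrightarrow> p' = p"
  shows "p (x + y) = p x + p y"
proof -
  define r where "r x = (INF t\<in>{0..}. p (x + t *\<^sub>R y) - t * p y)" for x
  have lb: "- p (- x) \<le> p (x + t *\<^sub>R y) - t * p y" if "t \<ge> 0" for t x
    using sublinear_add[OF p, of "x + t *\<^sub>R y" "- x"] sublinear_scale[OF p that, of y] by simp
  have bdd: "bdd_below ((\<lambda>t. p (x + t *\<^sub>R y) - t * p y) ` {0..})" for x
    using lb by (intro bdd_belowI2[where m = "- p (- x)"]) auto
  have r_le: "r x \<le> p (x + t *\<^sub>R y) - t * p y" if "t \<ge> 0" for t x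
    unfolding r_def by (rule cINF_lower[OF bdd]) (use that in auto)
  have r_ge: "c \<le> r x" if "\<And>t. t \<ge> 0 \<Longrightarrow> c \<le> p (x + t *\<^sub>R y) - t * p y" for c x
    unfolding r_def by (rule cINF_greatest) (use that in auto)
  have add: "r (x + x') \<le> r x + r x'" for x x'
  proof -
    have *: "r (x + x') \<le> (p (x + t *\<^sub>R y) - t * p y) + (p (x' + s *\<^sub>R y) - s * p y)"
      if "t \<ge> 0" "s \<ge> 0" for t s
      using r_le[of "t + s" "x + x'"] that sublinear_add[OF p, of "x + t *\<^sub>R y" "x' + s *\<^sub>R y"]
      by (simp add: algebra_simps)
    have "r (x + x') - (p (x' + s *\<^sub>R y) - s * p y) \<le> r x" if "s \<ge> 0" for s
      by (rule r_ge) (use *[OF _ that] in \<open>simp add: algebra_simps\<close>)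
    then have "r (x + x') - r x \<le> r x'" by (intro r_ge) (simp add: algebra_simps)
    then show ?thesis by simp
  qed
  have zero: "r 0 = 0"
  proof (rule antisym)
    show "r 0 \<le> 0" using r_le[of 0 0] sublinear_zero[OF p] by simp
    show "0 \<le> r 0" by (rule r_ge) (simp add: sublinear_scale[OF p])
  qed
  have "r (s *\<^sub>R x) \<le> s * r x" if "s > 0" for s x
  proof -
    have "r (s *\<^sub>R x) / s \<le> r x"
    proof (rule r_ge)
      fix t :: real assume t: "t \<ge> 0"
      have "r (s *\<^sub>R x) \<le> p (s *\<^sub>R x + (s * t) *\<^sub>R y) - (s * t) * p y"
        using t that by (intro r_le) simp
      also have "s *\<^sub>R x + (s * t) *\<^sub>R y = s *\<^sub>R (x + t *\<^sub>R y)" by (simp add: algebra_simps)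
      also have "p \<dots> = s * p (x + t *\<^sub>R y)" using that by (intro sublinear_scale[OF p]) simp
      finally show "r (s *\<^sub>R x) / s \<le> p (x + t *\<^sub>R y) - t * p y"
        using that by (simp add: field_simps)
    qed
    then show ?thesis using that by (simp add: field_simps)
  qed
  then have "sublinear r"
    using add zero sublinear_scaleI[of r] by (simp add: sublinear_def)
  moreover have "r \<le> p" using r_le[of 0] by (simp add: le_fun_def)
  ultimately have "r = p" by (rule min)
  then have "p x \<le> p (x + y) - p y" using r_le[of 1 x] by simp
  with sublinear_add[OF p, of x y] show ?thesis by simp
qed

text \<open>A minimal sublinear functional below \<open>q\<close> is additive, and additivity turns
  positive homogeneity into linearity through \<open>p (- x) = - p x\<close>.\<close>

theorem Hahn_Banach_sublinear:
  assumes q: "sublinear q"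
  obtains l where "linear l" "\<And>x. l x \<le> q x"
proof -
  obtain p where p: "sublinear p" "p \<le> q" and min: "\<And>p'. sublinear p' \<Longrightarrow> p' \<le> p \<Longrightarrow> p' = p"
    using minimal_sublinear_exists[OF q] by metis
  have add: "p (x + y) = p x + p y" for x y
    by (rule minimal_sublinear_additive[OF p(1) min])
  have neg: "p (- x) = - p x" for x
    using add[of x "- x"] sublinear_zero[OF p(1)] by simp
  have "p (t *\<^sub>R x) = t * p x" for t x
  proof (cases "t \<ge> 0")
    case False
    then have "p ((- t) *\<^sub>R (- x)) = (- t) * p (- x)" by (intro sublinear_scale[OF p(1)]) simp
    then show ?thesis by (simp add: neg)
  qed (rule sublinear_scale[OF p(1)])
  then have "linear p" by (intro linearI) (auto simp: add)
  then show thesis using p(2) by (auto simp: le_fun_def intro: that)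
qed

text \<open>
  The functional \<open>inf {\<parallel>y + t s\<parallel> - t d | t \<ge> 0, s \<in> S}\<close>, where \<open>d\<close> is the distance of \<open>S\<close> from
  the origin, is sublinear, dominated by the norm, and at most \<open>-d\<close> on \<open>-S\<close>.
\<close>

lemma convex_norm_separation:
  fixes S :: "'a::real_normed_vector set"
  assumes S: "convex S" "S \<noteq> {}" and d: "\<And>s. s \<in> S \<Longrightarrow> d \<le> norm s" "d \<ge> 0"
  obtains l where "linear l" "\<And>x. \<bar>l x\<bar> \<le> norm x" "\<And>s. s \<in> S \<Longrightarrow> d \<le> l s"
proof -
  define I where "I = {0::real..} \<times> S"
  define q where "q y = (INF (t, s)\<in>I. norm (y + t *\<^sub>R s) - t * d)" for y
  have Ine: "I \<noteq> {}" using S by (auto simp: I_def)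
  have lb: "- norm y \<le> norm (y + t *\<^sub>R s) - t * d" if "t \<ge> 0" "s \<in> S" for t s y
  proof -
    have "t * d \<le> norm (t *\<^sub>R s)" using d(1)[OF that(2)] that(1) by (simp add: mult_left_mono)
    also have "\<dots> \<le> norm (y + t *\<^sub>R s) + norm y"
      using norm_triangle_ineq4[of "y + t *\<^sub>R s" y] by simp
    finally show ?thesis by simp
  qed
  have bdd: "bdd_below ((\<lambda>(t, s). norm (y + t *\<^sub>R s) - t * d) ` I)" for y
    using lb by (intro bdd_belowI2[where m = "- norm y"]) (auto simp: I_def)
  have q_le: "q y \<le> norm (y + t *\<^sub>R s) - t * d" if "t \<ge> 0" "s \<in> S" for t s y
    unfolding q_def using cINF_lower[OF bdd, of "(t, s)" y] that by (simp add: I_def)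
  have q_ge: "c \<le> q y" if "\<And>t s. t \<ge> 0 \<Longrightarrow> s \<in> S \<Longrightarrow> c \<le> norm (y + t *\<^sub>R s) - t * d" for c y
    unfolding q_def by (rule cINF_greatest[OF Ine]) (use that in \<open>auto simp: I_def\<close>)
  have add: "q (y + y') \<le> q y + q y'" for y y'
  proof -
    have *: "q (y + y') \<le> (norm (y + t *\<^sub>R s) - t * d) + (norm (y' + t' *\<^sub>R s') - t' * d)"
      if "t \<ge> 0" "s \<in> S" "t' \<ge> 0" "s' \<in> S" for t s t' s'
    proof (cases "t + t' = 0")
      case True
      then have "t = 0" "t' = 0" using that by auto
      then show ?thesis using q_le[of 0 s "y + y'"] that norm_triangle_ineq[of y y'] by simp
    next
      case False
      \<comment> \<open>By convexity two multiples of points of \<open>S\<close> merge into one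
        multiple, with the coefficients adding up.\<close>
      define u where "u = (t / (t + t')) *\<^sub>R s + (t' / (t + t')) *\<^sub>R s'"
      have pos: "t + t' > 0" using False that by simp
      have "u \<in> S" unfolding u_def
        by (rule convexD[OF S(1)]) (use that pos in \<open>auto simp: add_divide_distrib[symmetric]\<close>)
      then have "q (y + y') \<le> norm (y + y' + (t + t') *\<^sub>R u) - (t + t') * d"
        using that by (intro q_le) auto
      moreover have "(t + t') *\<^sub>R u = t *\<^sub>R s + t' *\<^sub>R s'"
        using pos by (simp add: u_def scaleR_add_right)
      ultimately show ?thesis
        using norm_triangle_ineq[of "y + t *\<^sub>R s" "y' + t' *\<^sub>R s'"] by (simp add: algebra_simps)
    qed
    have "q (y + y') - (norm (y' + t' *\<^sub>R s') - t' * d) \<le> q y" if "t' \<ge> 0" "s' \<in> S" for t' s'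
      by (rule q_ge) (use *[OF _ _ that] in \<open>simp add: algebra_simps\<close>)
    then have "q (y + y') - q y \<le> q y'" by (intro q_ge) (simp add: algebra_simps)
    then show ?thesis by simp
  qed
  obtain s0 where s0: "s0 \<in> S" using S by auto
  have q_norm: "q y \<le> norm y" for y using q_le[of 0 s0 y] s0 by simp
  have zero: "q 0 = 0"
  proof (rule antisym)
    show "q 0 \<le> 0" using q_norm[of 0] by simp
    show "0 \<le> q 0" by (rule q_ge) (use lb[of _ _ 0] in simp)
  qed
  have "q (r *\<^sub>R y) \<le> r * q y" if "r > 0" for r y
  proof -
    have "q (r *\<^sub>R y) / r \<le> q y"
    proof (rule q_ge)
      fix t s assume t: "t \<ge> (0::real)" "s \<in> S"
      have "q (r *\<^sub>R y) \<le> norm (r *\<^sub>R y + (r * t) *\<^sub>R s) - (r * t) * d"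
        using t that by (intro q_le) auto
      also have "r *\<^sub>R y + (r * t) *\<^sub>R s = r *\<^sub>R (y + t *\<^sub>R s)" by (simp add: algebra_simps)
      also have "norm \<dots> = r * norm (y + t *\<^sub>R s)" using that by simp
      finally show "q (r *\<^sub>R y) / r \<le> norm (y + t *\<^sub>R s) - t * d"
        using that by (simp add: field_simps)
    qed
    then show ?thesis using that by (simp add: field_simps)
  qed
  then have "sublinear q"
    using add zero sublinear_scaleI[of q] by (simp add: sublinear_def)
  then obtain l where l: "linear l" "\<And>x. l x \<le> q x" by (rule Hahn_Banach_sublinear) blast
  have neg: "l (- x) = - l x" for x using linear_neg[OF l(1)] .
  have "\<bar>l x\<bar> \<le> norm x" for x
    using l(2)[of x] l(2)[of "- x"] q_norm[of x] q_norm[of "- x"] neg[of x] by (simp add: abs_le_iff)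
  moreover have "d \<le> l s" if "s \<in> S" for s
    using l(2)[of "- s"] q_le[of 1 s "- s"] that neg[of s] by simp
  ultimately show thesis using that l(1) by blast
qed

lemma open_halfspacesI [intro]:
  fixes \<phi> :: "'a::real_normed_vector \<Rightarrow>\<^sub>L real"
  shows "{x. blinfun_apply \<phi> x > a} \<in> open_halfspaces"
  by (auto simp: open_halfspaces_def)

lemma open_halfspacesE:
  assumes "H \<in> open_halfspaces"
  obtains \<phi> :: "'a::real_normed_vector \<Rightarrow>\<^sub>L real" and a where "H = {x. blinfun_apply \<phi> x > a}"
  using assms by (auto simp: open_halfspaces_def)

lemma UNIV_open_halfspaces [simp]: "UNIV \<in> open_halfspaces"
  using open_halfspacesI[of "-1" "0"] by simp

lemma open_open_halfspaces: "H \<in> open_halfspaces \<Longrightarrow> open H"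
  by (elim open_halfspacesE) (auto intro!: open_Collect_less continuous_intros)

lemma convex_open_halfspaces: "H \<in> open_halfspaces \<Longrightarrow> convex H"
  by (elim open_halfspacesE)
     (use convex_linear_vimage[of "blinfun_apply _" "{_<..}"] in
       \<open>auto simp: vimage_def bounded_linear.linear[OF blinfun.bounded_linear_right]\<close>)

lemma convex_Compl_open_halfspaces: "H \<in> open_halfspaces \<Longrightarrow> convex (- H)"
  by (elim open_halfspacesE)
     (use convex_linear_vimage[of "blinfun_apply _" "{.._}"] in
       \<open>auto simp: vimage_def Compl_eq not_less bounded_linear.linear[OF blinfun.bounded_linear_right]\<close>)

text \<open>Translating \<open>x\<close> to the origin turns its distance \<open>d\<close> from
  \<open>S\<close> into a lower bound on norms; a functional of norm at most 1 is then at least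
  \<open>d\<close> on the translate of \<open>S\<close>. Its sign is reversed because the half-space
  has to contain \<open>x\<close>.\<close>

lemma open_halfspaces_separation:
  fixes S :: "'a::real_normed_vector set"
  assumes S: "closed S" "convex S" and x: "x \<notin> S"
  obtains H where "H \<in> open_halfspaces" "x \<in> H" "H \<inter> S = {}"
proof (cases "S = {}")
  case True
  then show ?thesis using that[of UNIV] by simp
next
  case False
  define d where "d = infdist x S"
  have d: "d > 0" unfolding d_def using S(1) False x by (rule infdist_pos_not_in_closed)
  have "convex ((\<lambda>s. s - x) ` S)" using convex_translation_subtract[OF S(2)] by simp
  moreover have "d \<le> norm (s - x)" if "s \<in> S" for s
    using infdist_le[OF that, of x] by (simp add: d_def dist_norm norm_minus_commute)
  ultimately obtain l where l: "linear l" "\<And>x. \<bar>l x\<bar> \<le> norm x" "\<And>s. s \<in> S \<Longrightarrow> d \<le> l (s - x)"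
    using convex_norm_separation[of "(\<lambda>s. s - x) ` S" d] False d by (auto simp: image_iff) metis
  have "bounded_linear (\<lambda>y. - l y)"
    by (intro bounded_linear_intro[where K = 1])
       (use l in \<open>auto simp: linear_add linear_cmul\<close>)
  then have app: "blinfun_apply (Blinfun (\<lambda>y. - l y)) = (\<lambda>y. - l y)" by (simp add: bounded_linear_Blinfun_apply)
  show ?thesis
  proof (rule that)
    let ?H = "{y. blinfun_apply (Blinfun (\<lambda>y. - l y)) y > - l x - d}"
    show "?H \<in> open_halfspaces" by blast
    show "x \<in> ?H" using d by (simp add: app)
    show "?H \<inter> S = {}" using l(3) by (force simp: app linear_diff[OF l(1)])
  qed
qed

section \<open>Slices and midpoint defects\<close>

text \<open>Joining the boundedness clause to the real-valued \<open>diameter\<close> lets all later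
  arguments speak of pairs of points. The bound \<open>e \<ge> 0\<close> covers the empty set, whose
  diameter is 0.\<close>

lemma bounded_diameter_le_iff:
  fixes S :: "'a::metric_space set"
  assumes "e \<ge> 0"
  shows "bounded S \<and> diameter S \<le> e \<longleftrightarrow> (\<forall>x\<in>S. \<forall>y\<in>S. dist x y \<le> e)"
proof (intro iffI conjI ballI)
  fix x y assume "bounded S \<and> diameter S \<le> e" "x \<in> S" "y \<in> S"
  then show "dist x y \<le> e" using diameter_bounded_bound[of S x y] by linarith
next
  assume *: "\<forall>x\<in>S. \<forall>y\<in>S. dist x y \<le> e"
  then show "bounded S" by (auto simp: bounded_two_points)
  show "diameter S \<le> e"
    by (cases "S = {}") (use * assms in \<open>auto simp: diameter_def intro!: cSUP_least\<close>)
qed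

lemma slice_derivative_iff:
  assumes "e \<ge> 0"
  shows "x \<in> slice_derivative f e D \<longleftrightarrow>
    x \<in> D \<and> (\<forall>H\<in>open_halfspaces. x \<in> H \<longrightarrow> (\<exists>y\<in>D \<inter> H. \<exists>z\<in>D \<inter> H. dist (f y) (f z) > e))"
proof -
  have "\<not> bounded (f ` (D \<inter> H)) \<or> diameter (f ` (D \<inter> H)) > e \<longleftrightarrow>
      (\<exists>y\<in>D \<inter> H. \<exists>z\<in>D \<inter> H. dist (f y) (f z) > e)" for H
  proof -
    have "\<not> bounded (f ` (D \<inter> H)) \<or> diameter (f ` (D \<inter> H)) > e \<longleftrightarrow>
        \<not> (\<forall>x\<in>f ` (D \<inter> H). \<forall>y\<in>f ` (D \<inter> H). dist x y \<le> e)"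
      unfolding bounded_diameter_le_iff[OF assms, symmetric] by (simp add: not_le)
    also have "\<dots> \<longleftrightarrow> (\<exists>y\<in>D \<inter> H. \<exists>z\<in>D \<inter> H. dist (f y) (f z) > e)"
      by (simp only: ball_simps bex_simps not_le)
    finally show ?thesis .
  qed
  then show ?thesis unfolding slice_derivative_def by simp
qed

lemma not_in_slice_derivativeE:
  assumes "e \<ge> 0" "x \<in> D" "x \<notin> slice_derivative f e D"
  obtains H where "H \<in> open_halfspaces" "x \<in> H"
    "\<And>y z. y \<in> D \<Longrightarrow> y \<in> H \<Longrightarrow> z \<in> D \<Longrightarrow> z \<in> H \<Longrightarrow> dist (f y) (f z) \<le> e"
  using assms by (force simp: slice_derivative_iff)

lemma slice_derivative_subset: "slice_derivative f e D \<subseteq> D"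
  by (auto simp: slice_derivative_def)

lemma slice_derivative_mono:
  assumes "e \<ge> 0" "D \<subseteq> D'"
  shows "slice_derivative f e D \<subseteq> slice_derivative f e D'"
proof
  fix x assume x: "x \<in> slice_derivative f e D"
  show "x \<in> slice_derivative f e D'"
  proof (rule ccontr)
    assume "\<not> ?thesis"
    then obtain H where H: "H \<in> open_halfspaces" "x \<in> H"
      "\<And>y z. y \<in> D' \<Longrightarrow> y \<in> H \<Longrightarrow> z \<in> D' \<Longrightarrow> z \<in> H \<Longrightarrow> dist (f y) (f z) \<le> e"
      using not_in_slice_derivativeE[OF assms(1), of x D' f] x assms(2) slice_derivative_subset[of f e D]
      by blast
    obtain y z where "y \<in> D \<inter> H" "z \<in> D \<inter> H" "dist (f y) (f z) > e"
      using x H(1,2) unfolding slice_derivative_iff[OF assms(1)] by blast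
    then show False using H(3)[of y z] assms(2) by force
  qed
qed

text \<open>A derivation step cuts off all half-spaces of small oscillation at once. What remains is
  an intersection with complements of open half-spaces, hence closed and convex again when
  \<open>D\<close> is.\<close>

lemma slice_derivative_eq_Diff:
  assumes "e \<ge> 0"
  shows "slice_derivative f e D = D - \<Union> {H \<in> open_halfspaces. \<forall>y\<in>D \<inter> H. \<forall>z\<in>D \<inter> H. dist (f y) (f z) \<le> e}"
    (is "_ = D - \<Union> ?\<H>")
proof -
  have "x \<notin> slice_derivative f e D \<longleftrightarrow> x \<in> \<Union> ?\<H>" if "x \<in> D" for x
  proof
    assume "x \<notin> slice_derivative f e D"
    then show "x \<in> \<Union> ?\<H>" by (rule not_in_slice_derivativeE[OF assms that]) blast
  next
    assume "x \<in> \<Union> ?\<H>"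
    then obtain H where H: "H \<in> open_halfspaces" "x \<in> H" "\<forall>y\<in>D \<inter> H. \<forall>z\<in>D \<inter> H. dist (f y) (f z) \<le> e"
      by blast
    show "x \<notin> slice_derivative f e D"
    proof
      assume "x \<in> slice_derivative f e D"
      then obtain y z where "y \<in> D \<inter> H" "z \<in> D \<inter> H" "dist (f y) (f z) > e"
        using H(1,2) unfolding slice_derivative_iff[OF assms] by blast
      then show False using H(3) by force
    qed
  qed
  then show ?thesis using slice_derivative_subset[of f e D] by blast
qed

lemma Diff_open_halfspaces:
  assumes "\<H> \<subseteq> open_halfspaces"
  shows "closed D \<Longrightarrow> closed (D - \<Union>\<H>)" "convex D \<Longrightarrow> convex (D - \<Union>\<H>)"
proof -
  show "closed (D - \<Union>\<H>)" if "closed D"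
    using assms open_open_halfspaces by (intro closed_Diff that open_Union) auto
  have "D - \<Union>\<H> = D \<inter> (\<Inter>H\<in>\<H>. - H)" by auto
  then show "convex (D - \<Union>\<H>)" if "convex D"
    using that assms by (auto intro!: convex_Int convex_INT convex_Compl_open_halfspaces)
qed

lemma
  assumes "e \<ge> 0"
  shows closed_slice_derivative: "closed D \<Longrightarrow> closed (slice_derivative f e D)"
    and convex_slice_derivative: "convex D \<Longrightarrow> convex (slice_derivative f e D)"
  unfolding slice_derivative_eq_Diff[OF assms] by (intro Diff_open_halfspaces; blast)+

lemma dentableI:
  assumes "\<And>A e. A \<noteq> {} \<Longrightarrow> A \<subseteq> C \<Longrightarrow> e > 0 \<Longrightarrow>
    \<exists>H\<in>open_halfspaces. A \<inter> H \<noteq> {} \<and> (\<forall>y\<in>A \<inter> H. \<forall>z\<in>A \<inter> H. dist (f y) (f z) \<le> e)"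
  shows "dentable C f"
  unfolding dentable_def
proof (intro allI impI)
  fix A :: "'a set" and e :: real
  assume *: "A \<noteq> {} \<and> bounded A \<and> A \<subseteq> C \<and> e > 0"
  then obtain H where H: "H \<in> open_halfspaces" "A \<inter> H \<noteq> {}"
      "\<forall>y\<in>A \<inter> H. \<forall>z\<in>A \<inter> H. dist (f y) (f z) \<le> e / 2"
    using assms[of A "e / 2"] by auto
  then have "bounded (f ` (A \<inter> H)) \<and> diameter (f ` (A \<inter> H)) \<le> e / 2"
    using * by (subst bounded_diameter_le_iff) auto
  then show "\<exists>H\<in>open_halfspaces. A \<inter> H \<noteq> {} \<and> bounded (f ` (A \<inter> H)) \<and> diameter (f ` (A \<inter> H)) < e"
    using H * by (intro bexI[of _ H]) auto
qed

lemma dentableE: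
  assumes "dentable C f" "A \<noteq> {}" "bounded A" "A \<subseteq> C" "e > 0"
  obtains H where "H \<in> open_halfspaces" "A \<inter> H \<noteq> {}"
    "\<And>y z. y \<in> A \<Longrightarrow> y \<in> H \<Longrightarrow> z \<in> A \<Longrightarrow> z \<in> H \<Longrightarrow> dist (f y) (f z) \<le> e"
proof -
  obtain H where H: "H \<in> open_halfspaces" "A \<inter> H \<noteq> {}"
      "bounded (f ` (A \<inter> H))" "diameter (f ` (A \<inter> H)) < e"
    using assms unfolding dentable_def by meson
  then have "\<forall>x\<in>f ` (A \<inter> H). \<forall>y\<in>f ` (A \<inter> H). dist x y \<le> e"
    using assms(5) by (subst bounded_diameter_le_iff[symmetric]) auto
  then show ?thesis using H by (intro that[of H]) auto
qed

lemma convex_on_midpoint: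
  assumes "convex_on C \<phi>" "x \<in> C" "y \<in> C"
  shows "midpoint x y \<in> C" "2 * \<phi> (midpoint x y) \<le> \<phi> x + \<phi> y"
proof -
  show "midpoint x y \<in> C"
    using convexD[OF convex_on_imp_convex[OF assms(1)] assms(2,3), of "1/2" "1/2"]
    by (simp add: midpoint_def scaleR_add_right)
  have "\<phi> ((1 - 1/2) *\<^sub>R x + (1/2) *\<^sub>R y) \<le> (1 - 1/2) * \<phi> x + (1/2) * \<phi> y"
    by (rule convex_onD[OF assms(1) _ _ assms(2,3)]) auto
  then show "2 * \<phi> (midpoint x y) \<le> \<phi> x + \<phi> y" by (simp add: midpoint_def scaleR_add_right)
qed

text \<open>The sublevel set is closed and convex, so \<open>x\<close> can be separated from
  it.\<close>

lemma superlevel_slice: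
  fixes \<phi> :: "'a::real_normed_vector \<Rightarrow> real"
  assumes C: "closed C" "convex_on C \<phi>" "continuous_on C \<phi>" and x: "x \<in> C" "\<phi> x > c"
  obtains H where "H \<in> open_halfspaces" "x \<in> H" "\<And>y. y \<in> C \<Longrightarrow> y \<in> H \<Longrightarrow> \<phi> y > c"
proof -
  let ?S = "{y \<in> C. \<phi> y \<le> c}"
  have "closed ?S"
    using continuous_closed_preimage[OF C(3,1), of "{..c}"] by (simp add: vimage_def Int_def)
  moreover have "convex ?S"
  proof (rule convexI)
    fix x y u v assume *: "x \<in> ?S" "y \<in> ?S" "0 \<le> u" "0 \<le> v" "u + v = (1::real)"
    have "\<phi> (u *\<^sub>R x + v *\<^sub>R y) \<le> u * \<phi> x + v * \<phi> y" using C(2) * by (simp add: convex_on_def)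
    also have "\<dots> \<le> c" using * by (intro convex_bound_le) auto
    finally show "u *\<^sub>R x + v *\<^sub>R y \<in> ?S"
      using convexD[OF convex_on_imp_convex[OF C(2)]] * by simp
  qed
  moreover have "x \<notin> ?S" using x by simp
  ultimately obtain H where "H \<in> open_halfspaces" "x \<in> H" "H \<inter> ?S = {}"
    by (rule open_halfspaces_separation) blast
  then show thesis by (intro that[of H]) (auto simp: disjoint_iff not_le)
qed

text \<open>Separation takes place inside \<open>C\<close>, not inside \<open>D\<close>: the set
  \<open>D\<close> may fail to be convex, and the midpoint of two points of the slice has to belong
  only to \<open>C\<close> for \<phi> to exceed \<open>s - \<delta>\<close> there.\<close>

lemma almost_maximal_slice:
  fixes \<phi> :: "'a::real_normed_vector \<Rightarrow> real"
  assumes C: "closed C" "convex_on C \<phi>" "continuous_on C \<phi>"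
    and D: "D \<subseteq> C" "\<And>y. y \<in> D \<Longrightarrow> \<phi> y \<le> s" and x: "x \<in> D" "\<phi> x > s - \<delta>"
  obtains H where "H \<in> open_halfspaces" "x \<in> H"
    "\<And>y. y \<in> D \<Longrightarrow> y \<in> H \<Longrightarrow> \<phi> y > s - \<delta>"
    "\<And>y z. y \<in> D \<Longrightarrow> y \<in> H \<Longrightarrow> z \<in> D \<Longrightarrow> z \<in> H \<Longrightarrow> \<phi> y + \<phi> z - 2 * \<phi> (midpoint y z) < 2 * \<delta>"
proof -
  obtain H where H: "H \<in> open_halfspaces" "x \<in> H" "\<And>y. y \<in> C \<Longrightarrow> y \<in> H \<Longrightarrow> \<phi> y > s - \<delta>"
    using superlevel_slice[OF C _ x(2)] x(1) D(1) by blast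
  show thesis
  proof (rule that[OF H(1,2)])
    show "\<phi> y > s - \<delta>" if "y \<in> D" "y \<in> H" for y using H(3) that D(1) by auto
    fix y z assume yz: "y \<in> D" "y \<in> H" "z \<in> D" "z \<in> H"
    have "midpoint y z \<in> H"
      using convexD[OF convex_open_halfspaces[OF H(1)] yz(2,4), of "1/2" "1/2"]
      by (simp add: midpoint_def scaleR_add_right)
    moreover have "midpoint y z \<in> C" using convex_on_midpoint(1)[OF C(2)] yz D(1) by auto
    ultimately have "\<phi> (midpoint y z) > s - \<delta>" by (intro H(3))
    then show "\<phi> y + \<phi> z - 2 * \<phi> (midpoint y z) < 2 * \<delta>"
      using D(2)[OF yz(1)] D(2)[OF yz(3)] by linarith
  qed
qed

text \<open>Uniform convexity of \<phi> at a single scale, with the oscillation of \<open>f\<close>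
  in place of the distance of the points. Regularity of \<phi> is left open: some uses have it
  continuous and bounded, others Lipschitz.\<close>

definition midpoint_control :: "'a::real_normed_vector set \<Rightarrow> ('a \<Rightarrow> 'b::metric_space) \<Rightarrow> real \<Rightarrow> ('a \<Rightarrow> real) \<Rightarrow> bool" where
  "midpoint_control C f \<epsilon> \<phi> \<longleftrightarrow> convex_on C \<phi> \<and>
     (\<exists>\<delta>>0. \<forall>x\<in>C. \<forall>y\<in>C. dist (f x) (f y) > \<epsilon> \<longrightarrow> \<delta> \<le> \<phi> x + \<phi> y - 2 * \<phi> (midpoint x y))"

text \<open>Where \<phi> comes within \<delta> / 2 of its supremum over \<open>A\<close>, all
  midpoint defects are below \<delta>.\<close>

lemma midpoint_control_dentable:
  assumes C: "closed C"
    and ex: "\<And>\<epsilon>. \<epsilon> > 0 \<Longrightarrow> \<exists>\<phi>. midpoint_control C f \<epsilon> \<phi> \<and> continuous_on C \<phi> \<and> bounded (\<phi> ` C)"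
  shows "dentable C f"
proof (rule dentableI)
  fix A e assume A: "A \<noteq> {}" "A \<subseteq> C" and e: "(e::real) > 0"
  obtain \<phi> \<delta> where \<phi>: "convex_on C \<phi>" "continuous_on C \<phi>" "bounded (\<phi> ` C)" and \<delta>: "\<delta> > 0"
    and ctrl: "\<And>x y. x \<in> C \<Longrightarrow> y \<in> C \<Longrightarrow> dist (f x) (f y) > e \<Longrightarrow> \<delta> \<le> \<phi> x + \<phi> y - 2 * \<phi> (midpoint x y)"
    using ex[OF e] unfolding midpoint_control_def by auto
  have "bdd_above (\<phi> ` A)" using \<phi>(3) A(2) by (meson bounded_imp_bdd_above bounded_subset image_mono)
  then have le: "\<phi> y \<le> Sup (\<phi> ` A)" if "y \<in> A" for y using that by (auto intro: cSUP_upper)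
  obtain x where x: "x \<in> A" "\<phi> x > Sup (\<phi> ` A) - \<delta> / 2"
    using less_cSupD[of "\<phi> ` A" "Sup (\<phi> ` A) - \<delta> / 2"] A(1) \<delta> by auto
  obtain H where H: "H \<in> open_halfspaces" "x \<in> H"
    "\<And>y z. y \<in> A \<Longrightarrow> y \<in> H \<Longrightarrow> z \<in> A \<Longrightarrow> z \<in> H \<Longrightarrow> \<phi> y + \<phi> z - 2 * \<phi> (midpoint y z) < 2 * (\<delta> / 2)"
    by (rule almost_maximal_slice[OF C \<phi>(1,2) A(2) le x]) blast+
  show "\<exists>H\<in>open_halfspaces. A \<inter> H \<noteq> {} \<and> (\<forall>y\<in>A \<inter> H. \<forall>z\<in>A \<inter> H. dist (f y) (f z) \<le> e)"
  proof (intro bexI[OF _ H(1)] conjI ballI)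
    show "A \<inter> H \<noteq> {}" using x H by auto
    fix y z assume "y \<in> A \<inter> H" "z \<in> A \<inter> H"
    then show "dist (f y) (f z) \<le> e" using H(3)[of y z] ctrl[of y z] A(2) by force
  qed
qed

text \<open>Each derivation step lowers the upper bound of \<phi> by \<delta> / 2, since a slice of
  points above the new bound has defects below \<delta> and so oscillation at most \<epsilon>. A
  bounded \<phi> allows only finitely many such steps.\<close>

lemma midpoint_control_slice_derivative_funpow:
  assumes C: "closed C" and \<epsilon>: "\<epsilon> \<ge> 0"
    and \<phi>: "midpoint_control C f \<epsilon> \<phi>" "continuous_on C \<phi>" "bounded (\<phi> ` C)"
  shows "\<exists>n. (slice_derivative f \<epsilon> ^^ n) C = {}"
proof -
  obtain \<delta> where conv: "convex_on C \<phi>" and \<delta>: "\<delta> > 0"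
    and ctrl: "\<And>x y. x \<in> C \<Longrightarrow> y \<in> C \<Longrightarrow> dist (f x) (f y) > \<epsilon> \<Longrightarrow> \<delta> \<le> \<phi> x + \<phi> y - 2 * \<phi> (midpoint x y)"
    using \<phi> unfolding midpoint_control_def by auto
  obtain M where M: "\<And>x. x \<in> C \<Longrightarrow> \<bar>\<phi> x\<bar> \<le> M" using \<phi>(3) by (auto simp: bounded_iff)
  have "(slice_derivative f \<epsilon> ^^ n) C \<subseteq> {x \<in> C. \<phi> x \<le> M - real n * (\<delta> / 2)}" for n
  proof (induction n)
    case 0
    then show ?case using M by (auto simp: abs_le_iff)
  next
    case (Suc n)
    let ?D = "{x \<in> C. \<phi> x \<le> M - real n * (\<delta> / 2)}"
    have "(slice_derivative f \<epsilon> ^^ Suc n) C \<subseteq> slice_derivative f \<epsilon> ?D"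
      using slice_derivative_mono[OF \<epsilon> Suc] by simp
    also have "\<dots> \<subseteq> {x \<in> C. \<phi> x \<le> M - real (Suc n) * (\<delta> / 2)}"
    proof
      fix x assume x: "x \<in> slice_derivative f \<epsilon> ?D"
      show "x \<in> {x \<in> C. \<phi> x \<le> M - real (Suc n) * (\<delta> / 2)}"
      proof (rule ccontr)
        assume "\<not> ?thesis"
        moreover have xD: "x \<in> ?D" using x slice_derivative_subset[of f \<epsilon> ?D] by blast
        ultimately have "\<phi> x > M - real (Suc n) * (\<delta> / 2)" by auto
        then have "\<phi> x > M - real n * (\<delta> / 2) - \<delta> / 2" by (simp add: field_simps)
        then obtain H where H: "H \<in> open_halfspaces" "x \<in> H"
          "\<And>y z. y \<in> ?D \<Longrightarrow> y \<in> H \<Longrightarrow> z \<in> ?D \<Longrightarrow> z \<in> H \<Longrightarrow> \<phi> y + \<phi> z - 2 * \<phi> (midpoint y z) < 2 * (\<delta> / 2)"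
          by - (rule almost_maximal_slice[OF C conv \<phi>(2) _ _ xD, of "M - real n * (\<delta> / 2)" "\<delta> / 2"];
              blast)
        moreover obtain y z where "y \<in> ?D \<inter> H" "z \<in> ?D \<inter> H" "dist (f y) (f z) > \<epsilon>"
          using x H(1,2) unfolding slice_derivative_iff[OF \<epsilon>] by blast
        ultimately show False using ctrl[of y z] by fastforce
      qed
    qed
    finally show ?case .
  qed
  moreover obtain n where "2 * M + 1 < real n * (\<delta> / 2)"
    using reals_Archimedean3[of "\<delta> / 2"] \<delta> half_gt_zero by blast
  then have "{x \<in> C. \<phi> x \<le> M - real n * (\<delta> / 2)} = {}" using M by force
  ultimately show ?thesis by blast
qed

text \<open>
  For nonnegative convex functions the squares are convex with midpoint defect at least
  \<open>(g x - g y)\<^sup>2 / 2\<close>.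
\<close>

lemma convex_on_square:
  fixes g :: "'a::real_vector \<Rightarrow> real"
  assumes g: "convex_on C g" and pos: "\<And>x. x \<in> C \<Longrightarrow> g x \<ge> 0"
  shows "convex_on C (\<lambda>x. (g x)\<^sup>2)"
  unfolding convex_on_def
proof (intro conjI ballI allI impI)
  show C: "convex C" using convex_on_imp_convex[OF g] .
  fix x y and u v :: real assume *: "x \<in> C" "y \<in> C" "0 \<le> u" "0 \<le> v" "u + v = 1"
  have "g (u *\<^sub>R x + v *\<^sub>R y) \<le> u * g x + v * g y" using g * by (simp add: convex_on_def)
  then have "(g (u *\<^sub>R x + v *\<^sub>R y))\<^sup>2 \<le> (u * g x + v * g y)\<^sup>2"
    using convexD[OF C *] pos by (intro power_mono) auto
  also have "\<dots> = u * (g x)\<^sup>2 + v * (g y)\<^sup>2 - u * v * (g x - g y)\<^sup>2"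
  proof -
    have v: "v = 1 - u" using * by simp
    show ?thesis unfolding v by (simp add: power2_eq_square algebra_simps)
  qed
  also have "\<dots> \<le> u * (g x)\<^sup>2 + v * (g y)\<^sup>2" using * by simp
  finally show "(g (u *\<^sub>R x + v *\<^sub>R y))\<^sup>2 \<le> u * (g x)\<^sup>2 + v * (g y)\<^sup>2" .
qed

lemma square_midpoint_defect:
  fixes g :: "'a::real_vector \<Rightarrow> real"
  assumes g: "convex_on C g" and pos: "\<And>x. x \<in> C \<Longrightarrow> g x \<ge> 0" and xy: "x \<in> C" "y \<in> C"
  shows "(g x - g y)\<^sup>2 / 2 \<le> (g x)\<^sup>2 + (g y)\<^sup>2 - 2 * (g (midpoint x y))\<^sup>2"
proof -
  have "2 * g (midpoint x y) \<le> g x + g y" "0 \<le> g (midpoint x y)"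
    using convex_on_midpoint[OF g xy] pos by auto
  then have "(2 * g (midpoint x y))\<^sup>2 \<le> (g x + g y)\<^sup>2" by (intro power_mono) auto
  then show ?thesis by (simp add: power2_eq_square field_simps)
qed

lemma uniform_limit_of_DC_bounded_midpoint_control:
  assumes f: "uniform_limit_of_DC_bounded C f" and \<epsilon>: "\<epsilon> > 0"
  obtains \<phi> where "midpoint_control C f \<epsilon> \<phi>" "continuous_on C \<phi>" "bounded (\<phi> ` C)"
proof -
  obtain u where u: "\<And>n. DC_bounded C (u n)" "uniform_limit C u f sequentially"
    using f unfolding uniform_limit_of_DC_bounded_def by auto
  obtain n where n: "\<And>x. x \<in> C \<Longrightarrow> dist (u n x) (f x) < \<epsilon> / 4"
    using uniform_limitD[OF u(2), of "\<epsilon> / 4"] \<epsilon> by (auto simp: eventually_sequentially)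
  obtain g h where gh: "convex_on C g" "continuous_on C g" "bounded (g ` C)"
      "convex_on C h" "continuous_on C h" "bounded (h ` C)" "\<And>x. x \<in> C \<Longrightarrow> u n x = g x - h x"
    using u(1)[of n] unfolding DC_bounded_def by auto
  obtain G where G: "\<And>x. x \<in> C \<Longrightarrow> \<bar>g x\<bar> \<le> G" using gh(3) by (auto simp: bounded_iff)
  obtain K where K: "\<And>x. x \<in> C \<Longrightarrow> \<bar>h x\<bar> \<le> K" using gh(6) by (auto simp: bounded_iff)
  \<comment> \<open>The constants make both functions nonnegative, as squaring requires, and cancel
    in differences of values.\<close>
  define g' h' where "g' x = g x + G" and "h' x = h x + K" for x
  define \<phi> where "\<phi> x = (g' x)\<^sup>2 + (h' x)\<^sup>2" for x
  have C: "convex C" using convex_on_imp_convex gh(1) by blast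
  have cg: "convex_on C g'" and ch: "convex_on C h'"
    unfolding g'_def h'_def by (auto intro!: convex_on_add gh simp: convex_on_const C)
  have pg: "g' x \<ge> 0" "g' x \<le> 2 * G" and ph: "h' x \<ge> 0" "h' x \<le> 2 * K" if "x \<in> C" for x
    using G[OF that] K[OF that] by (auto simp: g'_def h'_def abs_le_iff)
  show thesis
  proof (rule that)
    show "continuous_on C \<phi>" unfolding \<phi>_def g'_def h'_def by (intro continuous_intros gh)
    have "\<bar>\<phi> x\<bar> \<le> (2 * G)\<^sup>2 + (2 * K)\<^sup>2" if "x \<in> C" for x
      using power_mono[OF pg(2,1)[OF that], of 2] power_mono[OF ph(2,1)[OF that], of 2] by (simp add: \<phi>_def)
    then show "bounded (\<phi> ` C)" by (auto simp: bounded_iff)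
    show "midpoint_control C f \<epsilon> \<phi>"
      unfolding midpoint_control_def
    \<comment> \<open>Two errors of \<epsilon> / 4 leave a jump above \<epsilon> / 2 for
      \<open>u n\<close>, hence one above \<epsilon> / 4 for \<open>g'\<close> or \<open>h'\<close>;
      half the square of \<epsilon> / 4 is the constant.\<close>
    proof (intro conjI exI[of _ "\<epsilon>\<^sup>2 / 32"] ballI impI)
      show "convex_on C \<phi>" unfolding \<phi>_def using pg ph
        by (intro convex_on_add convex_on_square cg ch) auto
      show "\<epsilon>\<^sup>2 / 32 > 0" using \<epsilon> by simp
      fix x y assume xy: "x \<in> C" "y \<in> C" and d: "dist (f x) (f y) > \<epsilon>"
      have "\<bar>u n x - u n y\<bar> > \<epsilon> / 2" using n[OF xy(1)] n[OF xy(2)] d unfolding dist_real_def by linarith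
      moreover have "u n x - u n y = (g' x - g' y) - (h' x - h' y)"
        using gh(7) xy by (simp add: g'_def h'_def)
      ultimately have "\<bar>g' x - g' y\<bar> > \<epsilon> / 4 \<or> \<bar>h' x - h' y\<bar> > \<epsilon> / 4" by linarith
      then have "(\<epsilon> / 4)\<^sup>2 \<le> (g' x - g' y)\<^sup>2 + (h' x - h' y)\<^sup>2"
      proof
        assume "\<bar>g' x - g' y\<bar> > \<epsilon> / 4"
        then have "(\<epsilon> / 4)\<^sup>2 \<le> \<bar>g' x - g' y\<bar>\<^sup>2" using \<epsilon> by (intro power_mono) auto
        then show ?thesis by (simp add: add_increasing2)
      next
        assume "\<bar>h' x - h' y\<bar> > \<epsilon> / 4"
        then have "(\<epsilon> / 4)\<^sup>2 \<le> \<bar>h' x - h' y\<bar>\<^sup>2" using \<epsilon> by (intro power_mono) auto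
        then show ?thesis by (simp add: add_increasing)
      qed
      then have "\<epsilon>\<^sup>2 / 32 \<le> (g' x - g' y)\<^sup>2 / 2 + (h' x - h' y)\<^sup>2 / 2" by (simp add: power_divide)
      also have "\<dots> \<le> \<phi> x + \<phi> y - 2 * \<phi> (midpoint x y)"
        using square_midpoint_defect[OF cg pg(1) xy] square_midpoint_defect[OF ch ph(1) xy]
        by (simp add: \<phi>_def)
      finally show "\<epsilon>\<^sup>2 / 32 \<le> \<phi> x + \<phi> y - 2 * \<phi> (midpoint x y)" .
    qed
  qed
qed

section \<open>Uniform approximation\<close>

text \<open>The segment from \<open>a\<close> to any point splits into \<open>N\<close> pieces
  shorter than \<open>d\<close>, with \<open>N\<close> depending only on the radius;
  \<open>f\<close> changes by less than 1 on each.\<close>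

lemma uniformly_continuous_on_convex_bounded_image:
  fixes f :: "'a::real_normed_vector \<Rightarrow> 'b::metric_space"
  assumes C: "convex C" "bounded C" and f: "uniformly_continuous_on C f"
  shows "bounded (f ` C)"
proof (cases "C = {}")
  case False
  then obtain a where a: "a \<in> C" by auto
  obtain d where d: "d > 0" "\<And>x y. x \<in> C \<Longrightarrow> y \<in> C \<Longrightarrow> dist x y < d \<Longrightarrow> dist (f x) (f y) < 1"
    using uniformly_continuous_onE[OF f, of 1] by (auto simp: dist_commute)
  obtain R where R: "\<And>x. x \<in> C \<Longrightarrow> dist a x \<le> R"
    using C(2) bounded_any_center[of C a] by auto
  obtain N where N: "real N > R / d" "N > 0"
    using reals_Archimedean2[of "max (R / d) 1"] by (auto simp: less_max_iff_disj)
  have "dist (f a) (f x) \<le> real N" if x: "x \<in> C" for x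
  proof -
    define p where "p k = a + (real k / real N) *\<^sub>R (x - a)" for k :: nat
    have pC: "p k \<in> C" if "k \<le> N" for k
    proof -
      have "p k = (1 - real k / real N) *\<^sub>R a + (real k / real N) *\<^sub>R x" by (simp add: p_def algebra_simps)
      then show ?thesis using convexD_alt[OF C(1) a x, of "real k / real N"] that N by simp
    qed
    have "dist (f a) (f (p k)) \<le> real k" if "k \<le> N" for k
      using that
    proof (induction k)
      case (Suc k)
      have "p (Suc k) - p k = (1 / real N) *\<^sub>R (x - a)"
        by (simp add: p_def scaleR_left_diff_distrib[symmetric] diff_divide_distrib[symmetric])
      then have "dist (p k) (p (Suc k)) = dist a x / real N"
        by (simp add: dist_norm norm_minus_commute[of "p k"] norm_minus_commute[of a])
      also have "\<dots> \<le> R / real N" using R[OF x] N by (simp add: divide_right_mono)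
      also have "\<dots> < d" using N d(1) by (simp add: field_simps)
      finally have "dist (f (p k)) (f (p (Suc k))) < 1" using Suc by (intro d(2) pC) auto
      then show ?case using Suc dist_triangle[of "f a" "f (p (Suc k))" "f (p k)"] by simp
    qed (simp add: p_def)
    from this[of N] show ?thesis using N by (simp add: p_def)
  qed
  then show ?thesis by (auto simp: bounded_def)
qed auto

lemma convex_on_infdist:
  fixes S :: "'a::real_normed_vector set"
  assumes S: "convex S" "S \<noteq> {}" and C: "convex C"
  shows "convex_on C (\<lambda>x. infdist x S)"
  unfolding convex_on_def
proof (intro conjI ballI allI impI C)
  fix x y and u v :: real assume uv: "0 \<le> u" "0 \<le> v" "u + v = 1"
  show "infdist (u *\<^sub>R x + v *\<^sub>R y) S \<le> u * infdist x S + v * infdist y S"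
  proof (rule field_le_epsilon)
    fix e :: real assume e: "e > 0"
    have "\<exists>s\<in>S. dist z s < infdist z S + e" for z
      using S(2) e cInf_lessD[of "dist z ` S" "infdist z S + e"] by (auto simp: infdist_notempty)
    then obtain s t where st: "s \<in> S" "dist x s < infdist x S + e" "t \<in> S" "dist y t < infdist y S + e"
      by blast
    have "infdist (u *\<^sub>R x + v *\<^sub>R y) S \<le> dist (u *\<^sub>R x + v *\<^sub>R y) (u *\<^sub>R s + v *\<^sub>R t)"
      by (intro infdist_le convexD[OF S(1)] st uv)
    also have "\<dots> = norm (u *\<^sub>R (x - s) + v *\<^sub>R (y - t))" by (simp add: dist_norm algebra_simps)
    also have "\<dots> \<le> u * dist x s + v * dist y t"
      using uv norm_triangle_ineq[of "u *\<^sub>R (x - s)" "v *\<^sub>R (y - t)"] by (simp add: dist_norm)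
    also have "\<dots> \<le> u * (infdist x S + e) + v * (infdist y S + e)"
      using st uv by (intro add_mono mult_left_mono) auto
    also have "\<dots> = u * infdist x S + v * infdist y S + (u + v) * e" by (simp add: algebra_simps)
    finally show "infdist (u *\<^sub>R x + v *\<^sub>R y) S \<le> u * infdist x S + v * infdist y S + e"
      using uv(3) by simp
  qed
qed

lemma lipschitz_on_infdist: "1-lipschitz_on C (\<lambda>x. infdist x S)"
  by (rule lipschitz_onI) (auto simp: dist_real_def infdist_triangle_abs)

lemma lipschitz_on_square:
  fixes g :: "'a::metric_space \<Rightarrow> real"
  assumes g: "L-lipschitz_on C g" and R: "\<And>x. x \<in> C \<Longrightarrow> \<bar>g x\<bar> \<le> R" "R \<ge> 0"
  shows "(2 * R * L)-lipschitz_on C (\<lambda>x. (g x)\<^sup>2)"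
proof (rule lipschitz_onI)
  show "0 \<le> 2 * R * L" using R(2) lipschitz_on_nonneg[OF g] by simp
  fix x y assume xy: "x \<in> C" "y \<in> C"
  have "dist ((g x)\<^sup>2) ((g y)\<^sup>2) = \<bar>g x + g y\<bar> * \<bar>g x - g y\<bar>"
    by (simp add: dist_real_def abs_mult[symmetric] power2_eq_square algebra_simps)
  also have "\<dots> \<le> (2 * R) * (L * dist x y)"
    using R(1)[OF xy(1)] R(1)[OF xy(2)] R(2) lipschitz_onD[OF g xy]
    by (intro mult_mono) (auto simp: dist_real_def)
  finally show "dist ((g x)\<^sup>2) ((g y)\<^sup>2) \<le> 2 * R * L * dist x y" by (simp add: algebra_simps)
qed

lemma lipschitz_on_sum:
  fixes g :: "'i \<Rightarrow> 'a::metric_space \<Rightarrow> real"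
  assumes "\<And>i. i \<in> I \<Longrightarrow> (L i)-lipschitz_on C (g i)"
  shows "(\<Sum>i\<in>I. L i)-lipschitz_on C (\<lambda>x. \<Sum>i\<in>I. g i x)"
  using assms by (induction I rule: infinite_finite_induct) (auto intro!: lipschitz_intros)

lemma midpoint_combination:
  assumes "u + v = (1::real)"
  shows "midpoint (u *\<^sub>R x + v *\<^sub>R x') y = u *\<^sub>R midpoint x y + v *\<^sub>R midpoint x' y"
proof -
  have v: "v = 1 - u" using assms by simp
  show ?thesis unfolding v by (simp add: midpoint_def algebra_simps diff_divide_distrib)
qed

text \<open>
  The approximation is the infimal convolution \<open>inf\<^sub>y f y + n (\<phi> x + \<phi> y - 2 \<phi> ((x + y) / 2))\<close>: the
  terms depending on \<open>y\<close> are convex in \<open>x\<close> and enter with a negative sign.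
\<close>

lemma DC_Lipschitz_approximation:
  fixes f :: "'a::real_normed_vector \<Rightarrow> real"
  assumes f: "bounded (f ` C)" and \<phi>: "midpoint_control C f e \<phi>" "L-lipschitz_on C \<phi>" "bounded (\<phi> ` C)"
    and e: "e \<ge> 0"
  obtains g where "DC_Lipschitz C g" "\<And>x. x \<in> C \<Longrightarrow> \<bar>g x - f x\<bar> \<le> e"
proof (cases "C = {}")
  case True
  then show ?thesis
    by (intro that[of "\<lambda>_. 0"]) (auto simp: DC_Lipschitz_def convex_on_def lipschitz_on_def)
next
  case False
  obtain \<delta> where conv: "convex_on C \<phi>" and \<delta>: "\<delta> > 0"
    and ctrl: "\<And>x y. x \<in> C \<Longrightarrow> y \<in> C \<Longrightarrow> dist (f x) (f y) > e \<Longrightarrow> \<delta> \<le> \<phi> x + \<phi> y - 2 * \<phi> (midpoint x y)"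
    using \<phi> unfolding midpoint_control_def by auto
  have C: "convex C" using convex_on_imp_convex[OF conv] .
  have L: "L \<ge> 0" using lipschitz_on_nonneg[OF \<phi>(2)] .
  obtain F where F: "\<And>x. x \<in> C \<Longrightarrow> \<bar>f x\<bar> \<le> F" using f by (auto simp: bounded_iff)
  obtain P where P: "\<And>x. x \<in> C \<Longrightarrow> \<bar>\<phi> x\<bar> \<le> P" using \<phi>(3) by (auto simp: bounded_iff)
  \<comment> \<open>The penalty, \<open>real n\<close> times the defect, outweighs the oscillation
    \<open>2 * F\<close> wherever \<open>f x\<close> and \<open>f y\<close> differ by more than
    \<open>e\<close>.\<close>
  obtain n where n: "2 * F \<le> real n * \<delta>" using reals_Archimedean3[OF \<delta>] less_imp_le by blast
  define k where "k x y = 2 * real n * \<phi> (midpoint x y) - real n * \<phi> y - f y" for x y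
  define h where "h x = (SUP y\<in>C. k x y)" for x
  note mid = convex_on_midpoint[OF conv]
  have bdd: "bdd_above (k x ` C)" if "x \<in> C" for x
  proof (rule bdd_aboveI2)
    fix y assume y: "y \<in> C"
    have "real n * \<phi> (midpoint x y) \<le> real n * P"
      using P[OF mid(1)[OF that y]] by (intro mult_left_mono) auto
    moreover have "real n * (- \<phi> y) \<le> real n * P"
      using P[OF y] by (intro mult_left_mono) auto
    ultimately show "k x y \<le> 3 * (real n * P) + F" using F[OF y] by (simp add: k_def)
  qed
  have k_le: "k x y \<le> h x" if "x \<in> C" "y \<in> C" for x y
    unfolding h_def by (rule cSUP_upper[OF that(2) bdd[OF that(1)]])
  have h_le: "h x \<le> c" if "\<And>y. y \<in> C \<Longrightarrow> k x y \<le> c" for x c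
    unfolding h_def by (rule cSUP_least[OF False that])
  have "convex_on C h"
    unfolding convex_on_def
  proof (intro conjI C ballI allI impI)
    fix x x' and u v :: real assume *: "x \<in> C" "x' \<in> C" "0 \<le> u" "0 \<le> v" "u + v = 1"
    show "h (u *\<^sub>R x + v *\<^sub>R x') \<le> u * h x + v * h x'"
    proof (rule h_le)
      fix y assume y: "y \<in> C"
      have "\<phi> (u *\<^sub>R midpoint x y + v *\<^sub>R midpoint x' y) \<le> u * \<phi> (midpoint x y) + v * \<phi> (midpoint x' y)"
        using conv * mid(1) y by (simp add: convex_on_def)
      then have "k (u *\<^sub>R x + v *\<^sub>R x') y \<le>
          2 * real n * (u * \<phi> (midpoint x y) + v * \<phi> (midpoint x' y)) - (u + v) * (real n * \<phi> y + f y)"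
        using *(5) by (simp add: k_def midpoint_combination mult_left_mono)
      also have "\<dots> = u * k x y + v * k x' y" by (simp add: k_def algebra_simps)
      also have "\<dots> \<le> u * h x + v * h x'" using * y by (intro add_mono mult_left_mono k_le) auto
      finally show "k (u *\<^sub>R x + v *\<^sub>R x') y \<le> u * h x + v * h x'" .
    qed
  qed
  moreover have "(real n * L)-lipschitz_on C h"
  proof (rule lipschitz_onI)
    have *: "h x \<le> h x' + real n * L * dist x x'" if x: "x \<in> C" "x' \<in> C" for x x'
    proof (rule h_le)
      fix y assume y: "y \<in> C"
      have half: "dist (midpoint x y) (midpoint x' y) = dist x x' / 2"
        by (simp add: midpoint_def dist_norm flip: scaleR_diff_right)
      have "\<phi> (midpoint x y) - \<phi> (midpoint x' y) \<le> L * (dist x x' / 2)"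
        using lipschitz_onD[OF \<phi>(2) mid(1)[OF x(1) y] mid(1)[OF x(2) y]]
        unfolding half dist_real_def by linarith
      then have "2 * real n * (\<phi> (midpoint x y) - \<phi> (midpoint x' y)) \<le> 2 * real n * (L * (dist x x' / 2))"
        by (intro mult_left_mono) auto
      then have "k x y \<le> k x' y + real n * L * dist x x'" by (simp add: k_def algebra_simps)
      then show "k x y \<le> h x' + real n * L * dist x x'" using k_le[OF x(2) y] by simp
    qed
    show "dist (h x) (h x') \<le> real n * L * dist x x'" if "x \<in> C" "x' \<in> C" for x x'
      using *[OF that] *[OF that(2,1)] by (simp add: dist_real_def dist_commute abs_le_iff)
  qed (use L in simp)
  moreover have "convex_on C (\<lambda>x. real n * \<phi> x)" using conv by (intro convex_on_cmul) auto
  moreover have "(real n * L)-lipschitz_on C (\<lambda>x. real n * \<phi> x)"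
    using lipschitz_on_cmult_real[OF \<phi>(2), of "real n"] by simp
  ultimately have "DC_Lipschitz C (\<lambda>x. real n * \<phi> x - h x)" unfolding DC_Lipschitz_def by blast
  moreover have "\<bar>(real n * \<phi> x - h x) - f x\<bar> \<le> e" if x: "x \<in> C" for x
  proof -
    \<comment> \<open>The choice \<open>y = x\<close> bounds the approximation above by
      \<open>f\<close>; the upper estimate of \<open>h x\<close> bounds it below by
      \<open>f - e\<close>.\<close>
    have "k x x = real n * \<phi> x - f x" by (simp add: k_def)
    moreover have "h x \<le> real n * \<phi> x - f x + e"
    proof (rule h_le)
      fix y assume y: "y \<in> C"
      let ?d = "\<phi> x + \<phi> y - 2 * \<phi> (midpoint x y)"
      have "f x - f y \<le> e + real n * ?d"
      proof (cases "dist (f x) (f y) > e")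
        case True
        have "real n * \<delta> \<le> real n * ?d" using ctrl[OF x y True] by (intro mult_left_mono) auto
        then show ?thesis using n F[OF x] F[OF y] e by (simp add: abs_le_iff)
      next
        case False
        have "0 \<le> real n * ?d" using mid(2)[OF x y] by (intro mult_nonneg_nonneg) auto
        then show ?thesis using False by (simp add: dist_real_def)
      qed
      then show "k x y \<le> real n * \<phi> x - f x + e" by (simp add: k_def algebra_simps)
    qed
    ultimately show ?thesis using k_le[OF x x] e by (simp add: abs_le_iff)
  qed
  ultimately show thesis by (rule that)
qed

text \<open>
  Each slice around a point of the segment contains one of its endpoints, since the complement of
  a half-space is convex; connectedness then yields a point close to both endpoints.
\<close>

lemma segment_covered_by_slices:
  fixes f :: "'a::real_normed_vector \<Rightarrow> 'b::metric_space"
  assumes D: "convex D" "continuous_on D f" and xy: "x \<in> D" "y \<in> D"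
    and sl: "\<And>p. p \<in> closed_segment x y \<Longrightarrow> \<exists>H\<in>open_halfspaces. p \<in> H \<and>
      (\<forall>a\<in>D \<inter> H. \<forall>b\<in>D \<inter> H. dist (f a) (f b) \<le> e)"
    and e: "e \<ge> 0"
  shows "dist (f x) (f y) \<le> 2 * e"
proof -
  let ?S = "closed_segment x y"
  have S: "?S \<subseteq> D" using xy D(1) by (simp add: closed_segment_subset)
  define P where "P a = {p \<in> ?S. dist (f a) (f p) \<le> e}" for a
  have cont: "continuous_on ?S f" using D(2) S continuous_on_subset by blast
  have closed: "closed (P a)" for a
  proof -
    have "continuous_on ?S (\<lambda>p. dist (f a) (f p))" by (intro continuous_intros cont)
    from continuous_closed_preimage[OF this closed_segment, of "{..e}"] show ?thesis
      by (simp add: P_def vimage_def Int_def)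
  qed
  have "?S \<subseteq> P x \<union> P y"
  proof
    fix p assume p: "p \<in> ?S"
    obtain H where H: "H \<in> open_halfspaces" "p \<in> H" "\<forall>a\<in>D \<inter> H. \<forall>b\<in>D \<inter> H. dist (f a) (f b) \<le> e"
      using sl[OF p] by blast
    have "x \<in> H \<or> y \<in> H"
    proof (rule ccontr)
      assume "\<not> ?thesis"
      then have "?S \<subseteq> - H"
        using convex_Compl_open_halfspaces[OF H(1)] by (intro closed_segment_subset) auto
      then show False using p H(2) by auto
    qed
    moreover have pD: "p \<in> D" using p S by auto
    moreover have "dist (f a) (f p) \<le> e" if "a \<in> D" "a \<in> H" for a using H(2,3) that pD by blast
    ultimately show "p \<in> P x \<union> P y" using p xy unfolding P_def by blast
  qed
  moreover have "x \<in> P x \<inter> ?S" "y \<in> P y \<inter> ?S" using e by (auto simp: P_def)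
  ultimately have "P x \<inter> P y \<inter> ?S \<noteq> {}"
    using connected_closedD[OF connected_segment(1)[of x y], of "P x" "P y"] closed by auto
  then obtain p where "dist (f x) (f p) \<le> e" "dist (f y) (f p) \<le> e" by (auto simp: P_def)
  then show ?thesis using dist_triangle[of "f x" "f y" "f p"] by (simp add: dist_commute)
qed

lemma convex_on_sum_functions:
  fixes g :: "'i \<Rightarrow> 'a::real_vector \<Rightarrow> real"
  assumes "convex C" "\<And>i. i \<in> I \<Longrightarrow> convex_on C (g i)"
  shows "convex_on C (\<lambda>x. \<Sum>i\<in>I. g i x)"
  using assms(2)
  by (induction I rule: infinite_finite_induct) (auto simp: convex_on_const assms(1))

lemma infdist_lessE:
  assumes "infdist x S < r" "S \<noteq> {}"
  obtains s where "s \<in> S" "dist x s < r"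
  using assms cInf_lessD[of "dist x ` S" r] by (auto simp: infdist_notempty)

text \<open>For \<open>p\<close> in the half of the segment next to one endpoint, the midpoint lies
  between \<open>p\<close> and the other endpoint. A low value at \<open>p\<close> would pull down
  the value at the midpoint, where \<open>p\<close> enters with weight \<open>s\<close> at least
  1/2; a loss of \<open>3 * c\<close> there allows at most \<open>6 * c\<close> at
  \<open>p\<close>.\<close>

lemma convex_on_segment_lower_bound:
  fixes h :: "'a::real_vector \<Rightarrow> real"
  assumes h: "convex_on C h" and xy: "x \<in> C" "y \<in> C" and p: "p \<in> closed_segment x y"
    and le: "h x \<le> a + c" "h y \<le> a + c" and mid: "a - 2 * c \<le> h (midpoint x y)" and c: "c \<ge> 0"
  shows "a - 6 * c \<le> h p"
proof -
  have *: "a - 6 * c \<le> h ((1 - t) *\<^sub>R x + t *\<^sub>R y)"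
    if xy: "x \<in> C" "y \<in> C" and le: "h y \<le> a + c" and mid: "a - 2 * c \<le> h (midpoint x y)"
      and t: "0 \<le> t" "t \<le> 1 / 2" for x y t
  proof -
    let ?p = "(1 - t) *\<^sub>R x + t *\<^sub>R y"
    define s where "s = 1 / (2 * (1 - t))"
    have s: "1 / 2 \<le> s" "s \<le> 1" "s * (1 - t) = 1 / 2" "s * t = s - 1 / 2"
      using t by (auto simp: s_def field_simps)
    have pC: "?p \<in> C" using convexD_alt[OF convex_on_imp_convex[OF h] xy, of t] t by simp
    have "s *\<^sub>R ?p + (1 - s) *\<^sub>R y = (s * (1 - t)) *\<^sub>R x + (s * t + (1 - s)) *\<^sub>R y"
      by (simp add: algebra_simps)
    also have "s * t + (1 - s) = 1 / 2" using s(4) by simp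
    also have "(s * (1 - t)) *\<^sub>R x + (1 / 2) *\<^sub>R y = midpoint x y"
      unfolding s(3) by (simp add: midpoint_def scaleR_add_right)
    finally have "a - 2 * c \<le> h (s *\<^sub>R ?p + (1 - s) *\<^sub>R y)" using mid by simp
    also have "\<dots> \<le> s * h ?p + (1 - s) * h y"
      using h pC xy(2) s(1,2) by (simp add: convex_on_def)
    also have "(1 - s) * h y \<le> (1 - s) * (a + c)" using le s by (intro mult_left_mono) auto
    finally have "s * (a - h ?p) \<le> 3 * c - s * c" by (simp add: algebra_simps)
    also have "\<dots> \<le> 3 * c" using s c by simp
    finally have "s * (a - h ?p) \<le> 3 * c" .
    show ?thesis
    proof (rule ccontr)
      assume "\<not> ?thesis"
      then have "6 * c < a - h ?p" by simp
      then have "(1 / 2) * (6 * c) < s * (a - h ?p)"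
        using s(1) c by (intro mult_le_less_imp_less) auto
      with \<open>s * (a - h ?p) \<le> 3 * c\<close> show False by simp
    qed
  qed
  obtain t where t: "0 \<le> t" "t \<le> 1" "p = (1 - t) *\<^sub>R x + t *\<^sub>R y"
    using p by (auto simp: closed_segment_def)
  show ?thesis
  proof (cases "t \<le> 1 / 2")
    case True
    then show ?thesis using *[OF xy le(2) mid t(1)] t(3) by simp
  next
    case False
    have "a - 2 * c \<le> h (midpoint y x)" using mid by (simp add: midpoint_sym)
    then show ?thesis using *[OF xy(2,1) le(1), of "1 - t"] False t by (simp add: add.commute)
  qed
qed

lemma slice_derivative_funpow:
  assumes "e \<ge> 0"
  shows "closed C \<Longrightarrow> closed ((slice_derivative f e ^^ k) C)"
    and "convex C \<Longrightarrow> convex ((slice_derivative f e ^^ k) C)"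
    and "(slice_derivative f e ^^ Suc k) C \<subseteq> (slice_derivative f e ^^ k) C"
    and "(slice_derivative f e ^^ k) C \<subseteq> C"
proof -
  show sub: "(slice_derivative f e ^^ Suc k) C \<subseteq> (slice_derivative f e ^^ k) C" for k
    by (simp add: slice_derivative_subset)
  show "closed C \<Longrightarrow> closed ((slice_derivative f e ^^ k) C)"
    by (induction k) (auto intro: closed_slice_derivative[OF assms])
  show "convex C \<Longrightarrow> convex ((slice_derivative f e ^^ k) C)"
    by (induction k) (auto intro: convex_slice_derivative[OF assms])
  show "(slice_derivative f e ^^ k) C \<subseteq> C"
    using sub by (induction k) auto
qed

text \<open>
  The function is \<open>\<Sum>\<^sub>k dist(\<cdot>, C\<^sub>k)\<^sup>2\<close> over the nonempty derived sets. If its midpoint defect at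
  \<open>x, y\<close> is small, each distance is almost constant on the segment \<open>[x, y]\<close>. With thresholds
  increasing geometrically in \<open>k\<close>, for the largest \<open>k\<close> with \<open>dist(x, C\<^sub>k)\<close> below its threshold the
  segment can be moved slightly into \<open>C\<^sub>k - C\<^bsub>k+1\<^esub>\<close>.
\<close>

lemma slice_derivative_funpow_midpoint_control:
  fixes f :: "'a::real_normed_vector \<Rightarrow> 'b::metric_space"
  assumes C: "closed C" "convex C" "bounded C" and f: "uniformly_continuous_on C f"
    and e: "e > 0" and n: "(slice_derivative f e ^^ n) C = {}"
  obtains \<phi> L where "midpoint_control C f (4 * e) \<phi>" "L-lipschitz_on C \<phi>" "bounded (\<phi> ` C)"
proof (cases "C = {}")
  case True
  then show ?thesis
    by (intro that[of "\<lambda>_. 0" 0]) (auto simp: midpoint_control_def convex_on_def intro!: exI[of _ 1])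
next
  case False
  have e0: "e \<ge> 0" using e by simp
  define K where "K k = (slice_derivative f e ^^ k) C" for k
  have K: "closed (K k)" "convex (K k)" "K (Suc k) \<subseteq> K k" "K k \<subseteq> C" for k
    unfolding K_def by (intro slice_derivative_funpow[OF e0] C)+
  have KSuc: "K (Suc k) = slice_derivative f e (K k)" for k by (simp add: K_def)
  \<comment> \<open>\<open>infdist\<close> to the empty set is 0, so only the nonempty sets, those
    with index below \<open>N\<close>, may enter the sum.\<close>
  define N where "N = (LEAST n. K n = {})"
  have KN: "K N = {}" unfolding N_def by (rule LeastI[of _ n]) (simp add: K_def n)
  have Kne: "K k \<noteq> {}" if "k < N" for k using not_less_Least that unfolding N_def by blast
  have less_N: "k < N" if "K k \<noteq> {}" for k
    using that lift_Suc_antimono_le[of K, OF K(3), of N k] KN by (cases "k < N") auto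
  have N: "N > 0" by (rule less_N) (simp add: K_def False)
  obtain R where R: "\<And>x y. x \<in> C \<Longrightarrow> y \<in> C \<Longrightarrow> dist x y \<le> R" using C(3) by (auto simp: bounded_two_points)
  have R0: "R \<ge> 0" using R False dist_self by (metis ex_in_conv)
  define d where "d k x = infdist x (K k)" for k x
  have d0: "d k x \<ge> 0" for k x by (simp add: d_def infdist_nonneg)
  have dR: "d k x \<le> R" if "k < N" "x \<in> C" for k x
  proof -
    obtain s where "s \<in> K k" using Kne[OF \<open>k < N\<close>] by auto
    then show ?thesis using infdist_le[of s "K k" x] R[of x s] K(4)[of k] that unfolding d_def by force
  qed
  have dconv: "convex_on C (d k)" if "k < N" for k
    unfolding d_def by (rule convex_on_infdist[OF K(2) Kne[OF that] C(2)])
  have d_tri: "d k x \<le> d k y + dist x y" for k x y unfolding d_def by (rule infdist_triangle)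
  define \<phi> where "\<phi> x = (\<Sum>k<N. (d k x)\<^sup>2)" for x
  have \<phi>conv: "convex_on C \<phi>"
    unfolding \<phi>_def by (intro convex_on_sum_functions C convex_on_square dconv) (auto simp: d0)
  have \<phi>lip: "(\<Sum>k<N. 2 * R * 1)-lipschitz_on C \<phi>"
    unfolding \<phi>_def
    by (intro lipschitz_on_sum lipschitz_on_square) (use dR d0 R0 in \<open>auto simp: d_def lipschitz_on_infdist\<close>)
  have "\<bar>\<phi> x\<bar> \<le> (\<Sum>k<N. R\<^sup>2)" if "x \<in> C" for x
  proof -
    have "\<phi> x \<le> (\<Sum>k<N. R\<^sup>2)" unfolding \<phi>_def by (intro sum_mono power_mono dR that d0) auto
    moreover have "\<phi> x \<ge> 0" unfolding \<phi>_def by (intro sum_nonneg) auto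
    ultimately show ?thesis by simp
  qed
  then have \<phi>bdd: "bounded (\<phi> ` C)" unfolding bounded_iff by auto
  obtain \<rho> where \<rho>: "\<rho> > 0" "\<And>x y. x \<in> C \<Longrightarrow> y \<in> C \<Longrightarrow> dist x y < \<rho> \<Longrightarrow> dist (f x) (f y) < e"
    using uniformly_continuous_onE[OF f e] by (auto simp: dist_commute)
  \<comment> \<open>The ratio 10 of the thresholds exceeds 6 + 3: along a segment at most
    \<open>6 * c\<close> of a distance is lost, and the segment is moved by at most
    \<open>3 * \<eta> k\<close>. The denominator keeps these moves below \<rho>.\<close>
  define c where "c = \<rho> / (4 * 10 ^ N)"
  have c: "c > 0" using \<rho> by (simp add: c_def)
  define \<eta> where "\<eta> k = c * 10 ^ k" for k
  have \<eta>: "c \<le> \<eta> k" "\<eta> (Suc k) = 10 * \<eta> k" for k using c by (auto simp: \<eta>_def)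
  have \<eta>\<rho>: "3 * \<eta> k < \<rho>" if "k < N" for k
  proof -
    have "\<eta> k \<le> c * 10 ^ N" unfolding \<eta>_def using that c by (intro mult_left_mono power_increasing) auto
    also have "\<dots> = \<rho> / 4" by (simp add: c_def)
    finally show ?thesis using \<rho>(1) by simp
  qed
  have main: "dist (f x) (f y) \<le> 4 * e"
    if xy: "x \<in> C" "y \<in> C" and defect: "\<phi> x + \<phi> y - 2 * \<phi> (midpoint x y) < c\<^sup>2 / 2" for x y
  proof -
    let ?m = "midpoint x y"
    have near: "\<bar>d k x - d k y\<bar> \<le> c" "d k x - 2 * c \<le> d k ?m" if k: "k < N" for k
    proof -
      let ?D = "\<lambda>k. (d k x)\<^sup>2 + (d k y)\<^sup>2 - 2 * (d k ?m)\<^sup>2"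
      have sq: "(d k x - d k y)\<^sup>2 / 2 \<le> ?D k" if "k < N" for k
        by (rule square_midpoint_defect[OF dconv[OF that] d0 xy])
      have "0 \<le> ?D k" if "k < N" for k
        by (rule order_trans[OF _ sq[OF that]]) simp
      then have "?D k \<le> (\<Sum>k<N. ?D k)"
        by (intro member_le_sum) (use k in auto)
      also have "\<dots> = \<phi> x + \<phi> y - 2 * \<phi> ?m"
        by (simp add: \<phi>_def sum.distrib sum_subtractf sum_distrib_left)
      finally have D: "?D k < c\<^sup>2 / 2" using defect by simp
      then have "(d k x - d k y)\<^sup>2 \<le> c\<^sup>2" using sq[OF k] by simp
      then show xy_c: "\<bar>d k x - d k y\<bar> \<le> c" using c by (simp add: abs_le_square_iff[symmetric])
      \<comment> \<open>Otherwise both endpoint distances are at least \<open>d k ?m + c\<close>,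
        which makes the defect at least \<open>2 * c\<^sup>2\<close>.\<close>
      show "d k x - 2 * c \<le> d k ?m"
      proof (rule ccontr)
        assume "\<not> ?thesis"
        then have less: "d k ?m + c < d k x - c" by simp
        then have "(d k ?m + c)\<^sup>2 \<le> (d k x - c)\<^sup>2" using d0[of k ?m] c by (intro power_mono) auto
        moreover have "(d k x - c)\<^sup>2 \<le> (d k y)\<^sup>2" using xy_c less d0[of k ?m] c by (intro power_mono) auto
        moreover have "(d k x - c)\<^sup>2 \<le> (d k x)\<^sup>2" using less d0[of k ?m] c by (intro power_mono) auto
        moreover have "(d k ?m)\<^sup>2 + c\<^sup>2 \<le> (d k ?m + c)\<^sup>2" using d0[of k ?m] c by (simp add: power2_sum)
        moreover have "c\<^sup>2 > 0" using c by simp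
        ultimately show False using D by linarith
      qed
    qed
    \<comment> \<open>If no such \<open>k\<close> existed, induction from \<open>d 0 x = 0\<close>
      would put every natural number below \<open>N\<close>.\<close>
    have "\<exists>k<N. d k x \<le> \<eta> k \<and> \<not> (Suc k < N \<and> d (Suc k) x \<le> \<eta> (Suc k))"
    proof (rule ccontr)
      assume *: "\<not> ?thesis"
      have "k < N \<and> d k x \<le> \<eta> k" for k
      proof (induction k)
        case 0
        have "d 0 x = 0" using xy(1) by (simp add: d_def K_def)
        then show ?case using N \<eta>(1)[of 0] c by simp
      next
        case (Suc k)
        then show ?case using * by blast
      qed
      then show False by blast
    qed
    then obtain k where k: "k < N" "d k x \<le> \<eta> k" and kmax: "Suc k < N \<Longrightarrow> \<eta> (Suc k) < d (Suc k) x"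
      by force
    have \<eta>k: "\<eta> k > 0" "c \<le> \<eta> k" using \<eta>(1)[of k] c by auto
    have "d k x < 3 * \<eta> k" "d k y < 3 * \<eta> k" using near(1)[OF k(1)] k(2) \<eta>k by linarith+
    then obtain x' y' where x': "x' \<in> K k" "dist x x' < 3 * \<eta> k" and y': "y' \<in> K k" "dist y y' < 3 * \<eta> k"
      using Kne[OF k(1)] unfolding d_def by (meson infdist_lessE)
    have out: "p' \<in> K k \<and> p' \<notin> K (Suc k)" if p': "p' \<in> closed_segment x' y'" for p'
    proof
      show "p' \<in> K k" using closed_segment_subset[OF x'(1) y'(1) K(2)] p' by blast
      obtain t where t: "0 \<le> t" "t \<le> 1" "p' = (1 - t) *\<^sub>R x' + t *\<^sub>R y'"
        using p' by (auto simp: closed_segment_def)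
      define p where "p = (1 - t) *\<^sub>R x + t *\<^sub>R y"
      have p: "p \<in> closed_segment x y" using t by (auto simp: p_def closed_segment_def)
      have "dist p p' = norm ((1 - t) *\<^sub>R (x - x') + t *\<^sub>R (y - y'))"
        by (simp add: p_def t(3) dist_norm algebra_simps)
      also have "\<dots> \<le> (1 - t) * dist x x' + t * dist y y'"
        using t norm_triangle_ineq[of "(1 - t) *\<^sub>R (x - x')" "t *\<^sub>R (y - y')"] by (simp add: dist_norm)
      also have "\<dots> \<le> 3 * \<eta> k" using t x' y' by (intro convex_bound_le) auto
      finally have pp': "dist p p' \<le> 3 * \<eta> k" .
      show "p' \<notin> K (Suc k)"
      proof
        assume in_K: "p' \<in> K (Suc k)"
        then have Sk: "Suc k < N" using less_N by blast
        have "d (Suc k) x - 6 * c \<le> d (Suc k) p"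
          by (rule convex_on_segment_lower_bound[OF dconv[OF Sk] xy p]) (use near[OF Sk] c in auto)
        moreover have "d (Suc k) p' = 0" using in_K by (simp add: d_def)
        ultimately show False
          using kmax[OF Sk] d_tri[of "Suc k" p p'] pp' \<eta>(2)[of k] \<eta>k by simp
      qed
    qed
    have "dist (f x') (f y') \<le> 2 * e"
    proof (rule segment_covered_by_slices[OF K(2) _ x'(1) y'(1) _ e0])
      show "continuous_on (K k) f"
        using uniformly_continuous_imp_continuous[OF f] K(4) continuous_on_subset by blast
      show "\<exists>H\<in>open_halfspaces. p \<in> H \<and> (\<forall>a\<in>K k \<inter> H. \<forall>b\<in>K k \<inter> H. dist (f a) (f b) \<le> e)"
        if "p \<in> closed_segment x' y'" for p
      proof -
        have "p \<in> K k \<and> p \<notin> K (Suc k)" using that by (rule out)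
        then obtain H where H: "H \<in> open_halfspaces" "p \<in> H"
          "\<And>a b. a \<in> K k \<Longrightarrow> a \<in> H \<Longrightarrow> b \<in> K k \<Longrightarrow> b \<in> H \<Longrightarrow> dist (f a) (f b) \<le> e"
          using not_in_slice_derivativeE[OF e0, of p "K k" f] unfolding KSuc by blast
        then show ?thesis by (intro bexI[OF _ H(1)]) auto
      qed
    qed
    \<comment> \<open>The moved segment accounts for \<open>2 * e\<close>, and moving each endpoint
      for one more \<open>e\<close>.\<close>
    moreover have "dist (f x) (f x') < e" "dist (f y) (f y') < e"
      using x' y' xy K(4)[of k] \<eta>\<rho>[OF k(1)] by (auto intro!: \<rho>(2))
    ultimately show ?thesis
      using dist_triangle[of "f x" "f y" "f x'"] dist_triangle[of "f x'" "f y" "f y'"]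
      by (simp add: dist_commute)
  qed
  have "midpoint_control C f (4 * e) \<phi>"
    unfolding midpoint_control_def
  proof (intro conjI \<phi>conv exI[of _ "c\<^sup>2 / 2"] ballI impI)
    show "c\<^sup>2 / 2 > 0" using c by simp
    fix x y assume "x \<in> C" "y \<in> C" "4 * e < dist (f x) (f y)"
    then show "c\<^sup>2 / 2 \<le> \<phi> x + \<phi> y - 2 * \<phi> (midpoint x y)" using main[of x y] by (meson not_le)
  qed
  then show thesis using \<phi>lip \<phi>bdd that by blast
qed

lemma uniform_limit_of_DC_LipschitzI:
  assumes "\<And>\<epsilon>. \<epsilon> > 0 \<Longrightarrow> \<exists>g. DC_Lipschitz C g \<and> (\<forall>x\<in>C. \<bar>g x - f x\<bar> \<le> \<epsilon>)"
  shows "uniform_limit_of_DC_Lipschitz C f"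
proof -
  have "\<exists>g. DC_Lipschitz C g \<and> (\<forall>x\<in>C. \<bar>g x - f x\<bar> \<le> 1 / real (Suc n))" for n
    by (rule assms) simp
  then obtain g where g: "\<And>n. DC_Lipschitz C (g n)" "\<And>n x. x \<in> C \<Longrightarrow> \<bar>g n x - f x\<bar> \<le> 1 / real (Suc n)"
    by metis
  have "uniform_limit C g f sequentially"
  proof (rule uniform_limitI)
    fix e :: real assume "e > 0"
    then have "\<forall>\<^sub>F n in sequentially. 1 / real (Suc n) < e"
      using order_tendstoD(2)[OF LIMSEQ_Suc[OF lim_1_over_n]] by simp
    then show "\<forall>\<^sub>F n in sequentially. \<forall>x\<in>C. dist (g n x) (f x) < e"
      by eventually_elim (auto simp: dist_real_def intro: le_less_trans[OF g(2)])
  qed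
  then show ?thesis unfolding uniform_limit_of_DC_Lipschitz_def using g(1) by blast
qed

lemma uniform_limit_of_DC_Lipschitz_if_slice_derivatives_vanish:
  fixes f :: "'a::real_normed_vector \<Rightarrow> real"
  assumes C: "closed C" "convex C" "bounded C" and f: "uniformly_continuous_on C f"
    and n: "\<And>\<epsilon>. \<epsilon> > 0 \<Longrightarrow> \<exists>n. (slice_derivative f \<epsilon> ^^ n) C = {}"
  shows "uniform_limit_of_DC_Lipschitz C f"
proof (rule uniform_limit_of_DC_LipschitzI)
  fix \<epsilon> :: real assume "\<epsilon> > 0"
  then have \<epsilon>: "\<epsilon> / 4 > 0" by simp
  obtain n where "(slice_derivative f (\<epsilon> / 4) ^^ n) C = {}" using n[OF \<epsilon>] by blast
  then obtain \<phi> L where \<phi>: "midpoint_control C f (4 * (\<epsilon> / 4)) \<phi>" "L-lipschitz_on C \<phi>" "bounded (\<phi> ` C)"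
    by (rule slice_derivative_funpow_midpoint_control[OF C f \<epsilon>])
  obtain g where "DC_Lipschitz C g" "\<And>x. x \<in> C \<Longrightarrow> \<bar>g x - f x\<bar> \<le> 4 * (\<epsilon> / 4)"
    using DC_Lipschitz_approximation[OF uniformly_continuous_on_convex_bounded_image[OF C(2,3) f] \<phi>] \<epsilon>
    by auto
  then show "\<exists>g. DC_Lipschitz C g \<and> (\<forall>x\<in>C. \<bar>g x - f x\<bar> \<le> \<epsilon>)" by auto
qed

lemma uniform_limit_of_DC_Lipschitz_imp_DC_bounded:
  assumes C: "bounded C" and f: "uniform_limit_of_DC_Lipschitz C f"
  shows "uniform_limit_of_DC_bounded C f"
proof -
  have "DC_bounded C g" if "DC_Lipschitz C g" for g
  proof -
    have bdd: "bounded (h ` C)" if h: "L-lipschitz_on C h" for h :: "'a \<Rightarrow> real" and L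
    proof -
      obtain R where "\<And>x y. x \<in> C \<Longrightarrow> y \<in> C \<Longrightarrow> dist x y \<le> R" using C by (auto simp: bounded_two_points)
      then have "dist (h x) (h y) \<le> L * R" if "x \<in> C" "y \<in> C" for x y
        using lipschitz_onD[OF h that] lipschitz_on_nonneg[OF h] that
        by (meson mult_left_mono order_trans)
      then show ?thesis by (auto simp: bounded_two_points)
    qed
    show ?thesis
      using that unfolding DC_Lipschitz_def DC_bounded_def by (meson bdd lipschitz_on_continuous_on)
  qed
  then show ?thesis
    using f unfolding uniform_limit_of_DC_bounded_def uniform_limit_of_DC_Lipschitz_def by blast
qed

section \<open>Transfinite derivations\<close>

no_notation elt_set_eq (infix "=o" 50)

lemma ordLess_Well_order:
  assumes "s <o r"
  shows "Well_order s" "Well_order r"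
  using assms unfolding ordLess_def by auto

context
  fixes r :: "'i rel"
  assumes r: "Well_order r"
begin

lemma Well_order_rules:
  shows Well_order_refl: "a \<in> Field r \<Longrightarrow> (a, a) \<in> r"
    and Well_order_trans: "(a, b) \<in> r \<Longrightarrow> (b, c) \<in> r \<Longrightarrow> (a, c) \<in> r"
    and Well_order_antisym: "(a, b) \<in> r \<Longrightarrow> (b, a) \<in> r \<Longrightarrow> a = b"
    and Well_order_total: "a \<in> Field r \<Longrightarrow> b \<in> Field r \<Longrightarrow> (a, b) \<in> r \<or> (b, a) \<in> r"
proof -
  have *: "Refl r" "trans r" "antisym r" "Total r" using r unfolding order_on_defs by auto
  show refl: "a \<in> Field r \<Longrightarrow> (a, a) \<in> r" for a by (rule refl_onD[OF *(1)])
  show "(a, b) \<in> r \<Longrightarrow> (b, c) \<in> r \<Longrightarrow> (a, c) \<in> r" by (rule transD[OF *(2)])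
  show "(a, b) \<in> r \<Longrightarrow> (b, a) \<in> r \<Longrightarrow> a = b" by (rule antisymD[OF *(3)])
  show "a \<in> Field r \<Longrightarrow> b \<in> Field r \<Longrightarrow> (a, b) \<in> r \<or> (b, a) \<in> r"
    by (cases "a = b") (use refl *(4) in \<open>auto simp: total_on_def\<close>)
qed

lemma Field_Restr_underS: "Field (Restr r (underS r a)) = underS r a"
  using Refl_Field_Restr2[of r "underS r a"] r underS_Field[of _ r a] unfolding order_on_defs by blast

lemma underS_Restr_underS:
  assumes "a \<in> underS r b"
  shows "Restr (Restr r (underS r b)) (underS (Restr r (underS r b)) a) = Restr r (underS r a)"
proof -
  have "underS (Restr r (underS r b)) a = underS r a"
    using assms Well_order_trans Well_order_antisym unfolding underS_def by blast
  moreover have "underS r a \<subseteq> underS r b"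
    using assms Well_order_trans Well_order_antisym unfolding underS_def by blast
  ultimately show ?thesis by auto
qed

lemma underS_Restr_ordLess_mono:
  assumes "a \<in> underS r b"
  shows "Restr r (underS r a) <o Restr r (underS r b)"
proof -
  have "Field (Restr r (underS r b)) \<noteq> {}" using assms Field_Restr_underS by blast
  from underS_Restr_ordLess[OF Well_order_Restr[OF r] this, of a]
  show ?thesis by (simp add: underS_Restr_underS[OF assms])
qed

lemma is_greatest_pred_order:
  assumes "is_greatest r m"
  shows "pred_order r = Restr r (underS r m)"
proof -
  have "(THE m. is_greatest r m) = m"
    using assms Well_order_antisym by (intro the_equality) (auto simp: is_greatest_def)
  then show ?thesis by (simp add: pred_order_def)
qed

lemma derived_set_zero: "Field r = {} \<Longrightarrow> derived_set f e C r = C"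
  by (simp add: derived_set.simps)

lemma derived_set_greatest:
  assumes "is_greatest r m"
  shows "derived_set f e C r = slice_derivative f e (derived_set f e C (Restr r (underS r m)))"
proof -
  have "Field r \<noteq> {}" using assms by (auto simp: is_greatest_def)
  then show ?thesis
    by (subst derived_set.simps) (use r assms is_greatest_pred_order in auto)
qed

lemma derived_set_limit:
  assumes "Field r \<noteq> {}" "\<nexists>m. is_greatest r m"
  shows "derived_set f e C r = (\<Inter>s\<in>{s :: 'i rel. s <o r}. derived_set f e C s)"
  by (subst derived_set.simps) (use r assms in auto)

lemma not_is_greatestE:
  assumes "\<nexists>m. is_greatest r m" "a \<in> Field r"
  obtains b where "b \<in> Field r" "a \<in> underS r b"
proof -
  obtain b where b: "b \<in> Field r" "(b, a) \<notin> r" using assms by (auto simp: is_greatest_def)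
  then have "(a, b) \<in> r" "a \<noteq> b" using Well_order_total[of a b] assms(2) Well_order_refl by auto
  then show thesis using that b by (auto simp: underS_def)
qed

lemma ordLess_segmentE:
  assumes "s <o r"
  obtains a where "a \<in> Field r" "s =o Restr r (underS r a)"
  using assms ordLess_iff_ordIso_Restr[OF r, of s] ordLess_Well_order[OF assms] by blast

end

lemma iso_underS_Restr:
  assumes r: "Well_order r" "Well_order r'" and h: "iso r r' h" and m: "m \<in> Field r"
  shows "Restr r (underS r m) =o Restr r' (underS r' (h m))"
proof -
  have h': "bij_betw h (Field r) (Field r')"
      "\<And>a b. a \<in> Field r \<Longrightarrow> b \<in> Field r \<Longrightarrow> (a, b) \<in> r \<longleftrightarrow> (h a, h b) \<in> r'"
    using h unfolding iso_iff2 by blast+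
  have inj: "h a = h b \<longleftrightarrow> a = b" if "a \<in> Field r" "b \<in> Field r" for a b
    using inj_on_eq_iff[OF bij_betw_imp_inj_on[OF h'(1)] that] .
  have sub: "underS r m \<subseteq> Field r" by (auto dest: underS_Field)
  have "h ` underS r m = underS r' (h m)"
  proof
    show "h ` underS r m \<subseteq> underS r' (h m)"
    proof
      fix y assume "y \<in> h ` underS r m"
      then obtain x where x: "x \<in> underS r m" "y = h x" by blast
      then have "x \<in> Field r" "x \<noteq> m" "(x, m) \<in> r" using sub by (auto simp: underS_def)
      then show "y \<in> underS r' (h m)" using h'(2)[of x m] inj[of x m] m x(2) by (simp add: underS_def)
    qed
    show "underS r' (h m) \<subseteq> h ` underS r m"
    proof
      fix y assume y: "y \<in> underS r' (h m)"
      then have "y \<in> Field r'" by (rule underS_Field)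
      then obtain x where x: "x \<in> Field r" "y = h x" using bij_betw_imp_surj_on[OF h'(1)] by blast
      have "h x \<noteq> h m" "(h x, h m) \<in> r'" using y x(2) by (simp_all add: underS_def)
      then have "x \<in> underS r m" using h'(2)[OF x(1) m] by (auto simp: underS_def)
      with x show "y \<in> h ` underS r m" by auto
    qed
  qed
  moreover have "inj_on h (underS r m)"
    by (rule inj_on_subset[OF bij_betw_imp_inj_on[OF h'(1)] sub])
  ultimately have bij: "bij_betw h (underS r m) (underS r' (h m))" by (simp add: bij_betw_def)
  have "iso (Restr r (underS r m)) (Restr r' (underS r' (h m))) h"
    unfolding iso_iff2 Field_Restr_underS[OF r(1)] Field_Restr_underS[OF r(2)]
  proof (intro conjI bij ballI)
    fix a b assume ab: "a \<in> underS r m" "b \<in> underS r m"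
    then have "h a \<in> underS r' (h m)" "h b \<in> underS r' (h m)" using bij_betw_apply[OF bij] by auto
    moreover have "a \<in> Field r" "b \<in> Field r" using ab sub by auto
    ultimately show "(a, b) \<in> Restr r (underS r m) \<longleftrightarrow> (h a, h b) \<in> Restr r' (underS r' (h m))"
      using ab h'(2)[of a b] by simp
  qed
  then show ?thesis
    using Well_order_Restr[OF r(1)] Well_order_Restr[OF r(2)] unfolding ordIso_def by auto
qed

text \<open>The recursion sees the order type only. In the limit case the two intersections range
  over orders on different types, and each smaller order is copied into the other type. This lets
  lengths found on a type of sets be compared with \<open>Dz\<close>.\<close>

lemma derived_set_ordIso:
  fixes r :: "'i rel" and r' :: "'j rel"
  assumes "r =o r'"
  shows "derived_set f e C r = derived_set f e C r'"
  using assms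
proof (induction r arbitrary: r' rule: wf_induct_rule[OF wf_ordLess])
  case (1 r)
  have r: "Well_order r" "Well_order r'" using 1(2) unfolding ordIso_def by auto
  obtain h where h: "iso r r' h" using 1(2) unfolding ordIso_def by auto
  then have bij: "bij_betw h (Field r) (Field r')"
      and iff: "\<And>a b. a \<in> Field r \<Longrightarrow> b \<in> Field r \<Longrightarrow> (a, b) \<in> r \<longleftrightarrow> (h a, h b) \<in> r'"
    unfolding iso_iff2 by blast+
  have img: "Field r' = h ` Field r" using bij_betw_imp_surj_on[OF bij] by simp
  have gr: "is_greatest r m \<longleftrightarrow> is_greatest r' (h m)" if "m \<in> Field r" for m
    unfolding is_greatest_def img using that iff[OF _ that] by simp
  show ?case
  proof (cases "Field r = {}")
    case True
    then show ?thesis using img derived_set_zero[OF r(1), of f e C] derived_set_zero[OF r(2), of f e C] by simp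
  next
    case False
    show ?thesis
    proof (cases "\<exists>m. is_greatest r m")
      case True
      then obtain m where m: "is_greatest r m" by blast
      have mF: "m \<in> Field r" using m by (simp add: is_greatest_def)
      have "derived_set f e C (Restr r (underS r m)) = derived_set f e C (Restr r' (underS r' (h m)))"
        by (intro 1(1) underS_Restr_ordLess iso_underS_Restr r False h mF)
      then show ?thesis
        using derived_set_greatest[OF r(1) m, of f e C] derived_set_greatest[OF r(2), of "h m" f e C]
          gr[OF mF] m by simp
    next
      case nog: False
      have nog': "\<nexists>m. is_greatest r' m"
      proof
        assume "\<exists>m. is_greatest r' m"
        then obtain m' where m': "is_greatest r' m'" by blast
        then obtain m where m: "m \<in> Field r" "m' = h m" unfolding is_greatest_def img by blast
        then show False using nog gr[OF m(1)] m' by blast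
      qed
      have "(\<Inter>s\<in>{s :: 'i rel. s <o r}. derived_set f e C s) = (\<Inter>s\<in>{s :: 'j rel. s <o r'}. derived_set f e C s)"
      proof (intro equalityI INT_greatest)
        fix s' assume "s' \<in> {s :: 'j rel. s <o r'}"
        then have "s' <o r'" by simp
        then have "s' <o r" by (rule ordLess_ordIso_trans[OF _ ordIso_symmetric[OF 1(2)]])
        from internalize_ordLess[THEN iffD1, OF this]
        obtain p :: "'i rel" where p: "s' =o p" "p <o r" by blast
        have "derived_set f e C p = derived_set f e C s'"
          by (rule 1(1)[OF p(2) ordIso_symmetric[OF p(1)]])
        then show "(\<Inter>s\<in>{s :: 'i rel. s <o r}. derived_set f e C s) \<subseteq> derived_set f e C s'" using p by blast
      next
        fix s assume "s \<in> {s :: 'i rel. s <o r}"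
        then have s: "s <o r" by simp
        then have "s <o r'" by (rule ordLess_ordIso_trans[OF _ 1(2)])
        from internalize_ordLess[THEN iffD1, OF this]
        obtain p :: "'j rel" where p: "s =o p" "p <o r'" by blast
        have "derived_set f e C s = derived_set f e C p" by (rule 1(1)[OF s p(1)])
        then show "(\<Inter>s\<in>{s :: 'j rel. s <o r'}. derived_set f e C s) \<subseteq> derived_set f e C s" using p by blast
      qed
      then show ?thesis
        using derived_set_limit[OF r(1) False nog, of f e C] derived_set_limit[OF r(2) _ nog', of f e C]
          False img by simp
    qed
  qed
qed

lemma derived_set_closed_convex:
  fixes r :: "'i rel"
  assumes "e \<ge> 0" "closed C" "convex C"
  shows "closed (derived_set f e C r) \<and> convex (derived_set f e C r) \<and> derived_set f e C r \<subseteq> C"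
proof (induction r rule: wf_induct_rule[OF wf_ordLess])
  case (1 r)
  consider "\<not> Well_order r \<or> Field r = {}" | m where "Well_order r" "is_greatest r m"
    | "Well_order r" "Field r \<noteq> {}" "\<nexists>m. is_greatest r m" by blast
  then show ?case
  proof cases
    case 1
    then show ?thesis using assms by (auto simp: derived_set.simps)
  next
    case 2
    have "Field r \<noteq> {}" using 2(2) by (auto simp: is_greatest_def)
    then have "Restr r (underS r m) <o r" using underS_Restr_ordLess[OF 2(1)] by blast
    then have "closed (derived_set f e C (Restr r (underS r m)))"
      "convex (derived_set f e C (Restr r (underS r m)))" "derived_set f e C (Restr r (underS r m)) \<subseteq> C"
      using "1.IH" by auto
    then show ?thesis
      unfolding derived_set_greatest[OF 2]
      by (intro conjI closed_slice_derivative convex_slice_derivative assms(1)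
          order_trans[OF slice_derivative_subset])
  next
    case 3
    obtain a where "a \<in> Field r" using 3 by blast
    have "Restr r (underS r a) <o r" using underS_Restr_ordLess[OF 3(1,2)] .
    then have "(\<Inter>s\<in>{s :: 'i rel. s <o r}. derived_set f e C s) \<subseteq> C" using "1.IH" by blast
    then show ?thesis
      unfolding derived_set_limit[OF 3] using "1.IH" by (auto intro!: closed_INT convex_INT)
  qed
qed

text \<open>Every stage before \<open>r\<close> is followed by one more derivation: at a greatest
  element directly, and below a limit because an intermediate stage exists.\<close>

lemma derived_set_ordLess:
  fixes r s :: "'i rel"
  assumes "s <o r"
  shows "derived_set f e C r \<subseteq> slice_derivative f e (derived_set f e C s)"
  using assms
proof (induction r rule: wf_induct_rule[OF wf_ordLess])
  case (1 r)
  have r: "Well_order r" by (rule ordLess_Well_order[OF 1(2)])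
  obtain a where a: "a \<in> Field r" "s =o Restr r (underS r a)" by (rule ordLess_segmentE[OF r 1(2)])
  then have ne: "Field r \<noteq> {}" by auto
  show ?case
  proof (cases "\<exists>m. is_greatest r m")
    case True
    then obtain m where m: "is_greatest r m" by blast
    let ?p = "Restr r (underS r m)"
    note eq = derived_set_greatest[OF r m, of f e C]
    show ?thesis
    proof (cases "a = m")
      case True
      then show ?thesis using eq derived_set_ordIso[OF a(2), of f e C] by simp
    next
      case False
      then have "a \<in> underS r m" using m a by (auto simp: underS_def is_greatest_def)
      then have "s <o ?p" using ordIso_ordLess_trans[OF a(2)] underS_Restr_ordLess_mono[OF r] by blast
      then have "derived_set f e C ?p \<subseteq> slice_derivative f e (derived_set f e C s)"
        by (intro 1(1) underS_Restr_ordLess[OF r ne])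
      then show ?thesis using eq slice_derivative_subset[of f e "derived_set f e C ?p"] by auto
    qed
  next
    case False
    obtain b where b: "b \<in> Field r" "a \<in> underS r b" by (rule not_is_greatestE[OF r False a(1)])
    let ?t = "Restr r (underS r b)"
    have t: "?t <o r" by (rule underS_Restr_ordLess[OF r ne])
    have "s <o ?t" using ordIso_ordLess_trans[OF a(2)] underS_Restr_ordLess_mono[OF r b(2)] by blast
    then have "derived_set f e C ?t \<subseteq> slice_derivative f e (derived_set f e C s)" by (intro 1(1) t)
    then show ?thesis unfolding derived_set_limit[OF r ne False] using t by blast
  qed
qed

text \<open>A limit stage is an intersection, so a point cannot be lost there for the first time;
  the loss occurs in a successor step.\<close>

lemma derived_set_removal_stage:
  fixes r :: "'i rel"
  assumes "Well_order r" "x \<in> C" "x \<notin> derived_set f e C r"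
  shows "\<exists>s :: 'i rel. s <o r \<and> x \<in> derived_set f e C s \<and> x \<notin> slice_derivative f e (derived_set f e C s)"
  using assms(1,3)
proof (induction r rule: wf_induct_rule[OF wf_ordLess])
  case (1 r)
  note r = 1(2)
  have ne: "Field r \<noteq> {}" using 1(3) assms(2) derived_set_zero[OF r, of f e C] by auto
  show ?case
  proof (cases "\<exists>m. is_greatest r m")
    case True
    then obtain m where m: "is_greatest r m" by blast
    let ?p = "Restr r (underS r m)"
    have p: "?p <o r" by (rule underS_Restr_ordLess[OF r ne])
    show ?thesis
    proof (cases "x \<in> derived_set f e C ?p")
      case True
      then show ?thesis using p 1(3) unfolding derived_set_greatest[OF r m] by blast
    next
      case False
      then show ?thesis using 1(1)[OF p Well_order_Restr[OF r]] p ordLess_transitive by blast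
    qed
  next
    case False
    then obtain s :: "'i rel" where s: "s <o r" "x \<notin> derived_set f e C s"
      using 1(3) derived_set_limit[OF r ne False, of f e C] by auto
    then show ?thesis using 1(1)[OF s(1)] ordLess_Well_order[OF s(1)] ordLess_transitive by blast
  qed
qed

text \<open>
  If every derivation step from a nonempty set destroys all points of one of the sets \<open>U u\<close>, then
  distinct steps destroy distinct sets, which bounds the length of the derivation.
\<close>

lemma derived_set_vanishes_below_cardSuc:
  fixes \<kappa> :: "'u rel" and U :: "'u \<Rightarrow> 'a::real_normed_vector set"
  assumes \<kappa>: "Card_order \<kappa>" and e: "e \<ge> 0" and C: "closed C" "convex C"
    and U: "\<And>D. D \<subseteq> C \<Longrightarrow> D \<noteq> {} \<Longrightarrow> \<exists>u\<in>Field \<kappa>. U u \<inter> D \<noteq> {} \<and> U u \<inter> slice_derivative f e D = {}"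
  shows "\<exists>s :: 'u set rel. s <o cardSuc \<kappa> \<and> derived_set f e C s = {}"
proof (rule ccontr)
  assume "\<not> ?thesis"
  then have ne: "derived_set f e C s \<noteq> {}" if "s <o cardSuc \<kappa>" for s :: "'u set rel" using that by blast
  define r where "r = cardSuc \<kappa>"
  have r: "Well_order r" "Card_order r"
    using cardSuc_Card_order[OF \<kappa>] unfolding r_def by (auto simp: card_order_on_well_order_on)
  define D where "D a = derived_set f e C (Restr r (underS r a))" for a
  have "\<exists>u\<in>Field \<kappa>. U u \<inter> D a \<noteq> {} \<and> U u \<inter> slice_derivative f e (D a) = {}" if "a \<in> Field r" for a
  proof (rule U)
    show "D a \<subseteq> C" unfolding D_def using derived_set_closed_convex[OF e C] by blast
    show "D a \<noteq> {}" unfolding D_def using ne underS_Restr_ordLess[OF r(1), of a] that by (auto simp: r_def)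
  qed
  then obtain c where c: "\<And>a. a \<in> Field r \<Longrightarrow>
      c a \<in> Field \<kappa> \<and> U (c a) \<inter> D a \<noteq> {} \<and> U (c a) \<inter> slice_derivative f e (D a) = {}" by metis
  \<comment> \<open>\<open>D b\<close> lies in the derivative of \<open>D a\<close>, which misses
    \<open>U (c a)\<close>, while \<open>D b\<close> meets \<open>U (c b)\<close>.\<close>
  have neq: "c a \<noteq> c b" if "b \<in> Field r" "a \<in> underS r b" for a b
  proof -
    have "a \<in> Field r" using that(2) by (rule underS_Field)
    moreover have "D b \<subseteq> slice_derivative f e (D a)"
      unfolding D_def by (rule derived_set_ordLess[OF underS_Restr_ordLess_mono[OF r(1) that(2)]])
    ultimately show ?thesis using c[of a] c[OF that(1)] by auto
  qed
  have "inj_on c (Field r)"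
  proof (rule inj_onI, rule ccontr)
    fix a b assume ab: "a \<in> Field r" "b \<in> Field r" "c a = c b" "a \<noteq> b"
    then have "a \<in> underS r b \<or> b \<in> underS r a" using Well_order_total[OF r(1)] by (auto simp: underS_def)
    then show False using neq ab by metis
  qed
  then have "|Field r| \<le>o |Field \<kappa>|" using c by (intro card_of_ordLeq[THEN iffD1]) auto
  from ordLeq_ordIso_trans[OF ordIso_ordLeq_trans[OF ordIso_symmetric[OF card_of_Field_ordIso[OF r(2)]] this]
      card_of_Field_ordIso[OF \<kappa>]]
  have "r \<le>o \<kappa>" .
  moreover have "\<kappa> <o r" unfolding r_def by (rule cardSuc_greater[OF \<kappa>])
  ultimately show False using not_ordLess_ordLeq[of \<kappa> r] by blast
qed

lemma card_of_Field_ordLeq_of_ordLess_cardSuc: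
  assumes "Card_order \<kappa>" "s <o cardSuc \<kappa>"
  shows "|Field s| \<le>o \<kappa>"
proof -
  have "|Field s| \<le>o s" by (rule card_of_least[OF ordLess_Well_order(1)[OF assms(2)]])
  then have "|Field s| <o cardSuc \<kappa>" by (rule ordLeq_ordLess_trans[OF _ assms(2)])
  then show ?thesis by (rule cardSuc_ordLeq_ordLess[OF assms(1) card_of_Card_order, THEN iffD1])
qed

lemma ordIso_copy:
  fixes s :: "'i rel"
  assumes "Well_order s" "|Field s| \<le>o |UNIV :: 'j set|"
  obtains s' :: "'j rel" where "s =o s'"
proof -
  obtain g :: "'i \<Rightarrow> 'j" where "inj_on g (Field s)"
    using card_of_ordLeq[THEN iffD2, OF assms(2)] by blast
  then show thesis by (rule that[OF dir_image_ordIso[OF assms(1)]])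
qed

text \<open>One vanishing order gives the choice in \<open>Dz\<close> a meaning, since nonempty
  families of well-orders have minima with respect to \<open>\<le>o\<close>.\<close>

lemma Dz_least:
  assumes "\<exists>r :: 'a rel. Well_order r \<and> derived_set f e C r = {}"
  shows "Well_order (Dz C f e)" "derived_set f e (C :: 'a::real_normed_vector set) (Dz C f e) = {}"
    "\<And>s :: 'a rel. Well_order s \<Longrightarrow> derived_set f e C s = {} \<Longrightarrow> Dz C f e \<le>o s"
proof -
  have "\<exists>r\<in>{r :: 'a rel. Well_order r \<and> derived_set f e C r = {}}.
      \<forall>s\<in>{r :: 'a rel. Well_order r \<and> derived_set f e C r = {}}. r \<le>o s"
    using assms by (intro exists_minim_Well_order) auto
  then have "\<exists>r :: 'a rel. Well_order r \<and> derived_set f e C r = {} \<and>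
      (\<forall>s :: 'a rel. Well_order s \<and> derived_set f e C s = {} \<longrightarrow> r \<le>o s)" by blast
  from someI_ex[OF this, folded Dz_def]
  show "Well_order (Dz C f e)" "derived_set f e C (Dz C f e) = {}"
    "\<And>s :: 'a rel. Well_order s \<Longrightarrow> derived_set f e C s = {} \<Longrightarrow> Dz C f e \<le>o s" by auto
qed

text \<open>A whole slice disappears, not just a point. This is what lets a countable family of sets
  register each step.\<close>

lemma dentable_slice_derivative_proper:
  assumes "dentable C f" "bounded C" "e > 0" "D \<subseteq> C" "D \<noteq> {}"
  obtains x H where "H \<in> open_halfspaces" "x \<in> D" "x \<in> H" "H \<inter> slice_derivative f e D = {}"
proof -
  obtain H where H: "H \<in> open_halfspaces" "D \<inter> H \<noteq> {}"
    "\<And>y z. y \<in> D \<Longrightarrow> y \<in> H \<Longrightarrow> z \<in> D \<Longrightarrow> z \<in> H \<Longrightarrow> dist (f y) (f z) \<le> e"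
    using dentableE[OF assms(1,5) bounded_subset[OF assms(2,4)] assms(4,3)] by metis
  moreover have "H \<inter> slice_derivative f e D = {}"
  proof (rule ccontr)
    assume "\<not> ?thesis"
    then obtain x where "x \<in> H" "x \<in> slice_derivative f e D" by blast
    then obtain y z where "y \<in> D \<inter> H" "z \<in> D \<inter> H" "dist (f y) (f z) > e"
      using H(1) assms(3) slice_derivative_iff[of e x f D] by auto
    then show False using H(3)[of y z] by auto
  qed
  ultimately show thesis using that by blast
qed

text \<open>With singletons as the sets destroyed, the length stays below the successor cardinal of
  the space. The order so obtained lives on sets of points and is copied back to points, as
  \<open>Dz\<close> requires.\<close>

lemma dentable_imp_derived_set_vanishes:
  fixes C :: "'a::real_normed_vector set"
  assumes "dentable C f" "bounded C" "closed C" "convex C" "e > 0"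
  shows "\<exists>r :: 'a rel. Well_order r \<and> derived_set f e C r = {}"
proof -
  have "\<exists>s :: 'a set rel. s <o cardSuc |UNIV :: 'a set| \<and> derived_set f e C s = {}"
  proof (rule derived_set_vanishes_below_cardSuc[where U = "\<lambda>x. {x}"])
    fix D assume "D \<subseteq> C" "D \<noteq> {}"
    then obtain x H where "H \<in> open_halfspaces" "x \<in> D" "x \<in> H" "H \<inter> slice_derivative f e D = {}"
      by (rule dentable_slice_derivative_proper[OF assms(1,2,5)])
    then show "\<exists>x\<in>Field |UNIV|. {x} \<inter> D \<noteq> {} \<and> {x} \<inter> slice_derivative f e D = {}"
      by (intro bexI[of _ x]) (auto simp: Field_card_of)
  qed (use assms card_of_Card_order in auto)
  then obtain s :: "'a set rel" where s: "s <o cardSuc |UNIV :: 'a set|" "derived_set f e C s = {}" by blast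
  have wo: "Well_order s" using ordLess_Well_order[OF s(1)] by blast
  obtain s' :: "'a rel" where s': "s =o s'"
    by (rule ordIso_copy[OF wo card_of_Field_ordLeq_of_ordLess_cardSuc[OF card_of_Card_order s(1)]])
  then show ?thesis using derived_set_ordIso[OF s', of f e C] s(2) unfolding ordIso_def by blast
qed

text \<open>The sets \<open>U n\<close> form a countable network of \<open>C\<close>: each removed
  half-space contains one that meets the current set, so the derivation is shorter than
  \<open>cardSuc natLeq\<close>.\<close>

lemma countably_dentableI:
  fixes C :: "'a::real_normed_vector set" and U :: "nat \<Rightarrow> 'a set"
  assumes f: "dentable C f" and C: "bounded C" "closed C" "convex C" and inf: "infinite (UNIV :: 'a set)"
    and base: "\<And>x V. open V \<Longrightarrow> x \<in> C \<inter> V \<Longrightarrow> \<exists>n. x \<in> U n \<and> U n \<subseteq> V"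
  shows "countably_dentable C f"
  unfolding countably_dentable_def
proof (intro conjI f allI impI)
  fix e :: real assume e: "e > 0"
  have "\<exists>s :: nat set rel. s <o cardSuc natLeq \<and> derived_set f e C s = {}"
  proof (rule derived_set_vanishes_below_cardSuc[where U = U, OF natLeq_Card_order])
    fix D assume D: "D \<subseteq> C" "D \<noteq> {}"
    then obtain x H where H: "H \<in> open_halfspaces" "x \<in> D" "x \<in> H" "H \<inter> slice_derivative f e D = {}"
      by (rule dentable_slice_derivative_proper[OF f C(1) e])
    obtain n where "x \<in> U n" "U n \<subseteq> H" using base[OF open_open_halfspaces[OF H(1)], of x] H D by blast
    then show "\<exists>n\<in>Field natLeq. U n \<inter> D \<noteq> {} \<and> U n \<inter> slice_derivative f e D = {}"
      using H by (intro bexI[of _ n]) (auto simp: Field_natLeq)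
  qed (use e C in auto)
  then obtain s :: "nat set rel" where s: "s <o cardSuc natLeq" "derived_set f e C s = {}" by blast
  have wo: "Well_order s" using ordLess_Well_order[OF s(1)] by blast
  \<comment> \<open>An infinite space has room for a copy of any countable order on its
    points.\<close>
  have "natLeq \<le>o |UNIV :: 'a set|" using inf infinite_iff_natLeq_ordLeq[of "UNIV :: 'a set"] by simp
  from ordLeq_transitive[OF card_of_Field_ordLeq_of_ordLess_cardSuc[OF natLeq_Card_order s(1)] this]
  have "|Field s| \<le>o |UNIV :: 'a set|" .
  then obtain s' :: "'a rel" where s': "s =o s'" by (rule ordIso_copy[OF wo])
  then have "Dz C f e \<le>o s'"
    using derived_set_ordIso[OF s', of f e C] s(2) unfolding ordIso_def
    by (intro Dz_least(3)) auto
  then show "Dz C f e <o cardSuc natLeq"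
    by (rule ordLeq_ordLess_trans[OF _ ordIso_ordLess_trans[OF ordIso_symmetric[OF s'] s(1)]])
qed

lemma derived_set_finite:
  assumes "Well_order r" "finite (Field r)"
  shows "derived_set f e C r = (slice_derivative f e ^^ card (Field r)) C"
  using assms
proof (induction "card (Field r)" arbitrary: r)
  case 0
  then show ?case using derived_set_zero[OF 0(2)] by simp
next
  case (Suc n)
  note r = \<open>Well_order r\<close>
  have ne: "Field r \<noteq> {}" using Suc(2) by auto
  \<comment> \<open>A finite nonempty order has a greatest element: nothing can lie above an element
    with the largest initial segment.\<close>
  have "\<exists>m. is_greatest r m"
  proof (rule ccontr)
    assume nog: "\<not> ?thesis"
    have "\<exists>b\<in>Field r. a \<in> underS r b" if "a \<in> Field r" for a
      using not_is_greatestE[OF r nog that] by blast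
    then obtain g where g: "\<And>a. a \<in> Field r \<Longrightarrow> g a \<in> Field r \<and> a \<in> underS r (g a)" by metis
    have "Max ((\<lambda>a. card (underS r a)) ` Field r) \<in> (\<lambda>a. card (underS r a)) ` Field r"
      using ne Suc(4) by (intro Max_in) auto
    then obtain a where a: "a \<in> Field r" "card (underS r a) = Max ((\<lambda>a. card (underS r a)) ` Field r)"
      by (metis (no_types, lifting) imageE)
    have "underS r a \<subset> underS r (g a)"
      using g[OF a(1)] Well_order_trans[OF r] Well_order_antisym[OF r] unfolding underS_def by blast
    moreover have "finite (underS r (g a))"
      by (rule finite_subset[OF _ Suc(4)]) (auto dest: underS_Field)
    ultimately have "card (underS r a) < card (underS r (g a))" by (rule psubset_card_mono[rotated])
    moreover have "card (underS r (g a)) \<le> Max ((\<lambda>a. card (underS r a)) ` Field r)"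
      using g[OF a(1)] Suc(4) by (intro Max_ge) auto
    ultimately show False using a(2) by simp
  qed
  then obtain m where m: "is_greatest r m" by blast
  let ?p = "Restr r (underS r m)"
  have mF: "m \<in> Field r" using m by (simp add: is_greatest_def)
  have Fp: "Field ?p = Field r - {m}"
    unfolding Field_Restr_underS[OF r]
    using m unfolding is_greatest_def underS_def Field_def by blast
  have card: "n = card (Field ?p)" unfolding Fp using Suc(2,4) mF by simp
  have "finite (Field ?p)" unfolding Fp using Suc(4) by simp
  from Suc(1)[OF card Well_order_Restr[OF r] this]
  have "derived_set f e C ?p = (slice_derivative f e ^^ n) C" using card by simp
  then show ?case using derived_set_greatest[OF r m, of f e C] Suc(2)[symmetric] by simp
qed

lemma finitely_dentable_iff:
  fixes C :: "'a::real_normed_vector set"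
  assumes C: "bounded C" "closed C" "convex C"
  shows "finitely_dentable C f \<longleftrightarrow>
    dentable C f \<and> (\<forall>e>0. \<exists>n. (slice_derivative f e ^^ n) C = {})"
proof (cases "dentable C f")
  case True
  note ex = dentable_imp_derived_set_vanishes[OF True C]
  have "Dz C f e <o natLeq \<longleftrightarrow> (\<exists>n. (slice_derivative f e ^^ n) C = {})" if e: "e > 0" for e
  proof
    assume Dz: "Dz C f e <o natLeq"
    have "|Field (Dz C f e)| <o natLeq"
      by (rule ordLeq_ordLess_trans[OF card_of_least[OF Dz_least(1)[OF ex[OF e]]] Dz])
    then have fin: "finite (Field (Dz C f e))" by (rule finite_iff_ordLess_natLeq[THEN iffD2])
    have "(slice_derivative f e ^^ card (Field (Dz C f e))) C = {}"
      using Dz_least(2)[OF ex[OF e]] derived_set_finite[OF Dz_least(1)[OF ex[OF e]] fin, of f e C]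
      by (rule trans[OF sym, rotated])
    then show "\<exists>n. (slice_derivative f e ^^ n) C = {}" ..
  next
    assume "\<exists>n. (slice_derivative f e ^^ n) C = {}"
    then obtain n where n: "(slice_derivative f e ^^ n) C = {}" by blast
    obtain r :: "'a rel" where r: "Well_order r" "derived_set f e C r = {}" using ex[OF e] by blast
    \<comment> \<open>The finite ordinal must be realised on points of the space. A finite
      \<open>r\<close> offers its own field; an infinite one shows that \<open>n\<close> points are
      available.\<close>
    have "\<exists>A :: 'a set. finite A \<and> (slice_derivative f e ^^ card A) C = {}"
    proof (cases "finite (Field r)")
      case fin: True
      have "(slice_derivative f e ^^ card (Field r)) C = {}"
        using r(2) derived_set_finite[OF r(1) fin, of f e C] by (rule trans[OF sym, rotated])
      then show ?thesis using fin by (intro exI[of _ "Field r"] conjI)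
    next
      case False
      have "infinite (UNIV :: 'a set)"
        by (rule infinite_super[OF subset_UNIV False])
      then obtain A :: "'a set" where A: "finite A" "card A = n"
        using infinite_arbitrarily_large by blast
      show ?thesis using n by (intro exI[of _ A] conjI A(1)) (simp only: A(2))
    qed
    then obtain A :: "'a set" where A: "finite A" "(slice_derivative f e ^^ card A) C = {}" by blast
    have "derived_set f e C |A| = (slice_derivative f e ^^ card A) C"
      using derived_set_finite[OF card_of_Well_order, of A f e C] A(1) unfolding Field_card_of .
    then have "derived_set f e C |A| = {}" using A(2) by simp
    then have "Dz C f e \<le>o |A|" by (rule Dz_least(3)[OF ex[OF e] card_of_Well_order])
    moreover have "|A| <o natLeq" using A(1) by (rule finite_iff_ordLess_natLeq[THEN iffD1])
    ultimately show "Dz C f e <o natLeq" by (rule ordLeq_ordLess_trans)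
  qed
  then show ?thesis using True by (simp add: finitely_dentable_def)
qed (simp add: finitely_dentable_def)

lemma finitely_dentable_imp_countably_dentable:
  "finitely_dentable C f \<Longrightarrow> countably_dentable C f"
  unfolding finitely_dentable_def countably_dentable_def
  using ordLess_transitive[OF _ cardSuc_greater[OF natLeq_Card_order]] by blast

text \<open>Only the countable collection of derived sets is kept and its order is forgotten: for
  measurability each point has just to be removed at some stage.\<close>

lemma countably_dentable_derivation:
  fixes C :: "'a::real_normed_vector set"
  assumes f: "countably_dentable C f" and C: "bounded C" "closed C" "convex C" and e: "e > 0"
  shows "\<exists>D :: nat \<Rightarrow> 'a set. (\<forall>n. closed (D n)) \<and> (\<forall>n. convex (D n)) \<and> (\<forall>n. D n \<subseteq> C) \<and>
    (\<forall>x\<in>C. \<exists>n. x \<in> D n \<and> x \<notin> slice_derivative f e (D n))"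
proof -
  have dent: "dentable C f" and Dz: "Dz C f e <o cardSuc natLeq"
    using f e by (auto simp: countably_dentable_def)
  note ex = dentable_imp_derived_set_vanishes[OF dent C e]
  define r where "r = Dz C f e"
  have r: "Well_order r" "derived_set f e C r = {}" unfolding r_def by (rule Dz_least[OF ex])+
  have "|Field r| \<le>o natLeq"
    unfolding r_def by (rule card_of_Field_ordLeq_of_ordLess_cardSuc[OF natLeq_Card_order Dz])
  then have "|Field r| \<le>o |UNIV :: nat set|" by (rule ordLeq_ordIso_trans[OF _ ordIso_symmetric[OF card_of_nat]])
  then have "countable (Field r)" using card_of_ordLeq[of "Field r" "UNIV :: nat set"]
    by (auto intro: countableI)
  \<comment> \<open>\<open>C\<close> is added to keep the family nonempty for the enumeration, as
    \<open>Field r\<close> may be empty.\<close>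
  let ?\<D> = "insert C ((\<lambda>a. derived_set f e C (Restr r (underS r a))) ` Field r)"
  define D where "D = from_nat_into ?\<D>"
  have D: "range D = ?\<D>"
    unfolding D_def using \<open>countable (Field r)\<close> by (intro range_from_nat_into) auto
  have all: "closed S \<and> convex S \<and> S \<subseteq> C" if "S \<in> ?\<D>" for S
    using that derived_set_closed_convex[OF less_imp_le[OF e] C(2,3), of f] C(2,3) by auto
  show ?thesis
  proof (intro exI[of _ D] conjI allI ballI)
    show "closed (D n)" "convex (D n)" "D n \<subseteq> C" for n using all[of "D n"] D rangeI[of D n] by blast+
    fix x assume x: "x \<in> C"
    have "x \<notin> derived_set f e C r" using r(2) by simp
    from derived_set_removal_stage[OF r(1) x this]
    obtain s :: "'a rel" where s: "s <o r" "x \<in> derived_set f e C s"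
      "x \<notin> slice_derivative f e (derived_set f e C s)" by blast
    obtain a where "a \<in> Field r" "s =o Restr r (underS r a)" by (rule ordLess_segmentE[OF r(1) s(1)])
    then have "derived_set f e C s \<in> range D" using derived_set_ordIso[of s _ f e C] unfolding D by blast
    then obtain n where "derived_set f e C s = D n" by blast
    then show "\<exists>n. x \<in> D n \<and> x \<notin> slice_derivative f e (D n)" using s(2,3) by auto
  qed
qed

section \<open>Measurability and pointwise approximation\<close>

lemma CC_sigma_Diff:
  assumes "closed A" "convex A" "closed B" "convex B"
  shows "CC_sigma (A - B)"
  unfolding CC_sigma_def using assms by (intro exI[of _ "\<lambda>_. A"] exI[of _ "\<lambda>_. B"]) auto

lemma CC_sigma_UN:
  fixes S :: "nat \<Rightarrow> 'a::real_normed_vector set"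
  assumes "\<And>n. CC_sigma (S n)"
  shows "CC_sigma (\<Union>n. S n)"
proof -
  define good where "good T A B \<longleftrightarrow> (\<forall>m. closed (A m) \<and> convex (A m) \<and> closed (B m) \<and> convex (B m)) \<and>
      T = (\<Union>m. A m - B m)" for T :: "'a set" and A B :: "nat \<Rightarrow> 'a set"
  have "\<forall>n. \<exists>A B. good (S n) A B" using assms unfolding CC_sigma_def good_def by simp
  then obtain A B where good: "\<And>n. good (S n) (A n) (B n)" by metis
  then have AB: "closed (A n m) \<and> convex (A n m) \<and> closed (B n m) \<and> convex (B n m)"
    and S: "S n = (\<Union>m. A n m - B n m)" for n m by (auto simp: good_def)
  have "(\<Union>n. S n) = (\<Union>i. (\<lambda>(n, m). A n m - B n m) (prod_decode i))" (is "?L = ?R")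
  proof
    show "?L \<subseteq> ?R"
    proof
      fix x assume "x \<in> ?L"
      then obtain n m where "x \<in> A n m - B n m" unfolding S by blast
      then show "x \<in> ?R" by (intro UN_I[of "prod_encode (n, m)"]) auto
    qed
    show "?R \<subseteq> ?L" unfolding S by (auto split: prod.splits)
  qed
  then show ?thesis
    unfolding CC_sigma_def using AB
    by (intro exI[of _ "\<lambda>i. (\<lambda>(n, m). A n m) (prod_decode i)"] exI[of _ "\<lambda>i. (\<lambda>(n, m). B n m) (prod_decode i)"])
       (auto split: prod.splits)
qed

text \<open>Uncountably many slices of one stage may have their image in \<open>V\<close>. Their
  union is removed from \<open>D k n\<close> as a whole, which leaves a closed convex set, so only
  stages and scales \<open>e k\<close> have to be counted.\<close>

lemma countably_dentable_CC_sigma_vimage: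
  fixes C :: "'a::real_normed_vector set" and f :: "'a \<Rightarrow> 'b::metric_space"
  assumes f: "countably_dentable C f" and C: "bounded C" "closed C" "convex C" and V: "open V"
  shows "CC_sigma {x \<in> C. f x \<in> V}"
proof -
  define e where "e k = 1 / real (Suc k)" for k
  define good where "good k D \<longleftrightarrow> (\<forall>n. closed (D n)) \<and> (\<forall>n. convex (D n)) \<and> (\<forall>n. D n \<subseteq> C) \<and>
      (\<forall>x\<in>C. \<exists>n. x \<in> D n \<and> x \<notin> slice_derivative f (e k) (D n))" for k and D :: "nat \<Rightarrow> 'a set"
  have "\<exists>D. good k D" for k
  proof -
    have "e k > 0" by (simp add: e_def)
    with f C show ?thesis unfolding good_def by (rule countably_dentable_derivation)
  qed
  then obtain D where "\<And>k. good k (D k)" by metis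
  then have D: "closed (D k n)" "convex (D k n)" "D k n \<subseteq> C"
    and Dx: "x \<in> C \<Longrightarrow> \<exists>n. x \<in> D k n \<and> x \<notin> slice_derivative f (e k) (D k n)" for k n x
    by (simp_all add: good_def)
  define \<H> where "\<H> k n = {H \<in> open_halfspaces. f ` (D k n \<inter> H) \<subseteq> V}" for k n
  have "{x \<in> C. f x \<in> V} = (\<Union>k. \<Union>n. D k n - (D k n - \<Union>(\<H> k n)))" (is "?L = ?R")
  proof
    show "?R \<subseteq> ?L" using D(3) unfolding \<H>_def by blast
    show "?L \<subseteq> ?R"
    proof
      fix x assume x: "x \<in> ?L"
      then obtain d where d: "d > 0" "\<And>y. dist y (f x) < d \<Longrightarrow> y \<in> V"
        using V unfolding open_dist by blast
      obtain k where k: "e k < d" using d(1) reals_Archimedean[of d] by (auto simp: e_def inverse_eq_divide)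
      have e0: "e k \<ge> 0" by (simp add: e_def)
      obtain n where n: "x \<in> D k n" "x \<notin> slice_derivative f (e k) (D k n)" using Dx[of x k] x by blast
      obtain H where H: "H \<in> open_halfspaces" "x \<in> H"
        "\<And>y z. y \<in> D k n \<Longrightarrow> y \<in> H \<Longrightarrow> z \<in> D k n \<Longrightarrow> z \<in> H \<Longrightarrow> dist (f y) (f z) \<le> e k"
        by (rule not_in_slice_derivativeE[OF e0 n]) blast
      have "f y \<in> V" if "y \<in> D k n" "y \<in> H" for y
        using d(2)[of "f y"] H(3)[OF that n(1) H(2)] k by simp
      then have "H \<in> \<H> k n" unfolding \<H>_def using H(1) by auto
      then show "x \<in> ?R" using n(1) H(2) by blast
    qed
  qed
  moreover have "CC_sigma (D k n - (D k n - \<Union>(\<H> k n)))" for k n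
  proof -
    have "\<H> k n \<subseteq> open_halfspaces" by (auto simp: \<H>_def)
    note * = Diff_open_halfspaces[OF this]
    show ?thesis by (intro CC_sigma_Diff *(1) *(2) D)
  qed
  ultimately show ?thesis by (simp only: CC_sigma_UN)
qed

lemma countably_dentable_imp_CC_sigma_measurable:
  fixes f :: "'a::real_normed_vector \<Rightarrow> real"
  assumes "countably_dentable C f" "bounded C" "closed C" "convex C"
  shows "CC_sigma_measurable C f"
  unfolding CC_sigma_measurable_def
  using countably_dentable_CC_sigma_vimage[OF assms, of "{..<_}"]
    countably_dentable_CC_sigma_vimage[OF assms, of "{_<..}"] by simp

section \<open>The lattice of DC-Lipschitz functions\<close>

lemma convex_on_max:
  assumes "convex_on C g" "convex_on C h"
  shows "convex_on C (\<lambda>x. max (g x) (h x :: real))"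
  unfolding convex_on_def
proof (intro conjI ballI allI impI)
  show "convex C" using convex_on_imp_convex[OF assms(1)] .
  fix x y and u v :: real assume *: "x \<in> C" "y \<in> C" "0 \<le> u" "0 \<le> v" "u + v = 1"
  have "u * g x + v * g y \<le> u * max (g x) (h x) + v * max (g y) (h y)"
    "u * h x + v * h y \<le> u * max (g x) (h x) + v * max (g y) (h y)"
    using * by (intro add_mono mult_left_mono; simp)+
  moreover have "g (u *\<^sub>R x + v *\<^sub>R y) \<le> u * g x + v * g y" "h (u *\<^sub>R x + v *\<^sub>R y) \<le> u * h x + v * h y"
    using assms * by (simp_all add: convex_on_def)
  ultimately show "max (g (u *\<^sub>R x + v *\<^sub>R y)) (h (u *\<^sub>R x + v *\<^sub>R y)) \<le>
      u * max (g x) (h x) + v * max (g y) (h y)" by simp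
qed

lemma lipschitz_on_max:
  fixes g h :: "'a::metric_space \<Rightarrow> real"
  assumes g: "L-lipschitz_on C g" and h: "M-lipschitz_on C h"
  shows "(max L M)-lipschitz_on C (\<lambda>x. max (g x) (h x))"
proof (rule lipschitz_onI)
  show "0 \<le> max L M" using lipschitz_on_nonneg[OF g] by simp
  fix x y assume xy: "x \<in> C" "y \<in> C"
  have "dist (g x) (g y) \<le> max L M * dist x y" "dist (h x) (h y) \<le> max L M * dist x y"
    using lipschitz_onD[OF g xy] lipschitz_onD[OF h xy]
    by (auto intro: order_trans[OF _ mult_right_mono])
  then show "dist (max (g x) (h x)) (max (g y) (h y)) \<le> max L M * dist x y"
    unfolding dist_real_def by (auto simp: max_def split: if_splits)
qed

lemma DC_LipschitzE:
  assumes "DC_Lipschitz C f"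
  obtains g h L M where "convex_on C g" "L-lipschitz_on C g" "convex_on C h" "M-lipschitz_on C h"
    "\<And>x. x \<in> C \<Longrightarrow> f x = g x - h x"
  using assms unfolding DC_Lipschitz_def by blast

lemma DC_LipschitzI:
  assumes "convex_on C g" "L-lipschitz_on C g" "convex_on C h" "M-lipschitz_on C h"
    "\<And>x. x \<in> C \<Longrightarrow> f x = g x - h x"
  shows "DC_Lipschitz C f"
  using assms unfolding DC_Lipschitz_def by blast

lemma DC_Lipschitz_const: "convex C \<Longrightarrow> DC_Lipschitz C (\<lambda>_. c)"
  by (rule DC_LipschitzI[of _ "\<lambda>_. c" 0 "\<lambda>_. 0" 0])
     (auto simp: convex_on_const intro: lipschitz_on_constant)

lemma DC_Lipschitz_convex:
  assumes "convex_on C g" "L-lipschitz_on C g"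
  shows "DC_Lipschitz C g"
  by (rule DC_LipschitzI[OF assms, of "\<lambda>_. 0" 0])
     (auto simp: convex_on_const convex_on_imp_convex[OF assms(1)] intro: lipschitz_on_constant)

lemma DC_Lipschitz_uminus:
  assumes "DC_Lipschitz C f"
  shows "DC_Lipschitz C (\<lambda>x. - f x)"
  using assms by (rule DC_LipschitzE) (rule DC_LipschitzI; force)

lemma DC_Lipschitz_add:
  assumes "DC_Lipschitz C f" "DC_Lipschitz C f'"
  shows "DC_Lipschitz C (\<lambda>x. f x + f' x)"
proof -
  obtain g h L M where 1: "convex_on C g" "L-lipschitz_on C g" "convex_on C h" "M-lipschitz_on C h"
    "\<And>x. x \<in> C \<Longrightarrow> f x = g x - h x" using assms(1) by (rule DC_LipschitzE) blast
  obtain g' h' L' M' where 2: "convex_on C g'" "L'-lipschitz_on C g'" "convex_on C h'" "M'-lipschitz_on C h'"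
    "\<And>x. x \<in> C \<Longrightarrow> f' x = g' x - h' x" using assms(2) by (rule DC_LipschitzE) blast
  show ?thesis
    by (rule DC_LipschitzI[of C "\<lambda>x. g x + g' x" "L + L'" "\<lambda>x. h x + h' x" "M + M'"])
       (use 1 2 in \<open>auto intro!: convex_on_add lipschitz_on_add\<close>)
qed

lemma DC_Lipschitz_diff:
  "DC_Lipschitz C f \<Longrightarrow> DC_Lipschitz C f' \<Longrightarrow> DC_Lipschitz C (\<lambda>x. f x - f' x)"
  using DC_Lipschitz_add[OF _ DC_Lipschitz_uminus, of C f f'] by simp

lemma DC_Lipschitz_cmult:
  assumes "DC_Lipschitz C f" "c \<ge> 0"
  shows "DC_Lipschitz C (\<lambda>x. c * f x)"
proof -
  obtain g h L M where 1: "convex_on C g" "L-lipschitz_on C g" "convex_on C h" "M-lipschitz_on C h"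
    "\<And>x. x \<in> C \<Longrightarrow> f x = g x - h x" using assms(1) by (rule DC_LipschitzE) blast
  show ?thesis
    by (rule DC_LipschitzI[of C "\<lambda>x. c * g x" "c * L" "\<lambda>x. c * h x" "c * M"])
       (use 1 assms(2) in \<open>auto intro!: convex_on_cmul lipschitz_on_cmult_real_nonneg simp: right_diff_distrib\<close>)
qed

lemma DC_Lipschitz_max:
  assumes "DC_Lipschitz C f" "DC_Lipschitz C f'"
  shows "DC_Lipschitz C (\<lambda>x. max (f x) (f' x))"
proof -
  obtain g h L M where 1: "convex_on C g" "L-lipschitz_on C g" "convex_on C h" "M-lipschitz_on C h"
    "\<And>x. x \<in> C \<Longrightarrow> f x = g x - h x" using assms(1) by (rule DC_LipschitzE) blast
  obtain g' h' L' M' where 2: "convex_on C g'" "L'-lipschitz_on C g'" "convex_on C h'" "M'-lipschitz_on C h'"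
    "\<And>x. x \<in> C \<Longrightarrow> f' x = g' x - h' x" using assms(2) by (rule DC_LipschitzE) blast
  show ?thesis
    \<comment> \<open>From max (g - h) (g' - h') = max (g + h') (g' + h) - (h + h').\<close>
    by (rule DC_LipschitzI[of C "\<lambda>x. max (g x + h' x) (g' x + h x)" "max (L + M') (L' + M)" "\<lambda>x. h x + h' x" "M + M'"])
       (use 1 2 in \<open>auto intro!: convex_on_add lipschitz_on_add convex_on_max lipschitz_on_max\<close>)
qed

lemma DC_Lipschitz_min:
  assumes "DC_Lipschitz C f" "DC_Lipschitz C f'"
  shows "DC_Lipschitz C (\<lambda>x. min (f x) (f' x))"
  using DC_Lipschitz_uminus[OF DC_Lipschitz_max[OF assms[THEN DC_Lipschitz_uminus]]]
  by (simp add: minus_max_eq_min)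

lemmas DC_Lipschitz_intros = DC_Lipschitz_const DC_Lipschitz_add DC_Lipschitz_diff DC_Lipschitz_cmult
  DC_Lipschitz_max DC_Lipschitz_min

text \<open>The bounds 0 and 1 belong to the notion because \<open>first_match\<close> uses the
  values as weights. Stability under intersection and complement carries it from closed convex sets
  to their differences.\<close>

definition DC_indicator :: "'a::real_normed_vector set \<Rightarrow> 'a set \<Rightarrow> bool" where
  "DC_indicator C S \<longleftrightarrow> (\<exists>u. (\<forall>n. DC_Lipschitz C (u n)) \<and>
     (\<forall>x\<in>C. (\<forall>n. 0 \<le> u n x \<and> u n x \<le> 1) \<and> (\<lambda>n. u n x) \<longlonglongrightarrow> indicat_real S x))"

lemma DC_indicatorI:
  assumes "\<And>n. DC_Lipschitz C (u n)" "\<And>n x. x \<in> C \<Longrightarrow> 0 \<le> u n x" "\<And>n x. x \<in> C \<Longrightarrow> u n x \<le> 1"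
    "\<And>x. x \<in> C \<Longrightarrow> (\<lambda>n. u n x) \<longlonglongrightarrow> indicat_real S x"
  shows "DC_indicator C S"
  unfolding DC_indicator_def using assms by (intro exI[of _ u]) auto

lemma DC_indicator_closed_convex:
  assumes C: "convex C" and A: "closed A" "convex A"
  shows "DC_indicator C A"
proof (cases "A = {}")
  case True
  then show ?thesis by (intro DC_indicatorI[of C "\<lambda>_ _. 0"]) (auto simp: DC_Lipschitz_const C)
next
  case False
  show ?thesis
  proof (rule DC_indicatorI)
    show "DC_Lipschitz C (\<lambda>x. max 0 (1 - real n * infdist x A))" for n
      by (intro DC_Lipschitz_intros C DC_Lipschitz_convex[OF convex_on_infdist[OF A(2) False C] lipschitz_on_infdist]) auto
    show "max 0 (1 - real n * infdist x A) \<le> 1" for n x using infdist_nonneg[of x A] by simp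
    show "(\<lambda>n. max 0 (1 - real n * infdist x A)) \<longlonglongrightarrow> indicat_real A x" for x
    proof (cases "x \<in> A")
      case False
      then have d: "infdist x A > 0" using infdist_pos_not_in_closed[OF A(1) \<open>A \<noteq> {}\<close>] by simp
      obtain N where N: "1 < real N * infdist x A" using reals_Archimedean3[OF d] by blast
      have "max 0 (1 - real n * infdist x A) = 0" if "n \<ge> N" for n
      proof -
        have "real N * infdist x A \<le> real n * infdist x A" using that d by (intro mult_right_mono) auto
        then show ?thesis using N by simp
      qed
      then have "\<forall>\<^sub>F n in sequentially. max 0 (1 - real n * infdist x A) = 0"
        by (auto simp: eventually_sequentially)
      then show ?thesis using False by (simp add: tendsto_eventually)
    qed simp
  qed simp
qed

lemma DC_indicator_Int:
  assumes "DC_indicator C S" "DC_indicator C T"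
  shows "DC_indicator C (S \<inter> T)"
proof -
  obtain u v where u: "\<And>n. DC_Lipschitz C (u n)"
      "\<And>x. x \<in> C \<Longrightarrow> (\<forall>n. 0 \<le> u n x \<and> u n x \<le> 1) \<and> (\<lambda>n. u n x) \<longlonglongrightarrow> indicat_real S x"
    and v: "\<And>n. DC_Lipschitz C (v n)"
      "\<And>x. x \<in> C \<Longrightarrow> (\<forall>n. 0 \<le> v n x \<and> v n x \<le> 1) \<and> (\<lambda>n. v n x) \<longlonglongrightarrow> indicat_real T x"
    using assms unfolding DC_indicator_def by metis
  show ?thesis
  proof (rule DC_indicatorI)
    show "DC_Lipschitz C (\<lambda>x. min (u n x) (v n x))" for n by (intro DC_Lipschitz_min u v)
    fix x assume x: "x \<in> C"
    have "(\<lambda>n. min (u n x) (v n x)) \<longlonglongrightarrow> min (indicat_real S x) (indicat_real T x)"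
      using u(2)[OF x] v(2)[OF x] by (intro tendsto_min) auto
    also have "min (indicat_real S x) (indicat_real T x) = indicat_real (S \<inter> T) x"
      by (auto simp: indicator_def)
    finally show "(\<lambda>n. min (u n x) (v n x)) \<longlonglongrightarrow> indicat_real (S \<inter> T) x" .
  qed (use u(2) v(2) in \<open>auto simp: min_le_iff_disj\<close>)
qed

lemma DC_indicator_Compl:
  assumes "convex C" "DC_indicator C S"
  shows "DC_indicator C (- S)"
proof -
  obtain u where u: "\<And>n. DC_Lipschitz C (u n)"
      "\<And>x. x \<in> C \<Longrightarrow> (\<forall>n. 0 \<le> u n x \<and> u n x \<le> 1) \<and> (\<lambda>n. u n x) \<longlonglongrightarrow> indicat_real S x"
    using assms unfolding DC_indicator_def by metis
  show ?thesis
  proof (rule DC_indicatorI)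
    show "DC_Lipschitz C (\<lambda>x. 1 - u n x)" for n by (intro DC_Lipschitz_intros assms u)
    fix x assume x: "x \<in> C"
    have "(\<lambda>n. 1 - u n x) \<longlonglongrightarrow> 1 - indicat_real S x"
      using u(2)[OF x] by (intro tendsto_diff tendsto_const) auto
    also have "1 - indicat_real S x = indicat_real (- S) x" by (auto simp: indicator_def)
    finally show "(\<lambda>n. 1 - u n x) \<longlonglongrightarrow> indicat_real (- S) x" .
  qed (use u(2) in auto)
qed

lemma DC_indicator_Diff_closed_convex:
  assumes "convex C" "closed A" "convex A" "closed B" "convex B"
  shows "DC_indicator C (A - B)"
  unfolding Diff_eq using assms
  by (intro DC_indicator_Int DC_indicator_Compl DC_indicator_closed_convex)

text \<open>
  If \<open>u i \<in> {0, 1}\<close>, this is the value \<open>v i\<close> at the least \<open>i < k\<close> with \<open>u i = 1\<close>; it only uses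
  operations preserving the class of DC-Lipschitz functions.
\<close>

primrec first_match :: "real \<Rightarrow> nat \<Rightarrow> (nat \<Rightarrow> real) \<Rightarrow> (nat \<Rightarrow> real) \<Rightarrow> real" where
  "first_match M 0 v u = 0"
| "first_match M (Suc k) v u =
     max (v 0 - 2 * M * (1 - u 0)) (min (v 0 + 2 * M * (1 - u 0)) (first_match M k (\<lambda>i. v (Suc i)) (\<lambda>i. u (Suc i))))"

lemma first_match_bounded:
  assumes "M \<ge> 0" "\<And>i. \<bar>v i\<bar> \<le> M" "\<And>i. u i \<le> 1"
  shows "\<bar>first_match M k v u\<bar> \<le> M"
  using assms(2,3)
proof (induction k arbitrary: v u)
  case (Suc k)
  have "\<bar>first_match M k (\<lambda>i. v (Suc i)) (\<lambda>i. u (Suc i))\<bar> \<le> M" by (rule Suc) (use Suc in auto)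
  moreover have "0 \<le> 2 * M * (1 - u 0)" using assms(1) Suc(3)[of 0] by simp
  ultimately show ?case using Suc(2)[of 0] by (auto simp: max_def min_def)
qed (use assms in simp)

lemma DC_Lipschitz_first_match:
  assumes C: "convex C" and M: "M \<ge> 0" and "\<And>i. DC_Lipschitz C (u i)"
  shows "DC_Lipschitz C (\<lambda>x. first_match M k v (\<lambda>i. u i x))"
  using assms(3)
proof (induction k arbitrary: v u)
  case (Suc k)
  have "DC_Lipschitz C (\<lambda>x. first_match M k (\<lambda>i. v (Suc i)) (\<lambda>i. u (Suc i) x))"
    using Suc(1)[of "\<lambda>i. u (Suc i)"] Suc(2) by simp
  then show ?case unfolding first_match.simps using M by (intro DC_Lipschitz_intros C Suc) auto
qed (simp add: DC_Lipschitz_const C)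

text \<open>The clamp around \<open>v 0\<close> has half-width \<open>2 * M * (1 - u 0)\<close>. It
  closes when \<open>u 0\<close> tends to 1, and in the limit lets the rest of the recursion pass
  when \<open>u 0\<close> tends to 0, since values bounded by \<open>M\<close> differ by at most
  \<open>2 * M\<close>. The depth is a general divergent \<open>k\<close> because each induction
  step consumes one level.\<close>

lemma first_match_tendsto:
  fixes u :: "nat \<Rightarrow> nat \<Rightarrow> real"
  assumes M: "M \<ge> 0" "\<And>i. \<bar>v i\<bar> \<le> M" and u: "\<And>i n. 0 \<le> u i n" "\<And>i n. u i n \<le> 1"
    and lim: "\<And>i. i < j \<Longrightarrow> u i \<longlonglongrightarrow> 0" "u j \<longlonglongrightarrow> 1" and k: "filterlim k at_top sequentially"
  shows "(\<lambda>n. first_match M (k n) v (\<lambda>i. u i n)) \<longlonglongrightarrow> v j"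
  using assms(2-)
proof (induction j arbitrary: v u k)
  case 0
  have "(\<lambda>n. 2 * M * (1 - u 0 n)) \<longlonglongrightarrow> 2 * M * (1 - 1)" by (intro tendsto_intros 0)
  then have lim: "(\<lambda>n. 2 * M * (1 - u 0 n)) \<longlonglongrightarrow> 0" by simp
  have "\<forall>\<^sub>F n in sequentially. k n \<ge> 1" using 0(6) by (auto simp: filterlim_at_top)
  then have "\<forall>\<^sub>F n in sequentially. norm (first_match M (k n) v (\<lambda>i. u i n) - v 0) \<le> 2 * M * (1 - u 0 n)"
  proof eventually_elim
    case (elim n)
    then obtain m where m: "k n = Suc m" by (cases "k n") auto
    have "0 \<le> 2 * M * (1 - u 0 n)" using M(1) 0(3)[of 0 n] by simp
    then show ?case unfolding m by (auto simp: max_def min_def)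
  qed
  from Lim_null_comparison[OF this lim] show ?case by (simp add: LIM_zero_iff)
next
  case (Suc j)
  define w where "w n = first_match M (k n - 1) (\<lambda>i. v (Suc i)) (\<lambda>i. u (Suc i) n)" for n
  have "filterlim (\<lambda>n. k n - 1) at_top sequentially"
    by (rule filterlim_compose[OF filterlim_minus_const_nat_at_top Suc(7)])
  then have w: "w \<longlonglongrightarrow> v (Suc j)"
    unfolding w_def using Suc by (intro Suc.IH[of "\<lambda>i. v (Suc i)" "\<lambda>i. u (Suc i)"]) auto
  have "(\<lambda>n. 2 * M * u 0 n) \<longlonglongrightarrow> 2 * M * 0" by (intro tendsto_intros Suc) simp
  then have lim: "(\<lambda>n. 2 * M * u 0 n) \<longlonglongrightarrow> 0" by simp
  have "\<forall>\<^sub>F n in sequentially. k n \<ge> 1" using Suc(7) by (auto simp: filterlim_at_top)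
  then have "\<forall>\<^sub>F n in sequentially. norm (first_match M (k n) v (\<lambda>i. u i n) - w n) \<le> 2 * M * u 0 n"
  proof eventually_elim
    case (elim n)
    then obtain m where m: "k n = Suc m" by (cases "k n") auto
    have W: "\<bar>w n\<bar> \<le> M" unfolding w_def using Suc by (intro first_match_bounded M) auto
    have "0 \<le> 2 * M * (1 - u 0 n)" using M(1) Suc(4)[of 0 n] by simp
    moreover have "2 * M * (1 - u 0 n) = 2 * M - 2 * M * u 0 n" by (simp add: algebra_simps)
    moreover have "first_match M (k n) v (\<lambda>i. u i n) =
        max (v 0 - 2 * M * (1 - u 0 n)) (min (v 0 + 2 * M * (1 - u 0 n)) (w n))"
      by (simp add: m w_def)
    moreover have "0 \<le> 2 * M * u 0 n" using M(1) Suc(3)[of 0 n] by simp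
    ultimately show ?case using Suc(2)[of 0] W unfolding real_norm_def by linarith
  qed
  from tendsto_add[OF Lim_null_comparison[OF this lim] w] show ?case by simp
qed

text \<open>Taking the least index has the effect of making the cover disjoint. The limit sees only
  the indices up to the least one, so depth and approximation stage may both be
  \<open>n\<close>.\<close>

lemma pointwise_limit_first_match:
  fixes T :: "nat \<Rightarrow> 'a::real_normed_vector set" and v :: "nat \<Rightarrow> real"
  assumes C: "convex C" and T: "\<And>i. DC_indicator C (T i)" and cover: "C \<subseteq> (\<Union>i. T i)"
    and v: "\<And>i. \<bar>v i\<bar> \<le> M"
  shows "pointwise_limit_of_DC_Lipschitz C (\<lambda>x. v (LEAST i. x \<in> T i))"
proof -
  have M: "M \<ge> 0" using v[of 0] by simp
  obtain u where u: "\<And>i n. DC_Lipschitz C (u i n)"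
    and u01: "\<And>i n x. x \<in> C \<Longrightarrow> 0 \<le> u i n x \<and> u i n x \<le> 1"
    and lim: "\<And>i x. x \<in> C \<Longrightarrow> (\<lambda>n. u i n x) \<longlonglongrightarrow> indicat_real (T i) x"
    using T unfolding DC_indicator_def by metis
  show ?thesis
    unfolding pointwise_limit_of_DC_Lipschitz_def
  proof (intro exI[of _ "\<lambda>n x. first_match M n v (\<lambda>i. u i n x)"] conjI allI ballI)
    show "DC_Lipschitz C (\<lambda>x. first_match M n v (\<lambda>i. u i n x))" for n
      by (rule DC_Lipschitz_first_match[OF C M u])
    fix x assume x: "x \<in> C"
    let ?j = "LEAST i. x \<in> T i"
    obtain i where "x \<in> T i" using cover x by blast
    then have j: "x \<in> T ?j" by (rule LeastI)
    show "(\<lambda>n. first_match M n v (\<lambda>i. u i n x)) \<longlonglongrightarrow> v ?j"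
    proof (rule first_match_tendsto[OF M v])
      show "0 \<le> u i n x" "u i n x \<le> 1" for i n using u01[OF x] by auto
      show "(\<lambda>n. u i n x) \<longlonglongrightarrow> 0" if "i < ?j" for i
        using lim[OF x, of i] not_less_Least[OF that] by simp
      show "(\<lambda>n. u ?j n x) \<longlonglongrightarrow> 1" using lim[OF x, of ?j] j by simp
      show "filterlim (\<lambda>n. n) at_top sequentially" by (rule filterlim_ident)
    qed
  qed
qed

text \<open>
  The approximating sequences of the functions \<open>F k\<close> are successively clamped, so that the \<open>k\<close>-th
  modification changes them by at most \<open>2 / 2 ^ k\<close>; the diagonal sequence then converges.
\<close>

lemma pointwise_limit_uniform_closure:
  assumes C: "convex C" and F: "\<And>k. pointwise_limit_of_DC_Lipschitz C (F k)"
    and close: "\<And>k x. x \<in> C \<Longrightarrow> \<bar>F k x - f x\<bar> \<le> (1/2) ^ k"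
  shows "pointwise_limit_of_DC_Lipschitz C f"
proof -
  obtain w where w: "\<And>k n. DC_Lipschitz C (w k n)" and lim: "\<And>k x. x \<in> C \<Longrightarrow> (\<lambda>n. w k n x) \<longlonglongrightarrow> F k x"
    using F unfolding pointwise_limit_of_DC_Lipschitz_def by metis
  \<comment> \<open>Consecutive \<open>F k\<close> differ by at most this much, so clamping does not
    disturb the limits.\<close>
  define c :: "nat \<Rightarrow> real" where "c k = 2 * (1/2) ^ k" for k
  define y where "y = rec_nat (w 0) (\<lambda>k z n x. max (z n x - c k) (min (z n x + c k) (w (Suc k) n x)))"
  have y0: "y 0 = w 0" unfolding y_def by (rule nat.rec(1))
  have ySuc': "y (Suc k) n = (\<lambda>x. max (y k n x - c k) (min (y k n x + c k) (w (Suc k) n x)))" for k n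
    unfolding y_def by (subst nat.rec(2)) (rule refl)
  note ySuc = fun_cong[OF ySuc']
  have DC: "DC_Lipschitz C (y k n)" for k n
  proof (induction k)
    case (Suc k)
    show ?case unfolding ySuc' by (intro DC_Lipschitz_intros C Suc w)
  qed (simp add: y0 w)
  have y_lim: "(\<lambda>n. y k n x) \<longlonglongrightarrow> F k x" if x: "x \<in> C" for k x
  proof (induction k)
    case (Suc k)
    have "(\<lambda>n. y (Suc k) n x) \<longlonglongrightarrow> max (F k x - c k) (min (F k x + c k) (F (Suc k) x))"
      unfolding ySuc by (intro tendsto_intros Suc lim x)
    moreover have "\<bar>F k x - F (Suc k) x\<bar> \<le> c k"
      using close[OF x, of k] close[OF x, of "Suc k"] zero_le_power[of "1/2 :: real" k]
      unfolding c_def power_Suc by linarith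
    then have "max (F k x - c k) (min (F k x + c k) (F (Suc k) x)) = F (Suc k) x" by simp
    ultimately show ?case by simp
  qed (simp add: y0 lim x)
  have step: "\<bar>y (k + j) n x - y k n x\<bar> \<le> 4 * (1/2) ^ k - 4 * (1/2) ^ (k + j)" for k j n x
  proof (induction j)
    case (Suc j)
    have "c (k + j) \<ge> 0" by (simp add: c_def)
    then have "\<bar>y (Suc (k + j)) n x - y (k + j) n x\<bar> \<le> c (k + j)"
      unfolding ySuc by (auto simp: max_def min_def)
    then show ?case using Suc by (simp add: c_def)
  qed simp
  show ?thesis
    unfolding pointwise_limit_of_DC_Lipschitz_def
  proof (intro exI[of _ "\<lambda>n. y n n"] conjI allI ballI DC)
    fix x assume x: "x \<in> C"
    show "(\<lambda>n. y n n x) \<longlonglongrightarrow> f x"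
    proof (rule metric_LIMSEQ_I)
      fix e :: real assume e: "e > 0"
      \<comment> \<open>The error splits into 4 + 1 + 1 sixths: the later clamps, the convergence of
        \<open>y k\<close>, and the distance from \<open>F k\<close> to \<open>f\<close>.\<close>
      obtain k where k: "(1/2) ^ k < e / 6" using real_arch_pow_inv[of "e / 6" "1/2"] e by auto
      obtain N where N: "\<And>n. n \<ge> N \<Longrightarrow> \<bar>y k n x - F k x\<bar> < e / 6"
        using LIMSEQ_D[OF y_lim[OF x, of k], of "e / 6"] e by auto
      have "dist (y n n x) (f x) < e" if n: "n \<ge> max N k" for n
      proof -
        have nk: "k \<le> n" using n by simp
        have "\<bar>y n n x - y k n x\<bar> \<le> 4 * (1/2) ^ k"
          using step[of k "n - k" n x] zero_le_power[of "1/2 :: real" n] unfolding le_add_diff_inverse[OF nk] by linarith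
        then show ?thesis
          using N[of n] n close[OF x, of k] k unfolding dist_real_def by linarith
      qed
      then show "\<exists>N. \<forall>n\<ge>N. dist (y n n x) (f x) < e" by blast
    qed
  qed
qed

text \<open>The values are rounded to multiples of \<eta>. Preimages of the overlapping intervals
  around these split into countably many sets with approximable indicators; choosing the first one
  containing a point gives a limit function within \<eta> of \<open>f\<close>.\<close>

lemma CC_sigma_measurable_imp_pointwise_limit:
  fixes f :: "'a::real_normed_vector \<Rightarrow> real"
  assumes C: "convex C" and bdd: "bounded (f ` C)" and f: "CC_sigma_measurable C f"
  shows "pointwise_limit_of_DC_Lipschitz C f"
proof -
  obtain M where M: "\<And>x. x \<in> C \<Longrightarrow> \<bar>f x\<bar> \<le> M" "M \<ge> 0"
    using bdd by (auto simp: bounded_iff) (metis abs_ge_zero order_trans linear)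
  define ind where "ind T S \<longleftrightarrow> (\<forall>n. DC_indicator C (S n)) \<and> T = (\<Union>n. S n)"
    for T and S :: "nat \<Rightarrow> 'a set"
  have cc: "\<exists>S. ind T S" if T: "CC_sigma T" for T
  proof -
    obtain A B :: "nat \<Rightarrow> 'a set" where "\<forall>n. closed (A n) \<and> convex (A n) \<and> closed (B n) \<and> convex (B n)"
      "T = (\<Union>n. A n - B n)" using T unfolding CC_sigma_def by blast
    then show ?thesis unfolding ind_def
      by (intro exI[of _ "\<lambda>n. A n - B n"]) (auto intro!: DC_indicator_Diff_closed_convex C)
  qed
  have "\<exists>S. ind {x \<in> C. f x < r} S" "\<exists>S. ind {x \<in> C. f x > r} S" for r
    using f cc unfolding CC_sigma_measurable_def by simp_all
  then obtain L G where "\<forall>r. ind {x \<in> C. f x < r} (L r)" "\<forall>r. ind {x \<in> C. f x > r} (G r)"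
    using choice[of "\<lambda>r. ind {x \<in> C. f x < r}"] choice[of "\<lambda>r. ind {x \<in> C. f x > r}"] by blast
  then have L: "DC_indicator C (L r n)" "{x \<in> C. f x < r} = (\<Union>n. L r n)"
    and G: "DC_indicator C (G r n)" "{x \<in> C. f x > r} = (\<Union>n. G r n)" for r n
    unfolding ind_def by simp_all
  have approx: "\<exists>g. pointwise_limit_of_DC_Lipschitz C g \<and> (\<forall>x\<in>C. \<bar>g x - f x\<bar> \<le> \<eta>)" if \<eta>: "\<eta> > 0" for \<eta>
  proof -
    define T where "T = (\<lambda>(j :: int, n, m). G ((real_of_int j - 1) * \<eta>) n \<inter> L ((real_of_int j + 1) * \<eta>) m)"
    \<comment> \<open>Clamping to the range of \<open>f\<close> supplies the uniform bound demanded
      by \<open>first_match\<close> and does not increase the distance to \<open>f\<close>.\<close>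
    define v where "v = (\<lambda>(j :: int, n :: nat, m :: nat). max (- M) (min M (real_of_int j * \<eta>)))"
    let ?T = "\<lambda>i. T (from_nat i)" and ?v = "\<lambda>i. v (from_nat i)"
    have T: "DC_indicator C (?T i)" for i
      unfolding T_def by (auto split: prod.splits intro!: DC_indicator_Int L G)
    have near: "\<bar>v p - f x\<bar> \<le> \<eta>" if "x \<in> C" "x \<in> T p" for p x
    proof -
      obtain j n m where p: "p = (j, n, m)" by (cases p)
      have "x \<in> G ((real_of_int j - 1) * \<eta>) n" "x \<in> L ((real_of_int j + 1) * \<eta>) m"
        using that(2) by (auto simp: T_def p)
      then have "f x > (real_of_int j - 1) * \<eta>" "f x < (real_of_int j + 1) * \<eta>"
        using L(2) G(2) by blast+
      then show ?thesis using M(1)[OF that(1)] M(2) by (auto simp: v_def p algebra_simps max_def min_def)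
    qed
    have cover: "C \<subseteq> (\<Union>i. ?T i)"
    proof
      fix x assume x: "x \<in> C"
      define j where "j = \<lfloor>f x / \<eta>\<rfloor>"
      have "real_of_int j \<le> f x / \<eta>" "f x / \<eta> < real_of_int j + 1"
        unfolding j_def by linarith+
      then have "real_of_int j * \<eta> \<le> f x" "f x < (real_of_int j + 1) * \<eta>"
        using \<eta> by (simp_all add: field_simps)
      moreover from this have "(real_of_int j - 1) * \<eta> < f x" using \<eta> by (simp add: algebra_simps)
      ultimately obtain n m where "x \<in> G ((real_of_int j - 1) * \<eta>) n" "x \<in> L ((real_of_int j + 1) * \<eta>) m"
        using x L(2) G(2) by blast
      then have "x \<in> ?T (to_nat (j, n, m))" by (simp add: T_def)
      then show "x \<in> (\<Union>i. ?T i)" by blast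
    qed
    have "\<bar>?v i\<bar> \<le> M" for i using M(2) by (auto simp: v_def max_def min_def split: prod.splits)
    from pointwise_limit_first_match[OF C T cover this]
    have "pointwise_limit_of_DC_Lipschitz C (\<lambda>x. ?v (LEAST i. x \<in> ?T i))" .
    moreover have "\<bar>?v (LEAST i. x \<in> ?T i) - f x\<bar> \<le> \<eta>" if x: "x \<in> C" for x
    proof -
      obtain i where "x \<in> ?T i" using cover x by blast
      then have "x \<in> ?T (LEAST i. x \<in> ?T i)" by (rule LeastI)
      then show ?thesis by (rule near[OF x])
    qed
    ultimately show ?thesis by blast
  qed
  have "\<exists>g. pointwise_limit_of_DC_Lipschitz C g \<and> (\<forall>x\<in>C. \<bar>g x - f x\<bar> \<le> (1/2) ^ k)" for k :: nat
    by (rule approx) simp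
  then obtain F where "\<And>k. pointwise_limit_of_DC_Lipschitz C (F k)"
      "\<And>k x. x \<in> C \<Longrightarrow> \<bar>F k x - f x\<bar> \<le> (1/2) ^ k" by metis
  then show ?thesis by (rule pointwise_limit_uniform_closure[OF C])
qed

section \<open>Counterexamples\<close>

notation apply_bcontfun (infixl "@@" 100)

section \<open>Coordinates of bounded sequences\<close>

lemma apply_Bcontfun_l_infty:
  assumes "\<And>i. \<bar>g i\<bar> \<le> b"
  shows "apply_bcontfun (Bcontfun g :: l_infty) = g"
  by (rule Bcontfun_inverse)
     (use assms in \<open>auto intro!: bcontfun_normI[of _ b] simp: continuous_on_open_vimage open_discrete\<close>)

lemma norm_l_infty_le_iff:
  fixes x :: l_infty
  shows "norm x \<le> b \<longleftrightarrow> (\<forall>i. \<bar>x @@ i\<bar> \<le> b)"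
  using norm_bounded[of x] norm_bound[of x b] by (auto intro: order_trans)

lemma dist_l_infty_le_iff:
  fixes x y :: l_infty
  shows "dist x y \<le> b \<longleftrightarrow> (\<forall>i. \<bar>x @@ i - y @@ i\<bar> \<le> b)"
  unfolding dist_norm norm_l_infty_le_iff by simp

lemma mem_unit_cball_l_infty:
  fixes x :: l_infty
  shows "x \<in> cball 0 1 \<longleftrightarrow> (\<forall>i. \<bar>x @@ i\<bar> \<le> 1)"
  by (simp add: norm_l_infty_le_iff)

lemma l_infty_coordinate:
  "bounded_linear (\<lambda>x :: l_infty. x @@ i)"
  by (rule bounded_linear_intro[where K = 1]) (auto simp: norm_bounded simp del: real_norm_def)

lemma apply_bcontfun_sum:
  "(\<Sum>m\<in>M. y m :: l_infty) @@ i = (\<Sum>m\<in>M. (y m) @@ i)"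
  using linear_sum[OF bounded_linear.linear[OF l_infty_coordinate]] .

lemma convex_on_abs_coordinate:
  fixes C :: "l_infty set"
  assumes "convex C"
  shows "convex_on C (\<lambda>x. \<bar>x @@ i\<bar>)"
  unfolding convex_on_def
proof (intro conjI assms ballI allI impI)
  fix x y :: l_infty and u v :: real assume "0 \<le> u" "0 \<le> v"
  then show "\<bar>(u *\<^sub>R x + v *\<^sub>R y) @@ i\<bar> \<le> u * \<bar>x @@ i\<bar> + v * \<bar>y @@ i\<bar>"
    using abs_triangle_ineq[of "u * x @@ i" "v * y @@ i"] by (simp add: abs_mult)
qed

lemma lipschitz_on_abs_coordinate: "1-lipschitz_on C (\<lambda>x :: l_infty. \<bar>x @@ i\<bar>)"
proof (rule lipschitz_onI)
  fix x y :: l_infty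
  have "\<bar>x @@ i - y @@ i\<bar> \<le> dist x y"
    using dist_l_infty_le_iff[of x y "dist x y"] by blast
  then show "dist \<bar>x @@ i\<bar> \<bar>y @@ i\<bar> \<le> 1 * dist x y"
    unfolding dist_real_def by linarith
qed simp

section \<open>The least coordinate: sign sequences with free coordinates\<close>

lemma infinite_set_partition:
  fixes I :: "nat set" and k :: nat
  assumes I: "infinite I"
  obtains J where "\<And>m. infinite (J m)" "\<And>m. J m \<subseteq> I" "\<And>m m'. m < k \<Longrightarrow> m' < k \<Longrightarrow> m \<noteq> m' \<Longrightarrow> J m \<inter> J m' = {}"
proof (cases "k = 0")
  case True
  then show ?thesis using that[of "\<lambda>_. I"] I by simp
next
  case False
  define J where "J m = range (\<lambda>j. enumerate I (m + k * j))" for m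
  have inj: "inj (enumerate I)" using strict_mono_enumerate[OF I] by (rule strict_mono_imp_inj_on)
  show ?thesis
  proof
    show "infinite (J m)" for m
      unfolding J_def by (rule range_inj_infinite) (use False in \<open>auto simp: inj_def inj_eq[OF inj]\<close>)
    show "J m \<subseteq> I" for m using enumerate_in_set[OF I] by (auto simp: J_def)
    fix m m' assume m: "m < k" "m' < k" "m \<noteq> m'"
    have "m + k * j \<noteq> m' + k * j'" for j j'
    proof
      assume "m + k * j = m' + k * j'"
      then have "(m + k * j) mod k = (m' + k * j') mod k" by simp
      then show False using m by simp
    qed
    then show "J m \<inter> J m' = {}" by (auto simp: J_def inj_eq[OF inj])
  qed
qed

text \<open>
  The points of the unit ball agreeing with \<open>w\<close> outside the set \<open>I\<close> of free coordinates. The pairs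
  \<open>(w, I)\<close> with \<open>w\<close> a sign sequence and \<open>I\<close> infinite are ordered as in Silver forcing.
\<close>

definition extensions :: "(nat \<Rightarrow> real) \<Rightarrow> nat set \<Rightarrow> l_infty set" where
  "extensions w I = {x \<in> cball 0 1. \<forall>i. i \<notin> I \<longrightarrow> x @@ i = w i}"

definition signs :: "(nat \<Rightarrow> real) \<Rightarrow> bool" where
  "signs w \<longleftrightarrow> (\<forall>i. \<bar>w i\<bar> = 1)"

definition stronger :: "(nat \<Rightarrow> real) \<times> nat set \<Rightarrow> (nat \<Rightarrow> real) \<times> nat set \<Rightarrow> bool" where
  "stronger q p \<longleftrightarrow> snd q \<subseteq> snd p \<and> (\<forall>i. i \<notin> snd p \<longrightarrow> fst q i = fst p i)"

definition condition :: "(nat \<Rightarrow> real) \<times> nat set \<Rightarrow> bool" where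
  "condition p \<longleftrightarrow> signs (fst p) \<and> infinite (snd p)"

lemma stronger_refl: "stronger p p" and stronger_trans: "stronger r q \<Longrightarrow> stronger q p \<Longrightarrow> stronger r p"
  by (auto simp: stronger_def)

text \<open>
  To approximate \<open>x\<close>, split \<open>I\<close> into \<open>k\<close> infinite pieces and average \<open>k\<close> points of \<open>A\<close>, the \<open>m\<close>-th
  of which agrees with \<open>x\<close> outside the \<open>m\<close>-th piece.
\<close>

lemma sign_extension_in_closed_convex:
  assumes A: "closed A" "convex A" and p: "condition p"
    and dense: "\<And>q. condition q \<Longrightarrow> stronger q p \<Longrightarrow> extensions (fst q) (snd q) \<inter> A \<noteq> {}"
    and x: "x \<in> extensions (fst p) (snd p)" "signs (apply_bcontfun x)"
  shows "x \<in> A"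
proof -
  have "\<exists>a\<in>A. dist a x < e" if e: "e > 0" for e
  proof -
    obtain k where k: "2 / e < real k" "k > 0"
      using reals_Archimedean2[of "2 / e"] e by (metis gr0I of_nat_0 divide_pos_pos less_asym zero_less_numeral)
    have I: "infinite (snd p)" using p by (simp add: condition_def)
    obtain J where J: "\<And>m. infinite (J m)" "\<And>m. J m \<subseteq> snd p"
      "\<And>m m'. m < k \<Longrightarrow> m' < k \<Longrightarrow> m \<noteq> m' \<Longrightarrow> J m \<inter> J m' = {}"
      using infinite_set_partition[OF I, of k] by metis
    have "\<exists>y. y \<in> extensions (apply_bcontfun x) (J m) \<inter> A" for m
      using dense[of "(apply_bcontfun x, J m)"] x J(1,2)[of m]
      by (auto simp: condition_def stronger_def extensions_def)
    then obtain y where y: "\<And>m. y m \<in> extensions (apply_bcontfun x) (J m)" "\<And>m. y m \<in> A" by (metis IntE)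
    define a where "a = (\<Sum>m<k. (1 / real k) *\<^sub>R y m)"
    have "a \<in> A" unfolding a_def by (rule convex_sum[OF _ A(2)]) (use k y(2) in auto)
    moreover have "\<bar>a @@ i - x @@ i\<bar> \<le> 2 / real k" for i
    proof -
      have yx: "\<bar>(y m) @@ i - x @@ i\<bar> \<le> 2" for m
      proof -
        have "\<bar>(y m) @@ i\<bar> \<le> 1" "\<bar>x @@ i\<bar> \<le> 1"
          using y(1)[of m] x(1) mem_unit_cball_l_infty by (auto simp: extensions_def)
        then show ?thesis by linarith
      qed
      have y0: "(y m) @@ i - x @@ i = 0" if "i \<notin> J m" for m
        using y(1)[of m] that by (simp add: extensions_def)
      have eq: "a @@ i - x @@ i =
          (1 / real k) * (\<Sum>m<k. (y m) @@ i - x @@ i)"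
        using k(2) by (simp add: a_def apply_bcontfun_sum sum_subtractf sum_distrib_left field_simps)
      \<comment> \<open>At most one of the \<open>k\<close> averaged points differs from
        \<open>x\<close> at \<open>i\<close>, and by at most 2.\<close>
      have "\<bar>\<Sum>m<k. (y m) @@ i - x @@ i\<bar> \<le> 2"
      proof (cases "\<exists>m<k. i \<in> J m")
        case True
        then obtain m where m: "m < k" "i \<in> J m" by blast
        have "i \<notin> J m'" if "m' < k" "m' \<noteq> m" for m' using J(3)[of m m'] m that by blast
        then have "(\<Sum>m'\<in>{..<k} - {m}. (y m') @@ i - x @@ i) = 0"
          by (intro sum.neutral ballI y0) auto
        then show ?thesis using yx[of m] sum.remove[of "{..<k}" m "\<lambda>m. (y m) @@ i - x @@ i"] m
          by simp
      next
        case False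
        then have "(\<Sum>m<k. (y m) @@ i - x @@ i) = 0"
          by (intro sum.neutral ballI y0) auto
        then show ?thesis by simp
      qed
      then show ?thesis unfolding eq abs_mult using k(2) by (simp add: divide_right_mono)
    qed
    then have "dist a x \<le> 2 / real k" by (simp add: dist_l_infty_le_iff)
    moreover have "2 / real k < e" using k e by (simp add: field_simps)
    ultimately show ?thesis by (intro bexI[of _ a]) auto
  qed
  then show ?thesis using A(1) by (metis closure_approachable closure_closed)
qed

text \<open>If no refinement escapes \<open>A\<close>, then \<open>A\<close> contains every sign
  sequence extending \<open>p\<close>. Two of these that differ in one free coordinate have an
  average in \<open>A\<close> vanishing there, which must lie in \<open>B\<close>. Such averages
  exist below every refinement, so \<open>B\<close> contains the sign sequences as well, and
  \<open>p\<close> itself will do.\<close>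

lemma refinement_avoiding_Diff:
  assumes A: "closed A" "convex A" and B: "closed B" "convex B" and p: "condition p"
    and AB: "\<And>x i. x \<in> A - B \<Longrightarrow> x @@ i \<noteq> 0"
  shows "\<exists>q. condition q \<and> stronger q p \<and>
    (\<forall>x\<in>extensions (fst q) (snd q). signs (apply_bcontfun x) \<longrightarrow> x \<notin> A - B)"
proof (cases "\<exists>q. condition q \<and> stronger q p \<and> extensions (fst q) (snd q) \<inter> A = {}")
  case True
  then show ?thesis by blast
next
  case False
  have inA: "x \<in> A" if "x \<in> extensions (fst p) (snd p)" "signs (apply_bcontfun x)" for x
    by (rule sign_extension_in_closed_convex[OF A p _ that]) (use False in blast)
  have inB: "x \<in> B" if "x \<in> extensions (fst p) (snd p)" "signs (apply_bcontfun x)" for x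
  proof (rule sign_extension_in_closed_convex[OF B p _ that])
    fix q assume q: "condition q" "stronger q p"
    have sq: "signs (fst q)" and "infinite (snd q)" using q(1) by (auto simp: condition_def)
    then obtain i where i: "i \<in> snd q" using infinite_imp_nonempty by blast
    define x where "x = (Bcontfun (fst q) :: l_infty)"
    define x' where "x' = (Bcontfun ((fst q)(i := - fst q i)) :: l_infty)"
    have ax: "apply_bcontfun x = fst q" unfolding x_def
      by (rule apply_Bcontfun_l_infty[of _ 1]) (use sq in \<open>simp add: signs_def\<close>)
    have ax': "apply_bcontfun x' = (fst q)(i := - fst q i)" unfolding x'_def
      by (rule apply_Bcontfun_l_infty[of _ 1]) (use sq in \<open>simp add: signs_def\<close>)
    have ball: "z \<in> cball 0 1" if "signs (apply_bcontfun z)" for z :: l_infty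
      using that unfolding mem_unit_cball_l_infty by (simp add: signs_def)
    have s: "signs (apply_bcontfun x)" "signs (apply_bcontfun x')"
      using sq by (auto simp: ax ax' signs_def)
    have "x \<in> extensions (fst p) (snd p)" "x' \<in> extensions (fst p) (snd p)"
      using ball[OF s(1)] ball[OF s(2)] q(2) i by (auto simp: extensions_def ax ax' stronger_def)
    then have xA: "x \<in> A" "x' \<in> A" using inA s by auto
    define z where "z = (1/2) *\<^sub>R x + (1/2) *\<^sub>R x'"
    have "z \<in> A" unfolding z_def by (rule convexD[OF A(2) xA]) auto
    moreover have "z @@ i = 0" by (simp add: z_def ax ax')
    ultimately have "z \<in> B" using AB by blast
    moreover have "z \<in> cball 0 1"
      unfolding z_def by (rule convexD[OF convex_cball ball[OF s(1)] ball[OF s(2)]]) auto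
    then have "z \<in> extensions (fst q) (snd q)" using i by (auto simp: extensions_def z_def ax ax')
    ultimately show "extensions (fst q) (snd q) \<inter> B \<noteq> {}" by blast
  qed
  show ?thesis using p stronger_refl inB by blast
qed

definition least_coordinate :: "l_infty \<Rightarrow> real" where
  "least_coordinate x = (INF i. \<bar>x @@ i\<bar>)"

lemma least_coordinate_le: "least_coordinate x \<le> \<bar>x @@ i\<bar>"
  unfolding least_coordinate_def by (rule cINF_lower) (auto intro!: bdd_belowI[of _ 0])

lemma least_coordinate_ge: "(\<And>i. c \<le> \<bar>x @@ i\<bar>) \<Longrightarrow> c \<le> least_coordinate x"
  unfolding least_coordinate_def by (rule cINF_greatest) auto

lemma not_CC_sigma_measurable_least_coordinate:
  "\<not> CC_sigma_measurable (cball 0 1) least_coordinate"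
proof
  assume "CC_sigma_measurable (cball 0 1) least_coordinate"
  then obtain A B :: "nat \<Rightarrow> l_infty set" where
    AB: "\<And>n. closed (A n)" "\<And>n. convex (A n)" "\<And>n. closed (B n)" "\<And>n. convex (B n)"
    and eq: "{x \<in> cball 0 1. least_coordinate x > 0} = (\<Union>n. A n - B n)"
    unfolding CC_sigma_measurable_def CC_sigma_def by metis
  have pos: "x @@ i \<noteq> 0" if "x \<in> A n - B n" for x n i
  proof -
    have "least_coordinate x > 0" using that eq by blast
    then show ?thesis using least_coordinate_le[of x i] by auto
  qed
  define avoid where "avoid n q \<longleftrightarrow>
    (\<forall>x\<in>extensions (fst q) (snd q). signs (apply_bcontfun x) \<longrightarrow> x \<notin> A n - B n)" for n q
  have "\<exists>p. \<forall>n. condition (p n) \<and> (stronger (p (Suc n)) (p n) \<and> avoid n (p (Suc n)))"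
  proof (rule dependent_nat_choice)
    show "\<exists>p. condition p" by (rule exI[of _ "(\<lambda>_. 1, UNIV)"]) (simp add: condition_def signs_def)
    fix p n assume "condition p"
    then show "\<exists>q. condition q \<and> stronger q p \<and> avoid n q" unfolding avoid_def
      by (rule refinement_avoiding_Diff[OF AB(1)[of n] AB(2)[of n] AB(3)[of n] AB(4)[of n] _ pos])
  qed
  then obtain p where p: "\<And>n. condition (p n)" "\<And>n. stronger (p (Suc n)) (p n)" "\<And>n. avoid n (p (Suc n))"
    by blast
  have mono: "stronger (p n) (p m)" if "m \<le> n" for m n
    using that by (induction rule: dec_induct) (auto intro: stronger_refl stronger_trans p(2))
  \<comment> \<open>Each coordinate keeps the sign it has when it first stops being free; those that
    stay free get 1. Only the limit point matters: the intersection of the free sets may well be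
    finite.\<close>
  define y where "y i = (if \<exists>n. i \<notin> snd (p n) then fst (p (LEAST n. i \<notin> snd (p n))) i else 1)" for i
  have sy: "signs y" using p(1) by (auto simp: y_def signs_def condition_def)
  define x where "x = (Bcontfun y :: l_infty)"
  have ax: "apply_bcontfun x = y" unfolding x_def
    by (rule apply_Bcontfun_l_infty[of _ 1]) (use sy in \<open>simp add: signs_def\<close>)
  have xC: "x \<in> cball 0 1" using sy unfolding mem_unit_cball_l_infty ax by (simp add: signs_def)
  have "x \<in> extensions (fst (p n)) (snd (p n))" for n
    unfolding extensions_def
  proof (intro CollectI conjI xC allI impI)
    fix i assume i: "i \<notin> snd (p n)"
    let ?m = "LEAST n. i \<notin> snd (p n)"
    have "?m \<le> n" using i by (rule Least_le)
    moreover have "i \<notin> snd (p ?m)" using i by (rule LeastI)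
    ultimately have "fst (p n) i = fst (p ?m) i" using mono[of ?m n] by (auto simp: stronger_def)
    then show "x @@ i = fst (p n) i" using i by (auto simp: ax y_def)
  qed
  then have "x \<notin> A n - B n" for n using p(3)[of n] sy unfolding avoid_def ax[symmetric] by blast
  moreover have "1 \<le> least_coordinate x"
    by (rule least_coordinate_ge) (use sy in \<open>simp add: ax signs_def\<close>)
  then have "x \<in> {x \<in> cball 0 1. least_coordinate x > 0}" using xC by simp
  ultimately show False using eq by blast
qed

lemma lipschitz_on_least_coordinate: "1-lipschitz_on C least_coordinate"
proof (rule lipschitz_onI)
  have *: "least_coordinate x - dist x y \<le> least_coordinate y" for x y
  proof (rule least_coordinate_ge)
    fix i
    have "dist \<bar>x @@ i\<bar> \<bar>y @@ i\<bar> \<le> 1 * dist x y"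
      by (rule lipschitz_onD[OF lipschitz_on_abs_coordinate[of UNIV]]) auto
    then show "least_coordinate x - dist x y \<le> \<bar>y @@ i\<bar>"
      using least_coordinate_le[of x i] unfolding dist_real_def by linarith
  qed
  show "dist (least_coordinate x) (least_coordinate y) \<le> 1 * dist x y" for x y
    using *[of x y] *[of y x] by (simp add: dist_real_def dist_commute abs_le_iff)
qed simp

text \<open>The minima over initial segments of coordinates decrease to the infimum and are
  DC-Lipschitz by the lattice property.\<close>

lemma pointwise_limit_least_coordinate:
  "pointwise_limit_of_DC_Lipschitz (cball 0 1) least_coordinate"
proof -
  define m where "m = rec_nat (\<lambda>x. \<bar>x @@ 0\<bar>) (\<lambda>n z x. min (z x) \<bar>(x :: l_infty) @@ (Suc n)\<bar>)"
  have m0: "m 0 = (\<lambda>x. \<bar>x @@ 0\<bar>)"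
    and mSuc: "\<And>n. m (Suc n) = (\<lambda>x. min (m n x) \<bar>x @@ (Suc n)\<bar>)"
    by (simp_all add: m_def)
  have DC: "DC_Lipschitz (cball 0 1) (\<lambda>x :: l_infty. \<bar>x @@ i\<bar>)" for i
    by (rule DC_Lipschitz_convex[OF convex_on_abs_coordinate[OF convex_cball] lipschitz_on_abs_coordinate])
  have "DC_Lipschitz (cball 0 1) (m n)" for n
    by (induction n) (simp_all add: m0 mSuc DC DC_Lipschitz_min)
  moreover have ge: "least_coordinate x \<le> m n x" for n x
    by (induction n) (simp_all add: m0 mSuc least_coordinate_le)
  have le: "m n x \<le> \<bar>x @@ i\<bar>" if "i \<le> n" for i n x
    using that
  proof (induction n)
    case (Suc n)
    then show ?case by (cases "i = Suc n") (auto simp: mSuc min_le_iff_disj)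
  qed (simp add: m0)
  have "(\<lambda>n. m n x) \<longlonglongrightarrow> least_coordinate x" for x
  proof (rule metric_LIMSEQ_I)
    fix e :: real assume "e > 0"
    then obtain i where i: "\<bar>x @@ i\<bar> < least_coordinate x + e"
      using least_coordinate_ge[of "least_coordinate x + e" x] by (meson less_add_same_cancel1 not_le)
    have "dist (m n x) (least_coordinate x) < e" if "n \<ge> i" for n
      using ge[of x n] le[OF that, of x] i unfolding dist_real_def by linarith
    then show "\<exists>N. \<forall>n\<ge>N. dist (m n x) (least_coordinate x) < e" by blast
  qed
  ultimately show ?thesis unfolding pointwise_limit_of_DC_Lipschitz_def by blast
qed

section \<open>Null sequences with blocks of coordinates\<close>

text \<open>Null sequences provide separability. The condition on pairs lets at most one block carry
  entries above 1/2 in absolute value, so one large entry makes all other blocks small. For constant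
  \<open>bl\<close> the set is the unit ball of \<open>c_0\<close>.\<close>

definition block_ball :: "(nat \<Rightarrow> nat) \<Rightarrow> l_infty set" where
  "block_ball bl = {x \<in> cball 0 1. (\<lambda>i. x @@ i) \<longlonglongrightarrow> 0 \<and>
     (\<forall>i j. bl i \<noteq> bl j \<longrightarrow> \<bar>x @@ i\<bar> + \<bar>x @@ j\<bar> \<le> 1)}"

lemma block_ballD:
  assumes "x \<in> block_ball bl"
  shows "\<bar>x @@ i\<bar> \<le> 1" "bl i \<noteq> bl j \<Longrightarrow> \<bar>x @@ i\<bar> + \<bar>x @@ j\<bar> \<le> 1"
    "(\<lambda>i. x @@ i) \<longlonglongrightarrow> 0"
  using assms mem_unit_cball_l_infty unfolding block_ball_def by auto

lemma bounded_block_ball: "bounded (block_ball bl)"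
  by (rule bounded_subset[OF bounded_cball[of 0 1]]) (auto simp: block_ball_def)

lemma closed_block_ball: "closed (block_ball bl)"
proof -
  have "closed {x :: l_infty. (\<lambda>i. x @@ i) \<longlonglongrightarrow> 0}"
    unfolding closed_sequential_limits
  proof (intro allI impI, elim conjE)
    fix s and x :: l_infty assume s: "\<forall>n. s n \<in> {x. (\<lambda>i. x @@ i) \<longlonglongrightarrow> 0}" "s \<longlonglongrightarrow> x"
    have "(\<lambda>i. x @@ i) \<longlonglongrightarrow> 0"
    proof (rule LIMSEQ_I)
      fix e :: real assume e: "e > 0"
      obtain n where n: "dist (s n) x < e / 2" using metric_LIMSEQ_D[OF s(2), of "e / 2"] e by auto
      have "(\<lambda>i. (s n) @@ i) \<longlonglongrightarrow> 0" using s(1) by blast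
      from LIMSEQ_D[OF this, of "e / 2"] e obtain N where
        N: "\<And>i. i \<ge> N \<Longrightarrow> \<bar>(s n) @@ i\<bar> < e / 2" by auto
      have "norm (x @@ i - 0) < e" if "i \<ge> N" for i
      proof -
        have "\<bar>(s n) @@ i - x @@ i\<bar> \<le> dist (s n) x"
          using dist_l_infty_le_iff[of "s n" x "dist (s n) x"] by blast
        then show ?thesis using N[OF that] n unfolding real_norm_def by linarith
      qed
      then show "\<exists>N. \<forall>i\<ge>N. norm (x @@ i - 0) < e" by blast
    qed
    then show "x \<in> {x. (\<lambda>i. x @@ i) \<longlonglongrightarrow> 0}" by simp
  qed
  moreover have "closed {x :: l_infty. bl i \<noteq> bl j \<longrightarrow> \<bar>x @@ i\<bar> + \<bar>x @@ j\<bar> \<le> 1}" for i j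
    by (cases "bl i \<noteq> bl j")
       (auto intro!: closed_Collect_le continuous_intros linear_continuous_on[OF l_infty_coordinate])
  ultimately have "closed (cball 0 1 \<inter> {x :: l_infty. (\<lambda>i. x @@ i) \<longlonglongrightarrow> 0} \<inter>
     (\<Inter>i. \<Inter>j. {x. bl i \<noteq> bl j \<longrightarrow> \<bar>x @@ i\<bar> + \<bar>x @@ j\<bar> \<le> 1}))"
    by (intro closed_Int closed_INT ballI closed_cball)
  also have "\<dots> = block_ball bl" by (auto simp: block_ball_def)
  finally show ?thesis .
qed

lemma convex_block_ball: "convex (block_ball bl)"
proof (rule convexI)
  fix x y and u v :: real assume *: "x \<in> block_ball bl" "y \<in> block_ball bl" "0 \<le> u" "0 \<le> v" "u + v = 1"
  note x = block_ballD[OF *(1)] and y = block_ballD[OF *(2)]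
  let ?z = "u *\<^sub>R x + v *\<^sub>R y"
  have le: "\<bar>?z @@ i\<bar> \<le> u * \<bar>x @@ i\<bar> + v * \<bar>y @@ i\<bar>" for i
    using *(3,4) abs_triangle_ineq[of "u * x @@ i" "v * y @@ i"] by (simp add: abs_mult)
  have "\<bar>?z @@ i\<bar> \<le> 1" for i
    by (rule order_trans[OF le]) (use * x(1) y(1) in \<open>auto intro!: convex_bound_le\<close>)
  then have "?z \<in> cball 0 1" unfolding mem_unit_cball_l_infty by blast
  moreover have "(\<lambda>i. ?z @@ i) \<longlonglongrightarrow> 0"
    using tendsto_add[OF tendsto_mult_left[OF x(3), of u] tendsto_mult_left[OF y(3), of v]] by simp
  moreover have "\<bar>?z @@ i\<bar> + \<bar>?z @@ j\<bar> \<le> 1" if "bl i \<noteq> bl j" for i j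
  proof -
    have "\<bar>?z @@ i\<bar> + \<bar>?z @@ j\<bar> \<le>
        u * (\<bar>x @@ i\<bar> + \<bar>x @@ j\<bar>) + v * (\<bar>y @@ i\<bar> + \<bar>y @@ j\<bar>)"
      using le[of i] le[of j] by (simp add: algebra_simps)
    also have "\<dots> \<le> 1" by (rule convex_bound_le) (use * x(2)[OF that] y(2)[OF that] in auto)
    finally show ?thesis .
  qed
  ultimately show "?z \<in> block_ball bl" by (simp add: block_ball_def)
qed

text \<open>Rounding finitely many entries to multiples of \<open>1 / k\<close> and dropping the
  small tail leaves countably many centres. The balls are closed and convex so that they can serve
  in \<open>CC_sigma\<close> too.\<close>

lemma null_sequences_countable_base:
  "\<exists>U :: nat \<Rightarrow> l_infty set. (\<forall>n. closed (U n)) \<and> (\<forall>n. convex (U n)) \<and>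
    (\<forall>x V. open V \<longrightarrow> x \<in> V \<longrightarrow> (\<lambda>i. x @@ i) \<longlonglongrightarrow> 0 \<longrightarrow> (\<exists>n. x \<in> U n \<and> U n \<subseteq> V))"
proof -
  define q where "q k l = (Bcontfun (\<lambda>i. if i < length l then real_of_int (l ! i) / real k else 0) :: l_infty)"
    for k :: nat and l :: "int list"
  have aq: "apply_bcontfun (q k l) = (\<lambda>i. if i < length l then real_of_int (l ! i) / real k else 0)" for k l
    unfolding q_def
  proof (rule apply_Bcontfun_l_infty)
    fix i
    show "\<bar>if i < length l then real_of_int (l ! i) / real k else 0\<bar> \<le> (\<Sum>j<length l. \<bar>real_of_int (l ! j) / real k\<bar>)"
      using member_le_sum[of i "{..<length l}" "\<lambda>j. \<bar>real_of_int (l ! j) / real k\<bar>"]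
      by (auto intro: sum_nonneg)
  qed
  \<comment> \<open>For \<open>k = 0\<close> division by zero gives the set consisting of 0 alone,
    still closed and convex.\<close>
  define U where "U n = (case from_nat n of (k, l) \<Rightarrow> cball (q k l) (1 / real k))" for n
  show ?thesis
  proof (intro exI[of _ U] conjI allI impI)
    show "closed (U n)" "convex (U n)" for n by (auto simp: U_def split: prod.splits)
    fix x :: l_infty and V assume V: "open V" "x \<in> V" and x: "(\<lambda>i. x @@ i) \<longlonglongrightarrow> 0"
    obtain e where e: "e > 0" "ball x e \<subseteq> V" using V openE by blast
    \<comment> \<open>A closed ball of radius \<open>1 / k\<close> around the rounded sequence
      contains \<open>x\<close> and has diameter below \<open>e\<close>.\<close>
    obtain k where k: "2 / e < real k" using reals_Archimedean2 by blast
    have "2 / e > 0" using e(1) by simp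
    then have k0: "real k > 0" using k by linarith
    obtain N where N: "\<And>i. i \<ge> N \<Longrightarrow> \<bar>x @@ i\<bar> < 1 / real k"
      using LIMSEQ_D[OF x, of "1 / real k"] k0 by auto
    define l where "l = map (\<lambda>i. \<lfloor>x @@ i * real k\<rfloor>) [0..<N]"
    have "\<bar>(q k l) @@ i - x @@ i\<bar> \<le> 1 / real k" for i
    proof (cases "i < N")
      case True
      have "\<bar>real_of_int \<lfloor>x @@ i * real k\<rfloor> - x @@ i * real k\<bar> \<le> 1" by linarith
      then have "\<bar>real_of_int \<lfloor>x @@ i * real k\<rfloor> - x @@ i * real k\<bar> / real k \<le> 1 / real k"
        using k0 by (intro divide_right_mono) auto
      also have "\<bar>real_of_int \<lfloor>x @@ i * real k\<rfloor> - x @@ i * real k\<bar> / real k =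
          \<bar>(real_of_int \<lfloor>x @@ i * real k\<rfloor> - x @@ i * real k) / real k\<bar>"
        by (simp add: abs_divide)
      also have "(real_of_int \<lfloor>x @@ i * real k\<rfloor> - x @@ i * real k) / real k =
          (q k l) @@ i - x @@ i"
        using True k0 by (simp add: aq l_def diff_divide_distrib)
      finally show ?thesis .
    next
      case False
      then show ?thesis using N[of i] by (simp add: aq l_def)
    qed
    then have d: "dist (q k l) x \<le> 1 / real k" by (simp add: dist_l_infty_le_iff)
    have "cball (q k l) (1 / real k) \<subseteq> ball x e"
    proof
      fix z assume "z \<in> cball (q k l) (1 / real k)"
      then have "dist x z \<le> 2 / real k" using d dist_triangle[of x z "q k l"] by (simp add: dist_commute)
      also have "\<dots> < e" using k k0 e(1) by (simp add: field_simps)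
      finally show "z \<in> ball x e" by simp
    qed
    then show "\<exists>n. x \<in> U n \<and> U n \<subseteq> V"
      using d e(2) by (intro exI[of _ "to_nat (k, l)"]) (auto simp: U_def)
  qed
qed

text \<open>By separability a relatively open set is the union of countably many closed convex sets
  cut out by the network; the sets subtracted are empty.\<close>

lemma CC_sigma_measurable_block_ball:
  assumes f: "continuous_on (block_ball bl) f"
  shows "CC_sigma_measurable (block_ball bl) f"
proof -
  let ?C = "block_ball bl"
  obtain U :: "nat \<Rightarrow> l_infty set" where U: "\<And>n. closed (U n)" "\<And>n. convex (U n)"
    "\<And>x V. open V \<Longrightarrow> x \<in> V \<Longrightarrow> (\<lambda>i. x @@ i) \<longlonglongrightarrow> 0 \<Longrightarrow> \<exists>n. x \<in> U n \<and> U n \<subseteq> V"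
    using null_sequences_countable_base by blast
  have *: "CC_sigma {x \<in> ?C. f x \<in> W}" if "open W" for W
  proof -
    obtain V where V: "open V" "V \<inter> ?C = f -` W \<inter> ?C"
      using f \<open>open W\<close> unfolding continuous_on_open_invariant by metis
    define A where "A n = (if U n \<subseteq> V then U n \<inter> ?C else {})" for n
    have "{x \<in> ?C. f x \<in> W} = (\<Union>n. A n - {})"
    proof
      show "{x \<in> ?C. f x \<in> W} \<subseteq> (\<Union>n. A n - {})"
      proof
        fix x assume x: "x \<in> {x \<in> ?C. f x \<in> W}"
        then obtain n where "x \<in> U n" "U n \<subseteq> V" using U(3)[OF V(1), of x] V(2) block_ballD(3) by blast
        then show "x \<in> (\<Union>n. A n - {})" using x by (auto simp: A_def)
      qed
      show "(\<Union>n. A n - {}) \<subseteq> {x \<in> ?C. f x \<in> W}" using V(2) by (auto simp: A_def split: if_splits)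
    qed
    moreover have "closed (A n)" "convex (A n)" for n
      unfolding A_def using U closed_block_ball convex_block_ball by (auto intro: closed_Int convex_Int)
    ultimately show ?thesis
      unfolding CC_sigma_def by (intro exI[of _ A] exI[of _ "\<lambda>_. {}"]) auto
  qed
  show ?thesis
    unfolding CC_sigma_measurable_def using *[of "{..<_}"] *[of "{_<..}"] by auto
qed

section \<open>Trees of nodes and the distance to the odd ones\<close>

definition support :: "l_infty \<Rightarrow> nat set" where
  "support x = {i. x @@ i \<noteq> 0}"

text \<open>Vertices of a tree inside one block: a node is the average of the two children obtained
  by adding plus or minus a unit vector of the block outside its support, and the step to a child
  changes parity.\<close>

definition nodes :: "(nat \<Rightarrow> nat) \<Rightarrow> nat \<Rightarrow> l_infty set" where
  "nodes bl n = {x. (\<forall>i. x @@ i \<in> {-1, 0, 1}) \<and> finite (support x) \<and> (\<forall>i\<in>support x. bl i = n)}"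

definition odd_points :: "(nat \<Rightarrow> nat) \<Rightarrow> l_infty set" where
  "odd_points bl = {x. \<exists>n. x \<in> nodes bl n \<and> odd (card (support x))}"

text \<open>Within distance 1/4 of an odd point some coordinate exceeds 3/4 in absolute value, which
  determines the block. The cap at 1/4 makes the function constant everywhere else.\<close>

definition parity_dist :: "(nat \<Rightarrow> nat) \<Rightarrow> l_infty \<Rightarrow> real" where
  "parity_dist bl x = min (1/4) (infdist x (odd_points bl))"

definition unit_vector :: "nat \<Rightarrow> l_infty" where
  "unit_vector i = Bcontfun (\<lambda>j. if j = i then 1 else 0)"

lemma apply_unit_vector: "apply_bcontfun (unit_vector i) = (\<lambda>j. if j = i then 1 else 0)"
  unfolding unit_vector_def by (rule apply_Bcontfun_l_infty[of _ 1]) simp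

lemma nodes_subset_block_ball: "nodes bl n \<subseteq> block_ball bl"
proof
  fix x assume x: "x \<in> nodes bl n"
  have v: "x @@ i \<in> {-1, 0, 1}" for i using x by (auto simp: nodes_def)
  have le: "\<bar>x @@ i\<bar> \<le> 1" for i using v[of i] by auto
  have "\<forall>\<^sub>F i in cofinite. x @@ i = 0"
    using x by (simp add: nodes_def support_def eventually_cofinite)
  then have "\<forall>\<^sub>F i in sequentially. x @@ i = 0" by (simp add: cofinite_eq_sequentially)
  then have "(\<lambda>i. x @@ i) \<longlonglongrightarrow> 0" by (rule tendsto_eventually)
  moreover have "\<bar>x @@ i\<bar> + \<bar>x @@ j\<bar> \<le> 1" if "bl i \<noteq> bl j" for i j
  proof -
    have "x @@ i = 0 \<or> x @@ j = 0" using x that by (auto simp: nodes_def support_def)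
    then show ?thesis using le by auto
  qed
  ultimately show "x \<in> block_ball bl"
    using le unfolding block_ball_def mem_Collect_eq mem_unit_cball_l_infty by blast
qed

lemma zero_node: "0 \<in> nodes bl n" "support 0 = {}"
  by (auto simp: nodes_def support_def)

lemma node_step:
  assumes x: "x \<in> nodes bl n" and i: "bl i = n" "i \<notin> support x" and s: "s = 1 \<or> s = -1"
  shows "x + s *\<^sub>R unit_vector i \<in> nodes bl n" "support (x + s *\<^sub>R unit_vector i) = insert i (support x)"
    "card (support (x + s *\<^sub>R unit_vector i)) = Suc (card (support x))"
proof -
  define y where "y = x + s *\<^sub>R unit_vector i"
  have ay: "y @@ j = (if j = i then s else x @@ j)" for j
    using i(2) by (simp add: y_def apply_unit_vector support_def)
  have supp: "support y = insert i (support x)"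
    using s unfolding support_def by (auto simp: ay)
  have "card (support y) = Suc (card (support x))"
    unfolding supp using x i(2) by (simp add: nodes_def)
  moreover have "y \<in> nodes bl n"
    using x i(1) s unfolding nodes_def mem_Collect_eq supp by (auto simp: ay)
  ultimately show "x + s *\<^sub>R unit_vector i \<in> nodes bl n"
    "support (x + s *\<^sub>R unit_vector i) = insert i (support x)"
    "card (support (x + s *\<^sub>R unit_vector i)) = Suc (card (support x))"
    using supp unfolding y_def by blast+
qed

lemma odd_points_nonempty: "odd_points bl \<noteq> {}"
  using node_step(1,3)[OF zero_node(1), of bl 0 "bl 0" 1] zero_node(2) 
  by (force simp: odd_points_def)

text \<open>Different integer points are at distance at least 1, so an even node lies beyond the
  cap.\<close>

lemma parity_dist_node:
  assumes x: "x \<in> nodes bl n"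
  shows "parity_dist bl x = (if odd (card (support x)) then 0 else 1/4)"
proof (cases "odd (card (support x))")
  case True
  then have "x \<in> odd_points bl" using x by (auto simp: odd_points_def)
  then show ?thesis using True by (simp add: parity_dist_def)
next
  case False
  have "1 \<le> dist x z" if "z \<in> odd_points bl" for z
  proof -
    have "x \<noteq> z" using that False by (auto simp: odd_points_def)
    then obtain i where i: "x @@ i \<noteq> z @@ i" using bcontfun_eqI by blast
    have "x @@ i \<in> {-1, 0, 1}" "z @@ i \<in> {-1, 0, 1}"
      using x that by (auto simp: nodes_def odd_points_def)
    then have "1 \<le> \<bar>x @@ i - z @@ i\<bar>" using i by auto
    also have "\<dots> \<le> dist x z" using dist_l_infty_le_iff[of x z "dist x z"] by blast
    finally show ?thesis .
  qed
  then have "1 \<le> infdist x (odd_points bl)"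
    unfolding infdist_notempty[OF odd_points_nonempty] by (intro cINF_greatest odd_points_nonempty)
  then show ?thesis using False by (simp add: parity_dist_def)
qed

lemma parity_dist_step:
  assumes "x \<in> nodes bl n" "bl i = n" "i \<notin> support x" "s = 1 \<or> s = -1"
  shows "dist (parity_dist bl x) (parity_dist bl (x + s *\<^sub>R unit_vector i)) = 1/4"
  using parity_dist_node[OF assms(1)] parity_dist_node[OF node_step(1)[OF assms]] node_step(3)[OF assms]
  by (simp add: dist_real_def)

lemma lipschitz_on_parity_dist: "1-lipschitz_on C (parity_dist bl)"
proof (rule lipschitz_onI)
  fix x y
  show "dist (parity_dist bl x) (parity_dist bl y) \<le> 1 * dist x y"
    using infdist_triangle_abs[of x "odd_points bl" y] unfolding parity_dist_def dist_real_def by linarith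
qed simp

text \<open>The complement of a half-space is convex, so a slice containing a node contains one of
  its two children, where the value jumps by 1/4. In a single infinite block every node has
  children.\<close>

lemma not_dentable_parity_dist:
  "\<not> dentable (block_ball (\<lambda>_. 0)) (parity_dist (\<lambda>_. 0))"
proof
  let ?bl = "\<lambda>_ :: nat. 0 :: nat" and ?A = "nodes (\<lambda>_. 0) 0"
  assume "dentable (block_ball ?bl) (parity_dist ?bl)"
  moreover have "?A \<noteq> {}" "?A \<subseteq> block_ball ?bl" "bounded ?A"
    using zero_node(1)[of ?bl 0] nodes_subset_block_ball[of ?bl 0]
      bounded_subset[OF bounded_block_ball nodes_subset_block_ball, of ?bl 0] by auto
  ultimately obtain H where H: "H \<in> open_halfspaces" "?A \<inter> H \<noteq> {}"
    "\<And>y z. y \<in> ?A \<Longrightarrow> y \<in> H \<Longrightarrow> z \<in> ?A \<Longrightarrow> z \<in> H \<Longrightarrow> dist (parity_dist ?bl y) (parity_dist ?bl z) \<le> 1/8"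
    using dentableE[of "block_ball ?bl" "parity_dist ?bl" ?A "1/8"] by (auto simp del: Int_iff)
  obtain x where x: "x \<in> ?A" "x \<in> H" using H(2) by blast
  then have "finite (support x)" by (simp add: nodes_def)
  then obtain i where i: "i \<notin> support x" using ex_new_if_finite infinite_UNIV_nat by blast
  define y where "y s = x + s *\<^sub>R unit_vector i" for s :: real
  have "y 1 \<in> H \<or> y (-1) \<in> H"
  proof (rule ccontr)
    assume *: "\<not> ?thesis"
    have "(1/2) *\<^sub>R y 1 + (1/2) *\<^sub>R y (-1) \<in> - H"
      by (rule convexD[OF convex_Compl_open_halfspaces[OF H(1)]]) (use * in auto)
    moreover have "(1/2) *\<^sub>R y 1 + (1/2) *\<^sub>R y (-1) = x" by (simp add: y_def algebra_simps flip: scaleR_add_left)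
    ultimately show False using x(2) by simp
  qed
  then obtain s where s: "s = 1 \<or> s = -1" "y s \<in> H" by blast
  have "dist (parity_dist ?bl x) (parity_dist ?bl (y s)) = 1/4" "y s \<in> ?A"
    unfolding y_def by (rule parity_dist_step node_step; use x i s in simp)+
  then show False using H(3)[OF x, of "y s"] s(2) by simp
qed

text \<open>The nearby point cannot vanish at \<open>i\<close>, and the support of a node lies in
  one block.\<close>

lemma odd_point_block:
  assumes z: "z \<in> odd_points bl" and d: "dist y z < 1/4" and i: "3/4 < \<bar>y @@ i\<bar>"
  shows "z \<in> nodes bl (bl i)" "\<exists>j. bl j = bl i \<and> \<bar>z @@ j\<bar> = 1"
proof -
  obtain n where z: "z \<in> nodes bl n" "odd (card (support z))" using z by (auto simp: odd_points_def)
  have "\<bar>y @@ i - z @@ i\<bar> < 1/4"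
    using dist_l_infty_le_iff[of y z "dist y z"] d by (meson le_less_trans order_refl)
  then have "z @@ i \<noteq> 0" using i by auto
  then have n: "n = bl i" using z(1) by (auto simp: nodes_def support_def)
  show "z \<in> nodes bl (bl i)" using z(1) n by simp
  have "support z \<noteq> {}" using z(2) by (metis card.empty even_zero)
  then obtain j where j: "z @@ j \<noteq> 0" by (auto simp: support_def)
  have "z @@ j \<in> {-1, 0, 1}" using z(1) by (auto simp: nodes_def)
  moreover have "bl j = bl i" using z(1) j n by (auto simp: nodes_def support_def)
  ultimately show "\<exists>j. bl j = bl i \<and> \<bar>z @@ j\<bar> = 1" using j by (intro exI[of _ j]) auto
qed

text \<open>
  If \<open>\<bar>y i\<bar> > 3/4\<close> then only the coordinates in the block of \<open>i\<close> matter: outside that block an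
  element of the ball is bounded by its distance to the nearest node within the block.
\<close>

lemma parity_dist_le_of_block:
  assumes v: "v \<in> block_ball bl" and i: "3/4 < \<bar>y @@ i\<bar>"
    and close: "\<And>j. bl j = bl i \<Longrightarrow> \<bar>y @@ j - v @@ j\<bar> \<le> \<eta>" and \<eta>: "\<eta> \<ge> 0"
  shows "parity_dist bl v \<le> parity_dist bl y + \<eta>"
proof (cases "infdist y (odd_points bl) < 1/4")
  case True
  have "infdist v (odd_points bl) \<le> infdist y (odd_points bl) + \<eta>"
  \<comment> \<open>The distance need not be attained, so every \<open>w\<close> slightly above the
    bound is tested; \<open>w < 1/4 + \<eta>\<close> keeps the odd point within 1/4 of
    \<open>y\<close>.\<close>
  proof (rule dense_ge_bounded)
    show "infdist y (odd_points bl) + \<eta> < 1/4 + \<eta>" using True by simp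
    fix w assume w: "infdist y (odd_points bl) + \<eta> < w" "w < 1/4 + \<eta>"
    then have "infdist y (odd_points bl) < w - \<eta>" by simp
    then obtain z where z: "z \<in> odd_points bl" "dist y z < w - \<eta>"
      by (rule infdist_lessE[OF _ odd_points_nonempty])
    have yz: "dist y z < 1/4" using z(2) w(2) by simp
    have coord: "\<bar>y @@ j - z @@ j\<bar> \<le> w - \<eta>" for j
      using dist_l_infty_le_iff[of y z "w - \<eta>"] z(2) by simp
    have zn: "z \<in> nodes bl (bl i)" by (rule odd_point_block[OF z(1) yz i])
    obtain k where k: "bl k = bl i" "\<bar>z @@ k\<bar> = 1" using odd_point_block(2)[OF z(1) yz i] by blast
    have in_block: "\<bar>v @@ j - z @@ j\<bar> \<le> w" if "bl j = bl i" for j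
      using coord[of j] close[OF that] by linarith
    have "\<bar>v @@ j - z @@ j\<bar> \<le> w" for j
    proof (cases "bl j = bl i")
      case False
      then have "z @@ j = 0" using zn by (auto simp: nodes_def support_def)
      moreover have "\<bar>v @@ j\<bar> + \<bar>v @@ k\<bar> \<le> 1"
        using block_ballD(2)[OF v, of j k] False k(1) by simp
      \<comment> \<open>As \<open>z\<close> has absolute value 1 at \<open>k\<close>, the room left
        for \<open>v\<close> at \<open>j\<close> is at most the deviation of \<open>v\<close> from
        \<open>z\<close> at \<open>k\<close>.\<close>
      ultimately show ?thesis using in_block[OF k(1)] k(2) by linarith
    qed (rule in_block)
    then have "dist v z \<le> w" by (simp add: dist_l_infty_le_iff)
    then show "infdist v (odd_points bl) \<le> w" using infdist_le2[OF z(1)] by blast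
  qed
  then show ?thesis using \<eta> unfolding parity_dist_def by linarith
next
  case False
  then show ?thesis using \<eta> unfolding parity_dist_def by linarith
qed

lemma convex_on_coordinate_square:
  fixes C :: "l_infty set"
  assumes "convex C"
  shows "convex_on C (\<lambda>x. (x @@ i)\<^sup>2)"
  using convex_on_square[OF convex_on_abs_coordinate[OF assms, of i]] by simp

text \<open>A point of \<open>A\<close> within 1/4 of an odd point has a large coordinate
  \<open>i\<close>. Nearly maximising a multiple of its absolute value plus the squares over the
  finite block of \<open>i\<close> keeps this coordinate large and, through the defect of the
  squares, makes the slice small in all coordinates of the block.\<close>

lemma dentable_parity_dist:
  assumes fin: "\<And>n. finite {i. bl i = n}"
  shows "dentable (block_ball bl) (parity_dist bl)"
proof (rule dentableI)
  let ?C = "block_ball bl"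
  fix A :: "l_infty set" and e :: real assume A: "A \<noteq> {}" "A \<subseteq> ?C" and e: "e > 0"
  show "\<exists>H\<in>open_halfspaces. A \<inter> H \<noteq> {} \<and>
      (\<forall>y\<in>A \<inter> H. \<forall>z\<in>A \<inter> H. dist (parity_dist bl y) (parity_dist bl z) \<le> e)"
  proof (cases "\<forall>x\<in>A. parity_dist bl x = 1/4")
    case True
    have "dist (parity_dist bl y) (parity_dist bl z) \<le> e" if "y \<in> A" "z \<in> A" for y z
      unfolding bspec[OF True that(1)] bspec[OF True that(2)] using e by simp
    then show ?thesis using A(1) by (intro bexI[of _ UNIV]) auto
  next
    case False
    then obtain x where x: "x \<in> A" "parity_dist bl x \<noteq> 1/4" by blast
    then have "infdist x (odd_points bl) < 1/4" by (auto simp: parity_dist_def min_def split: if_splits)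
    then obtain z where z: "z \<in> odd_points bl" "dist x z < 1/4"
      by (rule infdist_lessE[OF _ odd_points_nonempty])
    then obtain n where zn: "z \<in> nodes bl n" "odd (card (support z))" by (auto simp: odd_points_def)
    have "support z \<noteq> {}" using zn(2) by (metis card.empty even_zero)
    then obtain i where i: "z @@ i \<noteq> 0" by (auto simp: support_def)
    have "z @@ i \<in> {-1, 0, 1}" using zn(1) by (auto simp: nodes_def)
    then have "\<bar>z @@ i\<bar> = 1" using i by auto
    moreover have "\<bar>x @@ i - z @@ i\<bar> < 1/4"
      using dist_l_infty_le_iff[of x z "dist x z"] z(2) by (meson le_less_trans order_refl)
    ultimately have xi: "3/4 < \<bar>x @@ i\<bar>" by linarith
    define J where "J = {j. bl j = bl i}"
    have J: "finite J" using fin by (simp add: J_def)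
    \<comment> \<open>Lowering the coordinate from its size at \<open>x\<close> to 3/4 costs
      \<open>card J + 1\<close>, which the squares (at most \<open>card J\<close>) and the depth
      \<delta> \<le> 1 of the slice cannot make up.\<close>
    define K where "K = (real (card J) + 1) / (\<bar>x @@ i\<bar> - 3/4)"
    have K: "K > 0" "K * (\<bar>x @@ i\<bar> - 3/4) = real (card J) + 1"
      using xi by (auto simp: K_def)
    define \<phi> where "\<phi> y = K * \<bar>y @@ i\<bar> + (\<Sum>j\<in>J. (y @@ j)\<^sup>2)" for y :: l_infty
    have conv: "convex_on ?C \<phi>"
      unfolding \<phi>_def using K(1)
      by (intro convex_on_add convex_on_cmul convex_on_sum_functions convex_on_abs_coordinate
          convex_on_coordinate_square convex_block_ball) auto
    have cont: "continuous_on ?C \<phi>"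
      unfolding \<phi>_def by (intro continuous_intros linear_continuous_on[OF l_infty_coordinate])
    have sq: "0 \<le> (\<Sum>j\<in>J. (y @@ j)\<^sup>2)" "(\<Sum>j\<in>J. (y @@ j)\<^sup>2) \<le> real (card J)"
      if "y \<in> ?C" for y
    proof -
      show "0 \<le> (\<Sum>j\<in>J. (y @@ j)\<^sup>2)" by (intro sum_nonneg) auto
      have "(\<Sum>j\<in>J. (y @@ j)\<^sup>2) \<le> (\<Sum>j\<in>J. 1)"
        using block_ballD(1)[OF that] by (intro sum_mono) (simp add: abs_square_le_1)
      then show "(\<Sum>j\<in>J. (y @@ j)\<^sup>2) \<le> real (card J)" by simp
    qed
    have "\<phi> y \<le> K + real (card J)" if "y \<in> ?C" for y
    proof -
      have "K * \<bar>y @@ i\<bar> \<le> K * 1" using block_ballD(1)[OF that] K(1) by (intro mult_left_mono) auto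
      then show ?thesis using sq(2)[OF that] by (simp add: \<phi>_def)
    qed
    then have "bdd_above (\<phi> ` A)" using A(2) by (intro bdd_aboveI2) auto
    then have le: "\<phi> y \<le> Sup (\<phi> ` A)" if "y \<in> A" for y using that by (auto intro: cSUP_upper)
    define \<eta> where "\<eta> = min e 1"
    have \<eta>: "0 < \<eta>" "\<eta> \<le> e" "\<eta> \<le> 1" using e by (auto simp: \<eta>_def)
    \<comment> \<open>A coordinate contributes half the square of its difference to a defect below
      \<open>2 * \<delta>\<close>, which bounds the difference by \<eta>; \<eta> \<le> 1 ensures
      \<delta> \<le> 1.\<close>
    define \<delta> where "\<delta> = \<eta>\<^sup>2 / 4"
    have \<delta>: "0 < \<delta>" "\<delta> \<le> 1" using \<eta> power_le_one[of \<eta> 2] by (auto simp: \<delta>_def)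
    obtain x0 where x0: "x0 \<in> A" "\<phi> x0 > Sup (\<phi> ` A) - \<delta>"
      using less_cSupD[of "\<phi> ` A" "Sup (\<phi> ` A) - \<delta>"] A(1) \<delta>(1) by auto
    obtain H where H: "H \<in> open_halfspaces" "x0 \<in> H"
      and val: "\<And>y. y \<in> A \<Longrightarrow> y \<in> H \<Longrightarrow> \<phi> y > Sup (\<phi> ` A) - \<delta>"
      and defect: "\<And>y z. y \<in> A \<Longrightarrow> y \<in> H \<Longrightarrow> z \<in> A \<Longrightarrow> z \<in> H \<Longrightarrow> \<phi> y + \<phi> z - 2 * \<phi> (midpoint y z) < 2 * \<delta>"
      by (rule almost_maximal_slice[OF closed_block_ball conv cont A(2) le x0]) blast+
    have big: "3/4 < \<bar>y @@ i\<bar>" if y: "y \<in> A" "y \<in> H" for y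
    proof -
      have "K * \<bar>x @@ i\<bar> - \<delta> < \<phi> y"
        using val[OF y] le[OF x(1)] sq(1)[of x] x(1) A(2) by (auto simp: \<phi>_def)
      also have "\<phi> y \<le> K * \<bar>y @@ i\<bar> + real (card J)" using sq(2)[of y] y(1) A(2) by (auto simp: \<phi>_def)
      finally have "0 < K * (\<bar>y @@ i\<bar> - 3/4)" using K(2) \<delta>(2) by (simp add: algebra_simps)
      then show ?thesis using K(1) by (simp add: zero_less_mult_iff)
    qed
    have near: "\<bar>y @@ j - z @@ j\<bar> \<le> \<eta>"
      if y: "y \<in> A" "y \<in> H" and z: "z \<in> A" "z \<in> H" and j: "bl j = bl i" for y z j
    proof -
      let ?d = "\<lambda>j. (y @@ j)\<^sup>2 + (z @@ j)\<^sup>2 - 2 * ((midpoint y z) @@ j)\<^sup>2"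
      have d: "?d j = (y @@ j - z @@ j)\<^sup>2 / 2" for j
        by (simp add: midpoint_def power2_eq_square field_simps)
      have abs_mid: "2 * \<bar>(midpoint y z) @@ i\<bar> \<le> \<bar>y @@ i\<bar> + \<bar>z @@ i\<bar>"
        using convex_on_midpoint(2)[OF convex_on_abs_coordinate[OF convex_UNIV]] by blast
      have "?d j \<le> (\<Sum>j\<in>J. ?d j)" unfolding d
        by (rule member_le_sum) (use j J in \<open>auto simp: J_def\<close>)
      also have "\<dots> = (\<Sum>j\<in>J. (y @@ j)\<^sup>2) + (\<Sum>j\<in>J. (z @@ j)\<^sup>2) -
          2 * (\<Sum>j\<in>J. ((midpoint y z) @@ j)\<^sup>2)"
        by (simp add: sum.distrib sum_subtractf sum_distrib_left)
      also have "\<dots> = (\<phi> y + \<phi> z - 2 * \<phi> (midpoint y z)) -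
          K * (\<bar>y @@ i\<bar> + \<bar>z @@ i\<bar> - 2 * \<bar>(midpoint y z) @@ i\<bar>)"
        by (simp add: \<phi>_def algebra_simps)
      also have "\<dots> \<le> \<phi> y + \<phi> z - 2 * \<phi> (midpoint y z)" using K(1) abs_mid by simp
      also have "\<dots> < 2 * \<delta>" by (rule defect[OF y z])
      finally have "(y @@ j - z @@ j)\<^sup>2 \<le> \<eta>\<^sup>2" unfolding d by (simp add: \<delta>_def)
      then show ?thesis using \<eta>(1) abs_le_square_iff[of "y @@ j - z @@ j" \<eta>] by simp
    qed
    have one: "parity_dist bl z \<le> parity_dist bl y + \<eta>"
      if "y \<in> A" "y \<in> H" "z \<in> A" "z \<in> H" for y z
      by (rule parity_dist_le_of_block[OF _ big near]) (use that A(2) \<eta>(1) in auto)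
    show ?thesis
    proof (intro bexI[OF _ H(1)] conjI ballI)
      show "A \<inter> H \<noteq> {}" using x0(1) H(2) by blast
      fix y z assume "y \<in> A \<inter> H" "z \<in> A \<inter> H"
      then show "dist (parity_dist bl y) (parity_dist bl z) \<le> e"
        using one[of y z] one[of z y] \<eta>(2) by (simp add: dist_real_def abs_le_iff)
    qed
  qed
qed

lemma countably_dentable_parity_dist:
  assumes "\<And>n. finite {i. bl i = n}"
  shows "countably_dentable (block_ball bl) (parity_dist bl)"
proof -
  obtain U :: "nat \<Rightarrow> l_infty set" where "\<And>n. closed (U n)" "\<And>n. convex (U n)"
    and U: "\<And>x V. open V \<Longrightarrow> x \<in> V \<Longrightarrow> (\<lambda>i. x @@ i) \<longlonglongrightarrow> 0 \<Longrightarrow> \<exists>n. x \<in> U n \<and> U n \<subseteq> V"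
    using null_sequences_countable_base by blast
  have base: "\<exists>n. x \<in> U n \<and> U n \<subseteq> V" if V: "open V" "x \<in> block_ball bl \<inter> V" for x V
    by (rule U[OF V(1)]) (use V(2) block_ballD(3) in auto)
  have "inj unit_vector"
  proof (rule injI)
    fix i j assume "unit_vector i = unit_vector j"
    then have "(unit_vector i) @@ i = (unit_vector j) @@ i" by simp
    then show "i = j" by (simp add: apply_unit_vector split: if_splits)
  qed
  then have "infinite (UNIV :: l_infty set)"
    using infinite_super[OF subset_UNIV] range_inj_infinite by blast
  then show ?thesis
    by (rule countably_dentableI[OF dentable_parity_dist[OF assms] bounded_block_ball closed_block_ball
          convex_block_ball _ base])
qed

text \<open>
  A midpoint control function grows by \<open>\<delta>\<close> along some path of nodes of length the size of the block.
\<close>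

lemma not_uniform_limit_parity_dist:
  assumes fin: "\<And>n. finite {i. bl i = n}" and unbdd: "\<And>k. \<exists>n. k \<le> card {i. bl i = n}"
  shows "\<not> uniform_limit_of_DC_bounded (block_ball bl) (parity_dist bl)"
proof
  let ?C = "block_ball bl"
  assume "uniform_limit_of_DC_bounded ?C (parity_dist bl)"
  then obtain \<phi> where \<phi>: "midpoint_control ?C (parity_dist bl) (1/8) \<phi>" "bounded (\<phi> ` ?C)"
    \<comment> \<open>Any positive scale below the jump 1/4 between a node and its children will
      do.\<close>
    by (rule uniform_limit_of_DC_bounded_midpoint_control[where \<epsilon> = "1/8"]) auto
  obtain \<delta> where conv: "convex_on ?C \<phi>" and \<delta>: "\<delta> > 0"
    and ctrl: "\<And>x y. x \<in> ?C \<Longrightarrow> y \<in> ?C \<Longrightarrow> dist (parity_dist bl x) (parity_dist bl y) > 1/8 \<Longrightarrow>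
      \<delta> \<le> \<phi> x + \<phi> y - 2 * \<phi> (midpoint x y)"
    using \<phi>(1) unfolding midpoint_control_def by auto
  obtain P where P: "\<And>x. x \<in> ?C \<Longrightarrow> \<bar>\<phi> x\<bar> \<le> P" using \<phi>(2) by (auto simp: bounded_iff)
  obtain k :: nat where k: "2 * P < real k * \<delta>" using reals_Archimedean3[OF \<delta>] by blast
  obtain n where n: "k \<le> card {i. bl i = n}" using unbdd by blast
  have path: "\<exists>x\<in>nodes bl n. card (support x) = m \<and> \<phi> 0 + real m * \<delta> \<le> \<phi> x" if "m \<le> k" for m
    using that
  proof (induction m)
    case 0
    show ?case using zero_node(1)[of bl n] zero_node(2) by (intro bexI[of _ 0]) auto
  next
    case (Suc m)
    then obtain x where x: "x \<in> nodes bl n" "card (support x) = m" "\<phi> 0 + real m * \<delta> \<le> \<phi> x" by auto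
    have fs: "finite (support x)" using x(1) by (auto simp: nodes_def)
    have "card (support x) < card {i. bl i = n}" using x(2) Suc(2) n by simp
    then have "\<not> {i. bl i = n} \<subseteq> support x" using card_mono[OF fs] by (meson not_le)
    then obtain i where i: "bl i = n" "i \<notin> support x" by blast
    define y where "y s = x + s *\<^sub>R unit_vector i" for s :: real
    have y: "y s \<in> nodes bl n" "card (support (y s)) = Suc m" "\<delta> \<le> \<phi> x + \<phi> (y s) - 2 * \<phi> (midpoint x (y s))"
      and mid: "midpoint x (y s) \<in> ?C"
      if s: "s = 1 \<or> s = -1" for s
    proof -
      show yn: "y s \<in> nodes bl n" "card (support (y s)) = Suc m"
        unfolding y_def using node_step[OF x(1) i s] x(2) by auto
      have C: "x \<in> ?C" "y s \<in> ?C" using x(1) yn nodes_subset_block_ball by blast+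
      show "\<delta> \<le> \<phi> x + \<phi> (y s) - 2 * \<phi> (midpoint x (y s))"
        by (rule ctrl[OF C]) (use parity_dist_step[OF x(1) i s] in \<open>simp add: y_def\<close>)
      show "midpoint x (y s) \<in> ?C" by (rule convex_on_midpoint(1)[OF conv C])
    qed
    \<comment> \<open>\<open>x\<close> is also the midpoint of the two midpoints. Adding the two
      defects and using convexity at \<open>x\<close>, the children together gain
      \<open>2 * \<delta>\<close>, hence one of them gains \<delta>.\<close>
    have "midpoint (midpoint x (y 1)) (midpoint x (y (-1))) = x"
      by (simp add: y_def midpoint_def algebra_simps flip: scaleR_add_left)
    then have "2 * \<phi> x \<le> \<phi> (midpoint x (y 1)) + \<phi> (midpoint x (y (-1)))"
      using convex_on_midpoint(2)[OF conv mid[of 1] mid[of "-1"]] by simp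
    then have "\<phi> x + \<delta> \<le> \<phi> (y 1) \<or> \<phi> x + \<delta> \<le> \<phi> (y (-1))"
      using y(3)[of 1] y(3)[of "-1"] by linarith
    then obtain s where "s = 1 \<or> s = -1" "\<phi> x + \<delta> \<le> \<phi> (y s)" by blast
    then show ?case using y(1,2)[of s] x(3) by (intro bexI[of _ "y s"]) (auto simp: algebra_simps)
  qed
  obtain x where x: "x \<in> nodes bl n" "\<phi> 0 + real k * \<delta> \<le> \<phi> x" using path[of k] by blast
  then have "x \<in> ?C" "0 \<in> ?C" using nodes_subset_block_ball zero_node(1) by blast+
  from P[OF this(1)] P[OF this(2)] show False using x(2) k by linarith
qed

text \<open>\<open>floor_sqrt\<close> serves as block map: the block of \<open>n\<close> reaches
  from \<open>n\<^sup>2\<close> to just before \<open>(Suc n)\<^sup>2\<close>, so blocks are finite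
  but of unbounded size.\<close>

lemma finite_floor_sqrt_fiber: "finite {i. floor_sqrt i = n}"
proof (rule finite_subset)
  show "{i. floor_sqrt i = n} \<subseteq> {..<(Suc n)\<^sup>2}" using Suc_floor_sqrt_power2_gt by auto
qed simp

lemma card_floor_sqrt_fiber: "n \<le> card {i. floor_sqrt i = n}"
proof -
  have "{n\<^sup>2..<n\<^sup>2 + n} \<subseteq> {i. floor_sqrt i = n}"
    by (auto intro!: floor_sqrt_unique simp: power2_eq_square)
  from card_mono[OF finite_floor_sqrt_fiber this] show ?thesis by simp
qed

theorem theorem4p1:
  shows
    "(\<forall>(C :: 'a::banach set) (f :: 'a \<Rightarrow> real).
        bounded C \<and> closed C \<and> convex C \<and> uniformly_continuous_on C f \<longrightarrow>
          (uniform_limit_of_DC_bounded C f \<longleftrightarrow> finitely_dentable C f) \<and>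
          (finitely_dentable C f \<longleftrightarrow> uniform_limit_of_DC_Lipschitz C f) \<and>
          (uniform_limit_of_DC_Lipschitz C f \<longrightarrow> countably_dentable C f) \<and>
          (countably_dentable C f \<longrightarrow> CC_sigma_measurable C f) \<and>
          (CC_sigma_measurable C f \<longrightarrow> pointwise_limit_of_DC_Lipschitz C f)) \<and>
     (\<exists>(C :: l_infty set) (f :: l_infty \<Rightarrow> real).
        bounded C \<and> closed C \<and> convex C \<and> uniformly_continuous_on C f \<and>
        pointwise_limit_of_DC_Lipschitz C f \<and> \<not> CC_sigma_measurable C f) \<and>
     (\<exists>(C :: l_infty set) (f :: l_infty \<Rightarrow> real).
        bounded C \<and> closed C \<and> convex C \<and> uniformly_continuous_on C f \<and>
        CC_sigma_measurable C f \<and> \<not> countably_dentable C f) \<and>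
     (\<exists>(C :: l_infty set) (f :: l_infty \<Rightarrow> real).
        bounded C \<and> closed C \<and> convex C \<and> uniformly_continuous_on C f \<and>
        countably_dentable C f \<and> \<not> uniform_limit_of_DC_Lipschitz C f)"
proof (intro conjI allI impI)
  fix C :: "'a set" and f :: "'a \<Rightarrow> real"
  assume "bounded C \<and> closed C \<and> convex C \<and> uniformly_continuous_on C f"
  then have C: "bounded C" "closed C" "convex C" and f: "uniformly_continuous_on C f" by auto
  have i_ii: "finitely_dentable C f" if "uniform_limit_of_DC_bounded C f"
  proof -
    have "\<exists>\<phi>. midpoint_control C f \<epsilon> \<phi> \<and> continuous_on C \<phi> \<and> bounded (\<phi> ` C)" if "\<epsilon> > 0" for \<epsilon>
      using uniform_limit_of_DC_bounded_midpoint_control[OF \<open>uniform_limit_of_DC_bounded C f\<close> that] by blast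
    then show ?thesis
      unfolding finitely_dentable_iff[OF C]
      by (meson midpoint_control_dentable[OF C(2)] midpoint_control_slice_derivative_funpow[OF C(2)] less_imp_le)
  qed
  have ii_iii: "uniform_limit_of_DC_Lipschitz C f" if "finitely_dentable C f"
    using that uniform_limit_of_DC_Lipschitz_if_slice_derivatives_vanish[OF C(2,3,1) f]
    unfolding finitely_dentable_iff[OF C] by blast
  have iii_i: "uniform_limit_of_DC_bounded C f" if "uniform_limit_of_DC_Lipschitz C f"
    by (rule uniform_limit_of_DC_Lipschitz_imp_DC_bounded[OF C(1) that])
  show "uniform_limit_of_DC_bounded C f \<longleftrightarrow> finitely_dentable C f"
    "finitely_dentable C f \<longleftrightarrow> uniform_limit_of_DC_Lipschitz C f"
    using i_ii ii_iii iii_i by blast+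
  \<comment> \<open>Through (i) to (ii); a finite index is in particular below
    \<open>cardSuc natLeq\<close>.\<close>
  show "countably_dentable C f" if "uniform_limit_of_DC_Lipschitz C f"
    using that i_ii iii_i finitely_dentable_imp_countably_dentable by blast
  show "CC_sigma_measurable C f" if "countably_dentable C f"
    by (rule countably_dentable_imp_CC_sigma_measurable[OF that C])
  show "pointwise_limit_of_DC_Lipschitz C f" if "CC_sigma_measurable C f"
    by (rule CC_sigma_measurable_imp_pointwise_limit[OF C(3)
          uniformly_continuous_on_convex_bounded_image[OF C(3,1) f] that])
next
  show "\<exists>(C :: l_infty set) (f :: l_infty \<Rightarrow> real).
        bounded C \<and> closed C \<and> convex C \<and> uniformly_continuous_on C f \<and>
        pointwise_limit_of_DC_Lipschitz C f \<and> \<not> CC_sigma_measurable C f"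
    by (intro exI[of _ "cball 0 1"] exI[of _ least_coordinate] conjI bounded_cball closed_cball convex_cball
        pointwise_limit_least_coordinate not_CC_sigma_measurable_least_coordinate
        lipschitz_on_uniformly_continuous[OF lipschitz_on_least_coordinate])
next
  let ?C = "block_ball (\<lambda>_. 0)" and ?f = "parity_dist (\<lambda>_. 0)"
  have "uniformly_continuous_on ?C ?f"
    by (rule lipschitz_on_uniformly_continuous[OF lipschitz_on_parity_dist])
  moreover have "CC_sigma_measurable ?C ?f"
    by (rule CC_sigma_measurable_block_ball[OF lipschitz_on_continuous_on[OF lipschitz_on_parity_dist]])
  moreover have "\<not> countably_dentable ?C ?f"
    using not_dentable_parity_dist by (simp add: countably_dentable_def)
  ultimately show "\<exists>(C :: l_infty set) (f :: l_infty \<Rightarrow> real).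
        bounded C \<and> closed C \<and> convex C \<and> uniformly_continuous_on C f \<and>
        CC_sigma_measurable C f \<and> \<not> countably_dentable C f"
    using bounded_block_ball closed_block_ball convex_block_ball by blast
next
  let ?C = "block_ball floor_sqrt" and ?f = "parity_dist floor_sqrt"
  have "uniformly_continuous_on ?C ?f"
    by (rule lipschitz_on_uniformly_continuous[OF lipschitz_on_parity_dist])
  moreover have "countably_dentable ?C ?f"
    by (rule countably_dentable_parity_dist[OF finite_floor_sqrt_fiber])
  moreover have "\<not> uniform_limit_of_DC_bounded ?C ?f"
    by (rule not_uniform_limit_parity_dist[OF finite_floor_sqrt_fiber]) (use card_floor_sqrt_fiber in blast)
  then have "\<not> uniform_limit_of_DC_Lipschitz ?C ?f"
    using uniform_limit_of_DC_Lipschitz_imp_DC_bounded[OF bounded_block_ball] by blast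
  ultimately show "\<exists>(C :: l_infty set) (f :: l_infty \<Rightarrow> real).
        bounded C \<and> closed C \<and> convex C \<and> uniformly_continuous_on C f \<and>
        countably_dentable C f \<and> \<not> uniform_limit_of_DC_Lipschitz C f"
    using bounded_block_ball closed_block_ball convex_block_ball by blast
qed

end
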